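(* There exist universal positive constants $K_1,\dots,K_7$ such that the following holds. Suppose every weight matrix $W_1,\dots,W_d$ satisfies the WDC with constant $\epsilon$ and $A$ satisfies the RRIC with respect to $G$ with constant $\epsilon$, where $0<\epsilon\le K_1/d^{90}$, and suppose the noise $e$ obeys $\|e\|\le \frac{K_2\|x_*\|}{d^{42}2^{d/2}}$. Let $\{x_i\}_{i\ge 0}$ be iterates generated by the subgradient algorithm described in the context (from an arbitrary initial point $x_0\in\mathbb{R}^k\setminus\{0\}$) with step size $\nu=K_3\frac{2^d}{d^2}$. Then there exists a number of iterations $N$ with $$N\le \frac{K_4 f(x_0)2^d}{d^4\epsilon\|x_*\|^2}$$ such that $$\|x_N-x_*\|\le K_5 d^9\|x_*\|\sqrt{\epsilon}+K_6 d^6 2^{d/2}\|e\|.$$ In addition, for all $i\ge N$, $$\|x_{i+1}-x_*\|\le C^{\,i+1-N}\|x_N-x_*\|+K_7 2^{d/2}\|e\|$$ and $$\|G(x_{i+1})-G(x_* )\|\le \frac{1.2}{2^{d/2}}C^{\,i+1-N}\|x_N-x_*\|+1.2K_7\|e\|,$$ where $C=1-\frac{\nu}{2^d}\frac78\in(0,1)$.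
   Context: Setting. Let $d,k,m$ be positive integers, $n_0=k$, and $n_1,\dots,n_d=n$ positive integers; $W_i\in\mathbb{R}^{n_i\times n_{i-1}}$ for $i=1,\dots,d$; $\mathrm{relu}(a)=\max(a,0)$ applied entrywise. The generator $G:\mathbb{R}^k\to\mathbb{R}^n$ is $G(x)=\mathrm{relu}(W_d\cdots\mathrm{relu}(W_2\,\mathrm{relu}(W_1x))\cdots)$. Let $A\in\mathbb{R}^{m\times n}$, $x_*\in\mathbb{R}^k$ nonzero, $e\in\mathbb{R}^m$, $y=AG(x_* )+e$, and $f(x)=\frac12\|AG(x)-y\|^2$. $\|\cdot\|$ is the Euclidean norm of vectors and the spectral norm of matrices. For $x\in\mathbb{R}^k$ set $W_{1,+,x}=\mathrm{diag}(W_1x>0)W_1$ and $W_{i,+,x}=\mathrm{diag}(W_iW_{i-1,+,x}\cdots W_{1,+,x}x>0)W_i$, where $\mathrm{diag}(w>0)$ is the diagonal 0/1 matrix whose $j$th diagonal entry is 1 iff $w_j>0$. Let $\Lambda_x=W_{d,+,x}W_{d-1,+,x}\cdots W_{1,+,x}$. Clarke subdifferential: for locally Lipschitz $f$, $f^o(x;u)=\limsup_{y\to x,\,t\downarrow0}\frac{f(y+tu)-f(y)}{t}$ and $\partial f(x)=\{v:\langle v,u\rangle\le f^o(x;u)\ \forall u\}$. Weight Distribution Condition (WDC) with constant $\epsilon$ for $W\in\mathbb{R}^{p\times q}$ with rows $w_i^T$: for all nonzero $x,y\in\mathbb{R}^q$, $\left\|\sum_{i=1}^p 1_{w_i\cdot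 x>0}1_{w_i\cdot y>0}w_iw_i^T-Q_{x,y}\right\|\le\epsilon$, where $Q_{x,y}=\frac{\pi-\theta}{2\pi}I+\frac{\sin\theta}{2\pi}M_{\hat x\leftrightarrow\hat y}$, $\theta=\angle(x,y)$, $\hat x=x/\|x\|$, $\hat y=y/\|y\|$, and $M_{\hat x\leftrightarrow\hat y}$ is the matrix mapping $\hat x\mapsto\hat y$, $\hat y\mapsto\hat x$, and $z\mapsto0$ for $z\in\mathrm{span}(\{x,y\})^\perp$. Range Restricted Isometry Condition (RRIC) of $A$ with respect to $G$ with constant $\epsilon$: for all $x_1,x_2,x_3,x_4\in\mathbb{R}^k$, $|\langle A(G(x_1)-G(x_2)),A(G(x_3)-G(x_4))\rangle-\langle G(x_1)-G(x_2),G(x_3)-G(x_4)\rangle|\le\epsilon\|G(x_1)-G(x_2)\|\|G(x_3)-G(x_4)\|$. Algorithm (with step size $\nu>0$): choose any $x_0\in\mathbb{R}^k\setminus\{0\}$. For $i=0,1,\dots$: set $\tilde x_i=-x_i$ if $f(-x_i)<f(x_i)$, and $\tilde x_i=x_i$ otherwise; choose $v_{\tilde x_i}\in\partial f(\tilde x_i)$ (in particular, if $G$ is differentiable at $\tilde x_i$, then $v_{\tilde x_i}=\Lambda_{\tilde x_i}^TA^T(A\Lambda_{\tilde x_i}\tilde x_i-y)$); set $x_{i+1}=\tilde x_i-\nu v_{\tilde x_i}$. *)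

theory Defs
  imports
    Complex_Main
    "HOL-Library.Extended_Real"
    "HOL-Library.Liminf_Limsup"
    "Jordan_Normal_Form.Matrix"
begin

(* The constants of the theorem are chosen before the depth and the layer widths, so the
   dimensions have to be ordinary natural numbers rather than types. Vectors and matrices
   therefore are those of Jordan_Normal_Form, with explicit carriers. *)

definition vnorm :: "real vec \<Rightarrow> real" where
  "vnorm v = sqrt (v \<bullet> v)"

definition spectral_norm :: "real mat \<Rightarrow> real" where
  "spectral_norm M = Sup {vnorm (M *\<^sub>v v) | v. v \<in> carrier_vec (dim_col M) \<and> vnorm v \<le> 1}"

definition vunit :: "real vec \<Rightarrow> real vec" where
  "vunit x = (1 / vnorm x) \<cdot>\<^sub>v x"

definition vangle :: "real vec \<Rightarrow> real vec \<Rightarrow> real" where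
  "vangle x y = arccos ((x \<bullet> y) / (vnorm x * vnorm y))"


definition relu_vec :: "real vec \<Rightarrow> real vec" where
  "relu_vec v = map_vec (\<lambda>a. max a 0) v"

(* gen_net W d is the generator G with weights W 1, ..., W d; the value W 0 is not used. *)
fun gen_net :: "(nat \<Rightarrow> real mat) \<Rightarrow> nat \<Rightarrow> real vec \<Rightarrow> real vec" where
  "gen_net W 0 x = x"
| "gen_net W (Suc i) x = relu_vec (W (Suc i) *\<^sub>v gen_net W i x)"


(* On nonzero x, y of equal dimension exactly one matrix fits the description; for parallel
   x, y the two mapping conditions coincide. *)
definition swap_mat :: "real vec \<Rightarrow> real vec \<Rightarrow> real mat" where
  "swap_mat x y = (THE M. M \<in> carrier_mat (dim_vec x) (dim_vec x) \<and>
     M *\<^sub>v vunit x = vunit y \<and> M *\<^sub>v vunit y = vunit x \<and>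
     (\<forall>z \<in> carrier_vec (dim_vec x). z \<bullet> x = 0 \<and> z \<bullet> y = 0 \<longrightarrow> M *\<^sub>v z = 0\<^sub>v (dim_vec x)))"

definition Q_mat :: "real vec \<Rightarrow> real vec \<Rightarrow> real mat" where
  "Q_mat x y = ((pi - vangle x y) / (2 * pi)) \<cdot>\<^sub>m 1\<^sub>m (dim_vec x) +
               (sin (vangle x y) / (2 * pi)) \<cdot>\<^sub>m swap_mat x y"

(* Entry (a, b) of the sum of the outer products w w^T, taken over the rows w of W that have
   positive inner product with both x and y. *)
definition active_gram :: "real mat \<Rightarrow> real vec \<Rightarrow> real vec \<Rightarrow> real mat" where
  "active_gram W x y = mat (dim_col W) (dim_col W) (\<lambda>(a, b).
     \<Sum>i<dim_row W. of_bool (row W i \<bullet> x > 0) * of_bool (row W i \<bullet> y > 0) *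
                    (row W i $ a * row W i $ b))"

definition WDC :: "real \<Rightarrow> real mat \<Rightarrow> bool" where
  "WDC \<epsilon> W \<longleftrightarrow> (\<forall>x \<in> carrier_vec (dim_col W). \<forall>y \<in> carrier_vec (dim_col W).
     x \<noteq> 0\<^sub>v (dim_col W) \<and> y \<noteq> 0\<^sub>v (dim_col W) \<longrightarrow>
     spectral_norm (active_gram W x y - Q_mat x y) \<le> \<epsilon>)"

definition RRIC :: "real \<Rightarrow> nat \<Rightarrow> (real vec \<Rightarrow> real vec) \<Rightarrow> real mat \<Rightarrow> bool" where
  "RRIC \<epsilon> k G A \<longleftrightarrow>
    (\<forall>x1 \<in> carrier_vec k. \<forall>x2 \<in> carrier_vec k. \<forall>x3 \<in> carrier_vec k. \<forall>x4 \<in> carrier_vec k.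
      \<bar>(A *\<^sub>v (G x1 - G x2)) \<bullet> (A *\<^sub>v (G x3 - G x4)) - (G x1 - G x2) \<bullet> (G x3 - G x4)\<bar>
        \<le> \<epsilon> * vnorm (G x1 - G x2) * vnorm (G x3 - G x4))"

definition loss :: "real mat \<Rightarrow> (real vec \<Rightarrow> real vec) \<Rightarrow> real vec \<Rightarrow> real vec \<Rightarrow> real" where
  "loss A G y x = (1 / 2) * (vnorm (A *\<^sub>v G x - y))\<^sup>2"


(* The type of vectors of all dimensions carries no topology; this is the neighbourhood
   filter of x in the Euclidean space of the dimension of x. *)
definition vec_nhds :: "real vec \<Rightarrow> real vec filter" where
  "vec_nhds x = inf (filtercomap (\<lambda>y. vnorm (y - x)) (nhds 0))
                    (principal (carrier_vec (dim_vec x)))"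

definition clarke_dir_deriv :: "(real vec \<Rightarrow> real) \<Rightarrow> real vec \<Rightarrow> real vec \<Rightarrow> ereal" where
  "clarke_dir_deriv f x u = Limsup (vec_nhds x \<times>\<^sub>F at_right (0 :: real))
     (\<lambda>(y, t). ereal ((f (y + t \<cdot>\<^sub>v u) - f y) / t))"

definition clarke_subdiff :: "(real vec \<Rightarrow> real) \<Rightarrow> real vec \<Rightarrow> real vec set" where
  "clarke_subdiff f x = {v \<in> carrier_vec (dim_vec x).
     \<forall>u \<in> carrier_vec (dim_vec x). ereal (v \<bullet> u) \<le> clarke_dir_deriv f x u}"


definition sign_select :: "(real vec \<Rightarrow> real) \<Rightarrow> real vec \<Rightarrow> real vec" where
  "sign_select f x = (if f (- x) < f x then - x else x)"

(* X is a possible run of the algorithm on R^k: the starting point and the subgradient chosen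
   in each step are arbitrary. *)
definition subgradient_run ::
  "nat \<Rightarrow> (real vec \<Rightarrow> real) \<Rightarrow> real \<Rightarrow> (nat \<Rightarrow> real vec) \<Rightarrow> bool" where
  "subgradient_run k f \<nu> X \<longleftrightarrow>
     X 0 \<in> carrier_vec k \<and> X 0 \<noteq> 0\<^sub>v k \<and>
     (\<forall>i. \<exists>v \<in> clarke_subdiff f (sign_select f (X i)).
        X (Suc i) = sign_select f (X i) - \<nu> \<cdot>\<^sub>v v)"

end

theory Submission
  imports Defs "HOL-Analysis.Inner_Product"
begin

text \<open>
Let y be the vector to be recovered, and multiply every layer by sqrt 2, the loss by 2^d and the
noise by 2^(d/2). After this normalization every layer is almost an isometry on each of its linear
pieces, no power of 2 remains, and the step size becomes alpha = 1/(4 d^2).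

The WDC makes the inner product of the outputs for two inputs x, y close to |x| |y| c_d, where c_0 is the
cosine of the angle of x and y, c_(i+1) = Phi(c_i), and Phi(cos t) = ((pi - t) cos t + sin t) / pi. Hence
the loss is close to the explicit model |x|^2/2 - |x| |y| c_d plus a constant. What the proof
needs is closeness of differences: the loss minus the model is Lipschitz with a small constant delta * M on
a ball of radius M (objective_model). It is obtained by following segments, along which the network is
piecewise linear; recursion over the layers bounds the error on each piece. This one estimate controls
decreases along a step as well as Clarke subgradients, which lie within delta * M of the
gradient of the model (clarke_near_model_grad).

The function Phi is increasing and convex, so x \<mapsto> |x| |y| c_d is convex (kern_grad_le). Therefore the
model is bounded from above by its linearization plus |h|^2/2 for a displacement h, at every depth, and a step decreases the
loss by a fixed amount as long as the chosen subgradient is not tiny (step_descent). Since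
the loss is nonnegative, this can happen only a bounded number of times.

A tiny subgradient means that x almost solves the critical point equation of the model. The
comparison of the loss at x and - x in the algorithm rules out angles of 120 degrees or more (sign_select_angle), and the component
orthogonal to x of the model gradient has length |y| times the sine of the angle times the product of the slopes
of Phi at c_0, ..., c_(d-1). The angles decay like 3 pi / i, so this product is at least of order 1/d^3. Thus the
angle is small, and then so is |x - y| (step_near). The iterates never vanish (step_nonzero); this matters because the
subdifferential at 0 may contain 0.

Around y all activation patterns differ little, the network is close to an
isometry there (net_near_isometry), the subgradient is x - y up to a relative error 1/8 and the
noise (clarke_near_target), and the distance contracts by 1 - 7/8 alpha in every step.

The last part embeds the vectors of all dimensions into one inner product space and reads the
WDC, the RRIC and the Clarke subdifferential there.
\<close>

section \<open>How a layer acts on angles\<close>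

text \<open>
The derivative of Phi below.
\<close>
definition slope :: "real \<Rightarrow> real" where
  "slope c = 1 - arccos c / pi"

text \<open>
If two inputs of a layer have an angle with cosine c, their outputs have an angle with cosine close
to Phi c.
\<close>
definition Phi :: "real \<Rightarrow> real" where
  "Phi c = slope c * c + sin (arccos c) / pi"

lemma slope_bounds:
  assumes "\<bar>c\<bar> \<le> 1" shows "0 \<le> slope c" "slope c \<le> 1"
  using assms arccos_lbound[of c] arccos_ubound[of c] pi_gt_zero
  by (auto simp: slope_def field_simps)

lemma sin_tangent_le:
  fixes a b :: real
  assumes "0 \<le> a" "a \<le> pi" "0 \<le> b" "b \<le> pi"
  shows "sin b \<le> sin a + (b - a) * cos a"
proof -
  have "\<exists>z. min a b \<le> z \<and> z \<le> max a b \<and> sin b - sin a = (b - a) * cos z"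
  proof -
    consider "a < b" | "b < a" | "a = b" by linarith
    then show ?thesis
    proof cases
      case 1
      then obtain z where "a < z" "z < b" "sin b - sin a = (b - a) * cos z"
        using MVT2[of a b sin cos] by (auto intro: DERIV_sin)
      with 1 show ?thesis by (intro exI[of _ z]) auto
    next
      case 2
      then obtain z where "b < z" "z < a" "sin a - sin b = (a - b) * cos z"
        using MVT2[of b a sin cos] by (auto intro: DERIV_sin)
      with 2 show ?thesis by (intro exI[of _ z]) (auto simp: algebra_simps)
    qed (auto intro!: exI[of _ a])
  qed
  then obtain z where z: "min a b \<le> z" "z \<le> max a b" "sin b - sin a = (b - a) * cos z" by blast
  have "(b - a) * cos z \<le> (b - a) * cos a"
  proof (cases "a \<le> b")
    case True
    then have "cos z \<le> cos a" using z assms by (intro cos_monotone_0_pi_le) auto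
    then show ?thesis using True by (intro mult_left_mono) auto
  next
    case False
    then have "cos a \<le> cos z" using z assms by (intro cos_monotone_0_pi_le) auto
    then show ?thesis using False by (intro mult_left_mono_neg) auto
  qed
  with z show ?thesis by linarith
qed

text \<open>
In terms of the angles this says that the sine lies below its tangent at the angle of a.
\<close>
lemma Phi_convex:
  assumes "\<bar>a\<bar> \<le> 1" "\<bar>b\<bar> \<le> 1"
  shows "Phi b + slope b * (a - b) \<le> Phi a"
proof -
  have "sin (arccos b) \<le> sin (arccos a) + (arccos b - arccos a) * cos (arccos a)"
    using assms arccos_lbound arccos_ubound by (intro sin_tangent_le) auto
  moreover have "cos (arccos a) = a" using assms by simp
  ultimately have "sin (arccos b) + (arccos a - arccos b) * a \<le> sin (arccos a)"
    by (simp add: algebra_simps)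
  then have "(sin (arccos b) + (arccos a - arccos b) * a) / pi \<le> sin (arccos a) / pi"
    by (intro divide_right_mono) auto
  then show ?thesis unfolding Phi_def slope_def
    by (simp add: algebra_simps add_divide_distrib diff_divide_distrib)
qed

lemma Phi_mono:
  assumes "\<bar>a\<bar> \<le> 1" "\<bar>b\<bar> \<le> 1" "b \<le> a" shows "Phi b \<le> Phi a"
proof -
  have "0 \<le> slope b * (a - b)" using assms slope_bounds[of b] by simp
  then show ?thesis using Phi_convex[OF assms(1,2)] by linarith
qed

lemma Phi_ge:
  assumes "\<bar>c\<bar> \<le> 1" shows "c \<le> Phi c"
  using Phi_convex[of c 1] assms by (simp add: Phi_def slope_def)

lemma Phi_bounds:
  assumes "\<bar>c\<bar> \<le> 1" shows "0 \<le> Phi c" "Phi c \<le> 1" "\<bar>Phi c\<bar> \<le> 1"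
proof -
  show a: "0 \<le> Phi c" using Phi_mono[of c "-1"] assms by (simp add: Phi_def slope_def)
  show b: "Phi c \<le> 1" using Phi_mono[of 1 c] assms by (simp add: Phi_def slope_def)
  show "\<bar>Phi c\<bar> \<le> 1" using a b by simp
qed

lemma Phi_lipschitz:
  assumes "\<bar>a\<bar> \<le> 1" "\<bar>b\<bar> \<le> 1" shows "\<bar>Phi a - Phi b\<bar> \<le> \<bar>a - b\<bar>"
proof -
  have *: "Phi a - Phi b \<le> a - b" "0 \<le> Phi a - Phi b"
    if "\<bar>a\<bar> \<le> 1" "\<bar>b\<bar> \<le> 1" "b \<le> a" for a b
  proof -
    have "slope a * (a - b) \<le> 1 * (a - b)" using that slope_bounds[of a] by (intro mult_right_mono) auto
    then show "Phi a - Phi b \<le> a - b"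
      using Phi_convex[OF that(2) that(1)] by (simp add: algebra_simps)
    show "0 \<le> Phi a - Phi b" using Phi_mono[OF that] by simp
  qed
  show ?thesis using *[of a b] *[of b a] assms by (cases "a \<le> b") auto
qed

fun iter_cos :: "nat \<Rightarrow> real \<Rightarrow> real" where
  "iter_cos 0 c = c"
| "iter_cos (Suc j) c = Phi (iter_cos j c)"

text \<open>
By the chain rule, the derivative of iter_cos j.
\<close>
fun iter_slope :: "nat \<Rightarrow> real \<Rightarrow> real" where
  "iter_slope 0 c = 1"
| "iter_slope (Suc j) c = slope (iter_cos j c) * iter_slope j c"

lemma iter_cos_abs: "\<bar>c\<bar> \<le> 1 \<Longrightarrow> \<bar>iter_cos j c\<bar> \<le> 1"
  by (induction j) (auto simp: Phi_bounds)

lemma iter_cos_ge: "\<bar>c\<bar> \<le> 1 \<Longrightarrow> c \<le> iter_cos j c"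
proof (induction j)
  case (Suc j)
  then show ?case using Phi_ge[OF iter_cos_abs[of c j]] by auto
qed auto

lemma iter_cos_mono:
  "\<bar>a\<bar> \<le> 1 \<Longrightarrow> \<bar>b\<bar> \<le> 1 \<Longrightarrow> b \<le> a \<Longrightarrow> iter_cos j b \<le> iter_cos j a"
  by (induction j) (auto intro!: Phi_mono iter_cos_abs)

lemma iter_slope_bounds:
  assumes "\<bar>c\<bar> \<le> 1" shows "0 \<le> iter_slope j c \<and> iter_slope j c \<le> 1"
proof (induction j)
  case (Suc j)
  then show ?case using slope_bounds[OF iter_cos_abs[OF assms, of j]]
    by (auto intro: mult_le_one)
qed auto

text \<open>
Convexity survives the iteration because Phi is increasing.
\<close>
lemma iter_cos_convex:
  assumes "\<bar>a\<bar> \<le> 1" "\<bar>b\<bar> \<le> 1"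
  shows "iter_cos j b + iter_slope j b * (a - b) \<le> iter_cos j a"
proof (induction j)
  case (Suc j)
  let ?s = "slope (iter_cos j b)"
  have "?s * (iter_slope j b * (a - b)) \<le> ?s * (iter_cos j a - iter_cos j b)"
    using Suc slope_bounds[OF iter_cos_abs[OF assms(2)]] by (intro mult_left_mono) auto
  also have "\<dots> \<le> Phi (iter_cos j a) - Phi (iter_cos j b)"
    using Phi_convex[OF iter_cos_abs[OF assms(1)] iter_cos_abs[OF assms(2)], of j j] by simp
  finally show ?case by (simp add: mult.assoc)
qed auto

text \<open>
The tangent of iter_cos j at c has a nonnegative value at 0: each layer multiplies this value by a
slope and adds the nonnegative term sin / pi. This is what makes the kernel convex in the radial
direction.
\<close>
lemma iter_cos_offset_nonneg:
  assumes "\<bar>c\<bar> \<le> 1" shows "0 \<le> iter_cos j c - iter_slope j c * c"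
proof (induction j)
  case (Suc j)
  let ?b = "iter_cos j c" and ?s = "slope (iter_cos j c)"
  have ab: "\<bar>?b\<bar> \<le> 1" by (rule iter_cos_abs[OF assms])
  have "0 \<le> ?s * (?b - iter_slope j c * c)" using Suc slope_bounds[OF ab] by simp
  moreover have "0 \<le> sin (arccos ?b) / pi"
    using ab arccos_lbound arccos_ubound by (intro divide_nonneg_pos sin_ge_zero) auto
  ultimately show ?case by (simp add: Phi_def algebra_simps)
qed auto

lemma t_cos_le_sin:
  fixes t :: real assumes "0 \<le> t" "t \<le> pi" shows "t * cos t \<le> sin t"
  using sin_tangent_le[of t 0] assms by simp

text \<open>
Both sides agree at 0, and the difference has the derivative (t/3) (sin t - t cos t).
\<close>
lemma sin_minus_t_cos_ge:
  fixes t :: real assumes "0 \<le> t" "t \<le> pi/2"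
  shows "t\<^sup>2 / 3 * sin t \<le> sin t - t * cos t"
proof -
  let ?g = "\<lambda>t::real. sin t - t * cos t - t\<^sup>2 / 3 * sin t"
  have "?g 0 \<le> ?g t"
  proof (rule DERIV_nonneg_imp_nondecreasing[where f="?g"])
    show "0 \<le> t" by fact
    fix x assume x: "0 \<le> x" "x \<le> t"
    have "(?g has_real_derivative (x/3 * (sin x - x * cos x))) (at x)"
      by (auto intro!: derivative_eq_intros simp: field_simps power2_eq_square)
    moreover have "0 \<le> x/3 * (sin x - x * cos x)"
      using t_cos_le_sin[of x] x assms by (intro mult_nonneg_nonneg) auto
    ultimately show "\<exists>y. (?g has_real_derivative y) (at x) \<and> 0 \<le> y" by blast
  qed
  then show ?thesis by simp
qed

text \<open>
A layer shrinks an acute angle t at least to t - t^2/(3 pi).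
\<close>
lemma cos_shift_le_Phi:
  fixes t :: real assumes "0 \<le> t" "t \<le> pi/2"
  shows "cos (t - t\<^sup>2/(3*pi)) \<le> Phi (cos t)"
proof -
  let ?h = "t\<^sup>2/(3*pi)"
  have h: "0 \<le> ?h" by simp
  have tt: "t\<^sup>2 \<le> t * (3*pi)" unfolding power2_eq_square
    using assms pi_gt_zero by (intro mult_left_mono) linarith+
  have ht: "?h \<le> t" using tt pi_gt_zero by (simp add: field_simps)
  have "cos (t - ?h) - cos t \<le> ?h * sin t"
  proof (cases "?h = 0")
    case False
    then have "t - ?h < t" using h by linarith
    then obtain z where z: "t - ?h < z" "z < t" "cos t - cos (t - ?h) = (t - (t - ?h)) * - sin z"
      using MVT2[of "t - ?h" t cos "\<lambda>x. - sin x"] by (auto intro: DERIV_cos)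
    have "sin z \<le> sin t" using z ht assms by (intro sin_monotone_2pi_le) auto
    then have "?h * sin z \<le> ?h * sin t" using h by (intro mult_left_mono)
    then show ?thesis using z by (simp add: algebra_simps)
  qed simp
  also have "?h * sin t = (t\<^sup>2/3 * sin t)/pi" by simp
  also have "\<dots> \<le> (sin t - t * cos t)/pi"
    using sin_minus_t_cos_ge[OF assms] by (intro divide_right_mono) auto
  finally show ?thesis using assms by (simp add: Phi_def slope_def arccos_cos field_simps)
qed

lemma arccos_antimono: "\<bar>a\<bar> \<le> 1 \<Longrightarrow> \<bar>b\<bar> \<le> 1 \<Longrightarrow> a \<le> b \<Longrightarrow> arccos b \<le> arccos a"
  by (intro arccos_le_arccos) auto

text \<open>
The first layer makes every angle acute, that is at most 3 pi / 6; afterwards 3 pi / n is mapped below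
3 pi / n - 3 pi / n^2, which is at most 3 pi / (n + 1).
\<close>
lemma arccos_iter_le:
  assumes "\<bar>c\<bar> \<le> 1"
  shows "arccos (iter_cos (Suc j) c) \<le> 3 * pi / (real j + 6)"
proof (induction j)
  case 0
  have "arccos (Phi c) \<le> arccos 0" using Phi_bounds[OF assms] by (intro arccos_antimono) auto
  then show ?case by simp
next
  case (Suc j)
  define t where "t = arccos (iter_cos (Suc j) c)"
  define u where "u = 3 * pi / (real j + 6)"
  have ab: "\<bar>iter_cos (Suc j) c\<bar> \<le> 1" by (rule iter_cos_abs[OF assms])
  have nn: "0 \<le> iter_cos (Suc j) c" using Phi_bounds[OF iter_cos_abs[OF assms]] by simp
  have t0: "0 \<le> t" unfolding t_def using ab by (intro arccos_lbound) auto
  have t1: "t \<le> pi/2" unfolding t_def using ab nn arccos_le_pi2 by auto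
  have tu: "t \<le> u" using Suc by (simp add: t_def u_def)
  have ct: "cos t = iter_cos (Suc j) c" unfolding t_def using ab by (intro cos_arccos) auto
  have "t * t \<le> t * (3*pi)" using t0 t1 pi_gt_zero by (intro mult_left_mono) linarith+
  then have tt: "t\<^sup>2/(3*pi) \<le> t" using pi_gt_zero by (simp add: field_simps power2_eq_square)
  have "cos (t - t\<^sup>2/(3*pi)) \<le> iter_cos (Suc (Suc j)) c"
    using cos_shift_le_Phi[OF t0 t1] ct by simp
  then have "arccos (iter_cos (Suc (Suc j)) c) \<le> arccos (cos (t - t\<^sup>2/(3*pi)))"
    using iter_cos_abs[OF assms, of "Suc (Suc j)"] by (intro arccos_antimono) auto
  also have "\<dots> = t - t\<^sup>2/(3*pi)"
  proof -
    have "0 \<le> t\<^sup>2/(3*pi)" by simp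
    then show ?thesis using t0 t1 tt by (intro arccos_cos) linarith+
  qed
  also have "\<dots> \<le> u - u\<^sup>2/(3*pi)"
  proof -
    have u2: "u \<le> pi/2" unfolding u_def using pi_gt_zero by (simp add: field_simps)
    have "(u - t) * (u + t) \<le> (u - t) * (3*pi)"
      using tu t1 u2 pi_gt_zero by (intro mult_left_mono) linarith+
    then have "(u - t) * (u + t) / (3*pi) \<le> (u - t) * (3*pi) / (3*pi)"
      using pi_gt_zero by (intro divide_right_mono) auto
    moreover have "(u - t) * (u + t) / (3*pi) = u\<^sup>2/(3*pi) - t\<^sup>2/(3*pi)"
      by (simp add: algebra_simps power2_eq_square diff_divide_distrib)
    moreover have "(u - t) * (3*pi) / (3*pi) = u - t" by simp
    ultimately show ?thesis by linarith
  qed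
  also have "\<dots> \<le> 3 * pi / (real (Suc j) + 6)"
  proof -
    define n where "n = real j + 6"
    have n: "n > 0" by (simp add: n_def)
    have "u - u\<^sup>2/(3*pi) = 3*pi * (1/n - 1/n\<^sup>2)"
      unfolding u_def n_def[symmetric] using n by (simp add: field_simps power2_eq_square)
    also have "1/n - 1/n\<^sup>2 \<le> 1/(n+1)" using n by (simp add: field_simps power2_eq_square)
    then have "3*pi * (1/n - 1/n\<^sup>2) \<le> 3*pi * (1/(n+1))" by (intro mult_left_mono) auto
    finally show ?thesis by (simp add: n_def add.commute add.left_commute)
  qed
  finally show ?case .
qed

text \<open>
By the decay of the angles the slopes are at least 1 - 3/(j+6), and the product of these
numbers telescopes.
\<close>
lemma iter_slope_lower_exact:
  assumes "\<bar>c\<bar> \<le> 1"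
  shows "slope c * 60 / ((real j + 3) * (real j + 4) * (real j + 5)) \<le> iter_slope (Suc j) c"
proof (induction j)
  case (Suc j)
  let ?x = "real j"
  have s: "1 - 3 / (?x + 6) \<le> slope (iter_cos (Suc j) c)"
    using arccos_iter_le[OF assms, of j] pi_gt_zero
    by (simp add: slope_def divide_le_eq del: iter_cos.simps)
  have s0: "0 \<le> 1 - 3 / (?x + 6)" by (simp add: field_simps)
  have "slope c * 60 / ((?x + 4) * (?x + 5) * (?x + 6))
      = (1 - 3 / (?x + 6)) * (slope c * 60 / ((?x + 3) * (?x + 4) * (?x + 5)))"
    by (simp add: divide_simps)
  also have "\<dots> \<le> slope (iter_cos (Suc j) c) * iter_slope (Suc j) c"
    using Suc s s0 slope_bounds[OF assms] slope_bounds[OF iter_cos_abs[OF assms, of "Suc j"]]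
    by (intro mult_mono) auto
  finally show ?case by (simp add: algebra_simps)
qed (use slope_bounds[OF assms] in auto)

lemma iter_slope_lower:
  assumes "\<bar>c\<bar> \<le> 1" "d > 0"
  shows "slope c / real d ^ 3 \<le> iter_slope d c"
proof -
  obtain j where j: "d = Suc j" using assms(2) gr0_implies_Suc by blast
  have "(real j + 3) * (real j + 4) * (real j + 5) \<le> (3 * real d) * (4 * real d) * (5 * real d)"
    unfolding j by (intro mult_mono) auto
  also have "\<dots> = 60 * real d ^ 3" by (simp add: power3_eq_cube)
  finally have "slope c * 60 / (60 * real d ^ 3) \<le> slope c * 60 / ((real j + 3) * (real j + 4) * (real j + 5))"
    using slope_bounds[OF assms(1)] by (intro divide_left_mono) (auto simp: assms(2))
  also have "\<dots> \<le> iter_slope d c" unfolding j by (rule iter_slope_lower_exact[OF assms(1)])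
  finally show ?thesis by simp
qed

lemma slope_neg_half: "slope (- (1 / 2)) = 1 / 3"
proof -
  have "arccos (- (1 / 2)) = 2 * pi / 3"
    using arccos_cos[of "2*pi/3"] cos_120 pi_gt_zero by simp
  then show ?thesis by (simp add: slope_def)
qed

lemma slope_mono: "\<bar>a\<bar> \<le> 1 \<Longrightarrow> \<bar>b\<bar> \<le> 1 \<Longrightarrow> a \<le> b \<Longrightarrow> slope a \<le> slope b"
  using arccos_antimono[of a b] by (simp add: slope_def divide_right_mono)

lemma iter_slope_lower_half:
  assumes "\<bar>c\<bar> \<le> 1" "- 1 / 2 \<le> c" "d > 0"
  shows "1 / (3 * real d ^ 3) \<le> iter_slope d c"
proof -
  have "1/3 \<le> slope c" using slope_mono[of "-(1/2)" c] assms slope_neg_half by simp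
  then have "1/3 / real d ^ 3 \<le> slope c / real d ^ 3" by (intro divide_right_mono) auto
  then show ?thesis using iter_slope_lower[OF assms(1,3)] by simp
qed

text \<open>
Opposite inputs are separated by the kernel: by convexity the gap between 1/2 and - 1/2 is at least the
slope at - 1/2.
\<close>
lemma iter_cos_gap:
  assumes "\<bar>c\<bar> \<le> 1" "c \<le> - 1 / 2" "d > 0"
  shows "1 / (3 * real d ^ 3) \<le> iter_cos d (- c) - iter_cos d c"
proof -
  have "1 / (3 * real d ^ 3) \<le> iter_slope d (-(1/2))"
    using assms(3) by (intro iter_slope_lower_half) auto
  also have "\<dots> \<le> iter_cos d (1/2) - iter_cos d (-(1/2))"
    using iter_cos_convex[of "1/2" "-(1/2)" d] by simp
  also have "\<dots> \<le> iter_cos d (- c) - iter_cos d c"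
    using assms iter_cos_mono[of "-c" "1/2" d] iter_cos_mono[of "-(1/2)" c d] by auto
  finally show ?thesis .
qed

lemma iter_cos_pos:
  assumes "\<bar>c\<bar> \<le> 1" "- 1 / 2 \<le> c" "d > 0"
  shows "1 / 40 \<le> iter_cos d c"
proof -
  obtain j where j: "d = Suc j" using assms(3) gr0_implies_Suc by blast
  have mono: "\<bar>a\<bar> \<le> 1 \<Longrightarrow> Phi a \<le> iter_cos (Suc j) a" for a
  proof (induction j)
    case (Suc j)
    then show ?case using Phi_ge[OF iter_cos_abs[of a "Suc j"]] by auto
  qed auto
  have ac: "arccos (- (1 / 2)) = 2 * pi / 3"
    using arccos_cos[of "2*pi/3"] cos_120 pi_gt_zero by simp
  have "1/40 \<le> Phi (-(1/2))"
  proof -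
    have s3: "sqrt 3 \<ge> 17/10" by (rule real_le_rsqrt) (simp add: power2_eq_square)
    have p: "pi < 4" using pi_less_4 by simp
    have "Phi (-(1/2)) = - 1/6 + sqrt 3 / 2 / pi"
      by (simp add: Phi_def slope_neg_half ac sin_120)
    moreover have "17/20/pi \<le> sqrt 3 / 2 / pi" using s3 by (intro divide_right_mono) auto
    moreover have "17/20/4 \<le> 17/20/pi" using p pi_gt_zero by (intro divide_left_mono) auto
    ultimately show ?thesis by linarith
  qed
  also have "\<dots> \<le> Phi c" using assms by (intro Phi_mono) auto
  also have "\<dots> \<le> iter_cos d c" unfolding j using mono assms by blast
  finally show ?thesis .
qed

lemma one_minus_cos_ge:
  fixes t :: real assumes "\<bar>t\<bar> \<le> pi" shows "2 * t\<^sup>2 / pi\<^sup>2 \<le> 1 - cos t"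
proof -
  have jordan: "2 * x / pi \<le> sin x" if "0 \<le> x" "x \<le> pi/2" for x :: real
  proof (cases "x = 0")
    case False
    then have x: "x > 0" using that by simp
    have "sin (pi/2) / (pi/2) \<le> sin x / x"
    proof -
      let ?g = "\<lambda>x::real. sin x / x"
      have "?g (pi/2) \<le> ?g x"
      proof (rule DERIV_nonpos_imp_nonincreasing[where f="?g"])
        show "x \<le> pi/2" by fact
        fix y assume y: "x \<le> y" "y \<le> pi/2"
        have "(?g has_real_derivative ((y * cos y - sin y) / y\<^sup>2)) (at y)"
          using x y by (auto intro!: derivative_eq_intros simp: field_simps power2_eq_square)
        moreover have "(y * cos y - sin y) / y\<^sup>2 \<le> 0"
          using t_cos_le_sin[of y] x y by (intro divide_nonpos_nonneg) auto
        ultimately show "\<exists>z. (?g has_real_derivative z) (at y) \<and> z \<le> 0" by blast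
      qed
      then show ?thesis .
    qed
    then show ?thesis using x by (simp add: field_simps)
  qed simp
  have a: "1 - cos t = 2 * (sin (\<bar>t\<bar>/2))\<^sup>2"
    using cos_double_sin[of "\<bar>t\<bar>/2"] by simp
  have "(2 * (\<bar>t\<bar>/2) / pi)\<^sup>2 \<le> (sin (\<bar>t\<bar>/2))\<^sup>2"
    using assms pi_gt_zero by (intro power_mono jordan) auto
  then have "2 * (2 * (\<bar>t\<bar>/2) / pi)\<^sup>2 \<le> 1 - cos t" unfolding a by simp
  then show ?thesis by (simp add: power_divide)
qed

text \<open>
The arccosine is only Hoelder continuous with exponent 1/2. This is the source of the square root of the WDC constant
in the final error bound.
\<close>
lemma arccos_holder:
  assumes "\<bar>a\<bar> \<le> 1" "\<bar>b\<bar> \<le> 1"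
  shows "2 * (arccos a - arccos b)\<^sup>2 / pi\<^sup>2 \<le> \<bar>a - b\<bar>"
proof -
  have *: "1 - cos (x - y) \<le> cos y - cos x" if "0 \<le> y" "y \<le> x" "x \<le> pi" for x y :: real
  proof -
    have half: "2 * ((x - y)/2) = x - y" by simp
    have "sin ((x - y)/2) \<le> sin ((x + y)/2)"
    proof (cases "(x + y)/2 \<le> pi/2")
      case True then show ?thesis using that by (intro sin_monotone_2pi_le) auto
    next
      case False
      have "sin ((x - y)/2) \<le> sin (pi - (x + y)/2)"
        using that False by (intro sin_monotone_2pi_le) (auto simp: field_simps)
      then show ?thesis by simp
    qed
    moreover have "0 \<le> sin ((x - y)/2)" using that by (intro sin_ge_zero) auto
    ultimately have "sin ((x - y)/2) * sin ((x - y)/2) \<le> sin ((x + y)/2) * sin ((x - y)/2)"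
      by (intro mult_right_mono)
    moreover have "cos y - cos x = 2 * (sin ((y + x)/2) * sin ((x - y)/2))"
      by (simp add: cos_diff_cos)
    moreover have "1 - cos (x - y) = 2 * (sin ((x - y)/2) * sin ((x - y)/2))"
      using cos_double_sin[of "(x - y)/2"] unfolding half by (simp add: power2_eq_square)
    ultimately show ?thesis by (simp add: add.commute)
  qed
  have l: "0 \<le> arccos a" "arccos a \<le> pi" "0 \<le> arccos b" "arccos b \<le> pi"
    using assms by (auto intro: arccos_lbound arccos_ubound)
  have "2 * (arccos a - arccos b)\<^sup>2 / pi\<^sup>2 \<le> 1 - cos (arccos a - arccos b)"
    using l by (intro one_minus_cos_ge) auto
  also have "\<dots> \<le> \<bar>cos (arccos a) - cos (arccos b)\<bar>"
  proof (cases "arccos a \<le> arccos b")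
    case True
    then show ?thesis using *[of "arccos a" "arccos b"] l cos_minus[of "arccos a - arccos b"] by simp
  next
    case False
    then show ?thesis using *[of "arccos b" "arccos a"] l by simp
  qed
  also have "\<dots> = \<bar>a - b\<bar>" using assms by simp
  finally show ?thesis .
qed

lemma sin_lipschitz: "\<bar>sin x - sin y\<bar> \<le> \<bar>x - y\<bar>" for x y :: real
proof -
  have *: "\<bar>sin a - sin b\<bar> \<le> \<bar>a - b\<bar>" if "b < a" for a b :: real
  proof -
    have "\<exists>z. b < z \<and> z < a \<and> sin a - sin b = (a - b) * cos z"
      using that by (intro MVT2) (auto intro: DERIV_sin)
    then obtain z where "sin a - sin b = (a - b) * cos z" by blast
    then show ?thesis by (simp add: abs_mult mult_left_le)
  qed
  consider "x < y" | "y < x" | "x = y" by linarith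
  then show ?thesis using *[of x y] *[of y x] by cases auto
qed


section \<open>Angles, and Lipschitz bounds along segments\<close>

definition cosine :: "'a::real_inner \<Rightarrow> 'a \<Rightarrow> real" where
  "cosine u v = inner u v / (norm u * norm v)"

lemma cosine_abs: "\<bar>cosine u v\<bar> \<le> 1"
proof (cases "u = 0 \<or> v = 0")
  case False
  then show ?thesis using Cauchy_Schwarz_ineq2[of u v] by (simp add: cosine_def abs_mult divide_le_eq)
qed (auto simp: cosine_def)

lemma cosine_commute: "cosine u v = cosine v u"
  by (simp add: cosine_def inner_commute mult.commute)

lemma inner_eq_cosine: "inner u v = norm u * norm v * cosine u v"
  by (cases "u = 0 \<or> v = 0") (auto simp: cosine_def)

lemma cosine_self: "u \<noteq> 0 \<Longrightarrow> cosine u u = 1"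
  by (simp add: cosine_def dot_square_norm power2_eq_square)

text \<open>
A Lipschitz bound for differences follows from one-sided bounds at every point, where the radius may
depend on the point: at an interior point of the segment the hypothesis is used towards both ends, and bisection (Bolzano) glues the local bounds. ReLU networks are
only piecewise linear, so this replaces the mean value theorem.
\<close>
lemma segment_lipschitz:
  fixes \<psi> :: "'a::real_normed_vector \<Rightarrow> real"
  assumes seg: "\<And>s. 0 \<le> s \<Longrightarrow> s \<le> 1 \<Longrightarrow> a + s *\<^sub>R (b - a) \<in> S"
    and loc: "\<And>z w. z \<in> S \<Longrightarrow> w \<in> S \<Longrightarrow> z \<noteq> w \<Longrightarrow>
      \<exists>\<delta>>0. \<forall>p. 0 < p \<and> p < \<delta> \<longrightarrow> \<bar>\<psi> (z + p *\<^sub>R (w - z)) - \<psi> z\<bar> \<le> B * p * norm (w - z)"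
  shows "\<bar>\<psi> b - \<psi> a\<bar> \<le> B * norm (b - a)"
proof (cases "a = b")
  case False
  define g where "g s = a + s *\<^sub>R (b - a)" for s
  have nb: "norm (b - a) > 0" using False by simp
  have one: "\<exists>\<delta>>0. \<forall>s'. 0 \<le> s' \<and> s' \<le> 1 \<and> \<bar>s' - s\<bar> < \<delta> \<and> 0 \<le> (s' - s) * (e - s) \<longrightarrow>
      \<bar>\<psi> (g s') - \<psi> (g s)\<bar> \<le> B * norm (b - a) * \<bar>s' - s\<bar>"
    if s: "0 \<le> s" "s \<le> 1" and e: "0 \<le> e" "e \<le> 1" "s \<noteq> e" for s e
  proof -
    have gd: "g e - g s = (e - s) *\<^sub>R (b - a)" by (simp add: g_def algebra_simps)
    then have "g s \<noteq> g e" using e nb by auto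
    moreover have "g s \<in> S" "g e \<in> S" unfolding g_def using s e by (auto intro: seg)
    ultimately obtain \<delta> where \<delta>: "\<delta> > 0"
      "\<And>p. 0 < p \<Longrightarrow> p < \<delta> \<Longrightarrow> \<bar>\<psi> (g s + p *\<^sub>R (g e - g s)) - \<psi> (g s)\<bar> \<le> B * p * norm (g e - g s)"
      using loc[of "g s" "g e"] by blast
    show ?thesis
    proof (intro exI[of _ "\<delta> * \<bar>e - s\<bar>"] conjI allI impI)
      show "0 < \<delta> * \<bar>e - s\<bar>" using \<delta>(1) e by simp
      fix s' assume s': "0 \<le> s' \<and> s' \<le> 1 \<and> \<bar>s' - s\<bar> < \<delta> * \<bar>e - s\<bar> \<and> 0 \<le> (s' - s) * (e - s)"
      show "\<bar>\<psi> (g s') - \<psi> (g s)\<bar> \<le> B * norm (b - a) * \<bar>s' - s\<bar>"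
      proof (cases "s' = s")
        case False
        define p where "p = (s' - s) / (e - s)"
        have "0 \<le> p" using s' unfolding p_def zero_le_divide_iff zero_le_mult_iff by linarith
        then have p: "p = \<bar>s' - s\<bar> / \<bar>e - s\<bar>"
          using abs_of_nonneg[of p] by (simp add: p_def abs_divide)
        have p0: "0 < p" unfolding p using False e by simp
        have p1: "p < \<delta>" unfolding p using s' e by (simp add: divide_less_eq)
        have "p *\<^sub>R (g e - g s) = (s' - s) *\<^sub>R (b - a)"
          unfolding gd p_def using e by simp
        then have "g s + p *\<^sub>R (g e - g s) = g s'" by (simp add: g_def algebra_simps)
        moreover have "p * norm (g e - g s) = norm (b - a) * \<bar>s' - s\<bar>"
          unfolding gd p using e by simp
        ultimately show ?thesis using \<delta>(2)[OF p0 p1] by (simp add: mult.assoc)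
      qed simp
    qed
  qed
  have loc1: "\<exists>\<delta>>0. \<forall>s'. 0 \<le> s' \<and> s' \<le> 1 \<and> \<bar>s' - s\<bar> < \<delta> \<longrightarrow>
      \<bar>\<psi> (g s') - \<psi> (g s)\<bar> \<le> B * norm (b - a) * \<bar>s' - s\<bar>" if s: "0 \<le> s" "s \<le> 1" for s
  proof -
    have R: "\<exists>\<delta>>0. \<forall>s'. s \<le> s' \<and> s' \<le> 1 \<and> \<bar>s' - s\<bar> < \<delta> \<longrightarrow>
      \<bar>\<psi> (g s') - \<psi> (g s)\<bar> \<le> B * norm (b - a) * \<bar>s' - s\<bar>"
    proof (cases "s = 1")
      case False
      then obtain \<delta> where d: "\<delta> > 0" "\<And>s'. 0 \<le> s' \<and> s' \<le> 1 \<and> \<bar>s' - s\<bar> < \<delta> \<and> 0 \<le> (s' - s) * (1 - s) \<Longrightarrow>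
        \<bar>\<psi> (g s') - \<psi> (g s)\<bar> \<le> B * norm (b - a) * \<bar>s' - s\<bar>" using one[OF s, of 1] by auto
      have "0 \<le> (s' - s) * (1 - s)" if "s \<le> s'" for s'
        using that s by (intro mult_nonneg_nonneg) auto
      then show ?thesis using s d(1) by (intro exI[of _ \<delta>] conjI allI impI d(2)) auto
    qed (auto intro!: exI[of _ 1])
    have L: "\<exists>\<delta>>0. \<forall>s'. 0 \<le> s' \<and> s' \<le> s \<and> \<bar>s' - s\<bar> < \<delta> \<longrightarrow>
      \<bar>\<psi> (g s') - \<psi> (g s)\<bar> \<le> B * norm (b - a) * \<bar>s' - s\<bar>"
    proof (cases "s = 0")
      case False
      then obtain \<delta> where d: "\<delta> > 0" "\<And>s'. 0 \<le> s' \<and> s' \<le> 1 \<and> \<bar>s' - s\<bar> < \<delta> \<and> 0 \<le> (s' - s) * (0 - s) \<Longrightarrow>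
        \<bar>\<psi> (g s') - \<psi> (g s)\<bar> \<le> B * norm (b - a) * \<bar>s' - s\<bar>" using one[OF s, of 0] by auto
      have "0 \<le> (s' - s) * (0 - s)" if "s' \<le> s" for s'
        using that s by (intro mult_nonpos_nonpos) auto
      then show ?thesis using s d(1) by (intro exI[of _ \<delta>] conjI allI impI d(2)) auto
    qed (auto intro!: exI[of _ 1])
    from R L obtain \<delta>1 \<delta>2 where "\<delta>1 > 0" "\<delta>2 > 0"
      "\<And>s'. s \<le> s' \<and> s' \<le> 1 \<and> \<bar>s' - s\<bar> < \<delta>1 \<Longrightarrow> \<bar>\<psi> (g s') - \<psi> (g s)\<bar> \<le> B * norm (b - a) * \<bar>s' - s\<bar>"
      "\<And>s'. 0 \<le> s' \<and> s' \<le> s \<and> \<bar>s' - s\<bar> < \<delta>2 \<Longrightarrow> \<bar>\<psi> (g s') - \<psi> (g s)\<bar> \<le> B * norm (b - a) * \<bar>s' - s\<bar>"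
      by auto
    then show ?thesis by (intro exI[of _ "min \<delta>1 \<delta>2"]) (metis linear min_less_iff_conj)
  qed
  have "0 \<le> (0::real) \<longrightarrow> (1::real) \<le> 1 \<longrightarrow> \<bar>\<psi> (g 1) - \<psi> (g 0)\<bar> \<le> B * norm (b - a) * (1 - 0)"
  proof (rule Bolzano[where P = "\<lambda>p q. 0 \<le> p \<longrightarrow> q \<le> 1 \<longrightarrow> \<bar>\<psi> (g q) - \<psi> (g p)\<bar> \<le> B * norm (b - a) * (q - p)"])
    show "(0::real) \<le> 1" by simp
  next
    fix p q r :: real
    assume h: "0 \<le> p \<longrightarrow> q \<le> 1 \<longrightarrow> \<bar>\<psi> (g q) - \<psi> (g p)\<bar> \<le> B * norm (b - a) * (q - p)"
      "0 \<le> q \<longrightarrow> r \<le> 1 \<longrightarrow> \<bar>\<psi> (g r) - \<psi> (g q)\<bar> \<le> B * norm (b - a) * (r - q)" "p \<le> q" "q \<le> r"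
    show "0 \<le> p \<longrightarrow> r \<le> 1 \<longrightarrow> \<bar>\<psi> (g r) - \<psi> (g p)\<bar> \<le> B * norm (b - a) * (r - p)"
    proof (intro impI)
      assume "0 \<le> p" "r \<le> 1"
      then have "\<bar>\<psi> (g q) - \<psi> (g p)\<bar> \<le> B * norm (b - a) * (q - p)"
        "\<bar>\<psi> (g r) - \<psi> (g q)\<bar> \<le> B * norm (b - a) * (r - q)" using h by auto
      moreover have "B * norm (b - a) * (r - p) = B * norm (b - a) * (q - p) + B * norm (b - a) * (r - q)"
        by (simp add: algebra_simps)
      ultimately show "\<bar>\<psi> (g r) - \<psi> (g p)\<bar> \<le> B * norm (b - a) * (r - p)" by linarith
    qed
  next
    fix x :: real assume x: "0 \<le> x" "x \<le> 1"
    obtain \<delta> where \<delta>: "\<delta> > 0" "\<And>s'. 0 \<le> s' \<and> s' \<le> 1 \<and> \<bar>s' - x\<bar> < \<delta> \<Longrightarrow>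
      \<bar>\<psi> (g s') - \<psi> (g x)\<bar> \<le> B * norm (b - a) * \<bar>s' - x\<bar>" using loc1[OF x] by blast
    show "\<exists>\<delta>>0. \<forall>p q. p \<le> x \<and> x \<le> q \<and> q - p < \<delta> \<longrightarrow>
      0 \<le> p \<longrightarrow> q \<le> 1 \<longrightarrow> \<bar>\<psi> (g q) - \<psi> (g p)\<bar> \<le> B * norm (b - a) * (q - p)"
    proof (intro exI[of _ \<delta>] conjI allI impI \<delta>(1))
      fix p q assume h: "p \<le> x \<and> x \<le> q \<and> q - p < \<delta>" "0 \<le> p" "q \<le> 1"
      have "\<bar>\<psi> (g q) - \<psi> (g x)\<bar> \<le> B * norm (b - a) * (q - x)" using \<delta>(2)[of q] h by auto
      moreover have "\<bar>\<psi> (g p) - \<psi> (g x)\<bar> \<le> B * norm (b - a) * (x - p)" using \<delta>(2)[of p] h by auto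
      moreover have "B * norm (b - a) * (q - p) = B * norm (b - a) * (q - x) + B * norm (b - a) * (x - p)"
        by (simp add: algebra_simps)
      ultimately show "\<bar>\<psi> (g q) - \<psi> (g p)\<bar> \<le> B * norm (b - a) * (q - p)" by linarith
    qed
  qed
  then show ?thesis by (simp add: g_def)
qed simp

lemma norm_segment_le:
  fixes z w c :: "'a::real_normed_vector"
  assumes "norm (z - c) \<le> M" "norm (w - c) \<le> M" "0 \<le> s" "s \<le> 1"
  shows "norm (z + s *\<^sub>R (w - z) - c) \<le> M"
proof -
  have "z + s *\<^sub>R (w - z) - c = (1 - s) *\<^sub>R (z - c) + s *\<^sub>R (w - c)" by (simp add: algebra_simps)
  also have "norm \<dots> \<le> norm ((1 - s) *\<^sub>R (z - c)) + norm (s *\<^sub>R (w - c))" by (rule norm_triangle_ineq)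
  also have "\<dots> = (1 - s) * norm (z - c) + s * norm (w - c)" using assms by simp
  also have "\<dots> \<le> (1 - s) * M + s * M" using assms by (intro add_mono mult_left_mono) auto
  finally show ?thesis by (simp add: algebra_simps)
qed

lemma norm_le_if_inner_le:
  fixes v :: "'a::real_inner"
  assumes "inner v v \<le> B * norm v" "0 \<le> B" shows "norm v \<le> B"
proof (cases "v = 0")
  case False
  have "norm v * norm v \<le> B * norm v" using assms by (simp add: dot_square_norm power2_eq_square)
  then show ?thesis using False by simp
qed (use assms in auto)

section \<open>The kernel of an ideal network\<close>

definition kern :: "nat \<Rightarrow> 'a::real_inner \<Rightarrow> 'a \<Rightarrow> real" where
  "kern j y w = norm w * norm y * iter_cos j (cosine w y)"

text \<open>
For nonzero w a subgradient of kern j y at w; see kern_grad_le and kern_grad_euler.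
\<close>
definition kern_grad :: "nat \<Rightarrow> 'a::real_inner \<Rightarrow> 'a \<Rightarrow> 'a" where
  "kern_grad j y w =
     (norm y * (iter_cos j (cosine w y) - iter_slope j (cosine w y) * cosine w y) / norm w) *\<^sub>R w
     + iter_slope j (cosine w y) *\<^sub>R y"

lemma inner_kern_grad:
  "inner (kern_grad j y w) u =
     norm y * (iter_cos j (cosine w y) - iter_slope j (cosine w y) * cosine w y) / norm w * inner w u
     + iter_slope j (cosine w y) * inner y u"
  by (simp add: kern_grad_def inner_add_left)

lemma inner_kern_grad_Suc:
  "inner (kern_grad (Suc j) y w) u =
     slope (iter_cos j (cosine w y)) * inner (kern_grad j y w) u
     + sin (arccos (iter_cos j (cosine w y))) / pi * (norm y / norm w * inner w u)"
  unfolding inner_kern_grad by (simp add: Phi_def algebra_simps add_divide_distrib diff_divide_distrib)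

lemma kern_grad_euler: "w \<noteq> 0 \<Longrightarrow> inner (kern_grad j y w) w = kern j y w"
  unfolding inner_kern_grad inner_eq_cosine[of y w] cosine_commute[of y w]
  by (simp add: kern_def dot_square_norm power2_eq_square field_simps)

text \<open>
Convexity of the kernel. Homogeneity turns the subgradient inequality into this form, in which the term for w
cancels. It combines the tangent inequality for iter_cos with Cauchy-Schwarz; the latter has the right
direction because its coefficient, the offset of the tangent, is nonnegative.
\<close>
lemma kern_grad_le:
  assumes "w \<noteq> 0" shows "inner (kern_grad j y w) a \<le> kern j y a"
proof (cases "a = 0")
  case False
  let ?c = "cosine w y" and ?c' = "cosine a y"
  have "norm y * (iter_cos j ?c - iter_slope j ?c * ?c) * (inner w a / norm w)
      \<le> norm y * (iter_cos j ?c - iter_slope j ?c * ?c) * norm a"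
    using assms iter_cos_offset_nonneg[OF cosine_abs, of j w y] norm_cauchy_schwarz[of w a]
    by (intro mult_left_mono mult_nonneg_nonneg) (auto simp: divide_le_eq mult.commute)
  then have "inner (kern_grad j y w) a
      \<le> norm y * (iter_cos j ?c - iter_slope j ?c * ?c) * norm a + iter_slope j ?c * inner y a"
    unfolding inner_kern_grad by simp
  also have "\<dots> = norm a * norm y * (iter_cos j ?c + iter_slope j ?c * (?c' - ?c))"
    unfolding inner_eq_cosine[of y a] cosine_commute[of y a] by (simp add: algebra_simps)
  also have "\<dots> \<le> norm a * norm y * iter_cos j ?c'"
    by (intro mult_left_mono iter_cos_convex cosine_abs) auto
  finally show ?thesis by (simp add: kern_def)
qed (simp add: kern_def)

lemma kern_grad_norm:
  shows "norm (kern_grad j y w) \<le> 3 * norm y"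
proof -
  let ?c = "cosine w y"
  have s: "0 \<le> iter_slope j ?c" "iter_slope j ?c \<le> 1"
    using iter_slope_bounds[OF cosine_abs] by auto
  have o: "0 \<le> iter_cos j ?c - iter_slope j ?c * ?c" by (rule iter_cos_offset_nonneg[OF cosine_abs])
  have "\<bar>iter_slope j ?c * ?c\<bar> \<le> 1"
    unfolding abs_mult using s cosine_abs[of w y] by (intro mult_le_one) auto
  then have o2: "iter_cos j ?c - iter_slope j ?c * ?c \<le> 2"
    using iter_cos_abs[OF cosine_abs, of j w y] by linarith
  have "norm (kern_grad j y w) \<le> norm ((norm y * (iter_cos j ?c - iter_slope j ?c * ?c) / norm w) *\<^sub>R w)
      + norm (iter_slope j ?c *\<^sub>R y)"
    unfolding kern_grad_def by (rule norm_triangle_ineq)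
  also have "\<dots> \<le> norm y * 2 + 1 * norm y"
  proof (intro add_mono)
    show "norm ((norm y * (iter_cos j ?c - iter_slope j ?c * ?c) / norm w) *\<^sub>R w) \<le> norm y * 2"
      using o o2 by (cases "w = 0") (auto simp: abs_mult intro: mult_left_mono)
    show "norm (iter_slope j ?c *\<^sub>R y) \<le> 1 * norm y" using s by (simp add: mult_left_le_one_le)
  qed
  finally show ?thesis by simp
qed

lemma kern_lipschitz: "kern j y a - kern j y b \<le> 3 * norm y * norm (a - b)"
proof (cases "a = 0")
  case True
  have "- (norm b * norm y * iter_cos j (cosine b y)) \<le> norm b * norm y * 1"
    using iter_cos_abs[OF cosine_abs, of j b y] mult_left_mono[of "- iter_cos j (cosine b y)" 1 "norm b * norm y"]
    by simp
  also have "\<dots> \<le> 3 * norm y * norm b"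
  proof -
    have "0 \<le> norm y * norm b" by simp
    then show ?thesis by (simp add: mult.commute)
  qed
  finally show ?thesis using True by (simp add: kern_def)
next
  case False
  have "kern j y a - kern j y b \<le> inner (kern_grad j y a) (a - b)"
    using kern_grad_euler[OF False, of j y] kern_grad_le[OF False, of j y b] by (simp add: inner_diff_right)
  also have "\<dots> \<le> norm (kern_grad j y a) * norm (a - b)" by (rule norm_cauchy_schwarz)
  also have "\<dots> \<le> 3 * norm y * norm (a - b)" by (intro mult_right_mono kern_grad_norm) auto
  finally show ?thesis .
qed

section \<open>Networks of nearly ideal layers\<close>

text \<open>
The map D i w is the linear piece of layer i + 1 that is active at w, so the layer itself
is w \<mapsto> D i w w. The layers are normalized by sqrt 2, and eta is twice the WDC constant. The hypothesis D_germ says that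
the active piece is constant on a short open ray from z and that it computes the layer also at the
end point z, where the pattern may be different. The hypothesis wdc_kernel is the WDC applied to the vector x whose pattern is
used; wdc_isometry is the WDC together with the bound 2 * angle for the distance of 2 * Q_mat
to the identity.
\<close>
locale network =
  fixes V :: "nat \<Rightarrow> 'a::real_inner set" and D :: "nat \<Rightarrow> 'a \<Rightarrow> 'a \<Rightarrow> 'a"
    and d :: nat and \<eta> :: real
  assumes V_subspace: "subspace (V i)"
    and D_linear: "linear (D i w)"
    and D_in: "i < d \<Longrightarrow> w \<in> V i \<Longrightarrow> u \<in> V i \<Longrightarrow> D i w u \<in> V (Suc i)"
    and D_germ: "i < d \<Longrightarrow> z \<in> V i \<Longrightarrow> u \<in> V i \<Longrightarrow>
        \<exists>\<delta>>0. \<exists>L. (\<forall>p. 0 < p \<and> p < \<delta> \<longrightarrow> D i (z + p *\<^sub>R u) = L) \<and> D i z z = L z"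
    and wdc_kernel: "i < d \<Longrightarrow> x \<in> V i \<Longrightarrow> w \<in> V i \<Longrightarrow> u \<in> V i \<Longrightarrow> x \<noteq> 0 \<Longrightarrow> w \<noteq> 0 \<Longrightarrow>
        \<bar>inner (D i x x) (D i w u) - (slope (cosine x w) * inner x u
           + sin (arccos (cosine x w)) / pi * (norm x / norm w * inner w u))\<bar> \<le> \<eta> * norm x * norm u"
    and wdc_isometry: "i < d \<Longrightarrow> x \<in> V i \<Longrightarrow> w \<in> V i \<Longrightarrow> v \<in> V i \<Longrightarrow> u \<in> V i \<Longrightarrow> x \<noteq> 0 \<Longrightarrow> w \<noteq> 0 \<Longrightarrow>
        \<bar>inner (D i x v) (D i w u) - inner v u\<bar> \<le> (\<eta> + 2 * arccos (cosine x w)) * norm v * norm u"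
    and eta_nonneg: "0 \<le> \<eta>"
    and eta_small: "real d * \<eta> \<le> 1 / 100"
begin

fun net :: "nat \<Rightarrow> 'a \<Rightarrow> 'a" where
  "net 0 x = x"
| "net (Suc i) x = D i (net i x) (net i x)"

text \<open>
The product of the active linear pieces at w, applied to a direction u.
\<close>
fun der :: "nat \<Rightarrow> 'a \<Rightarrow> 'a \<Rightarrow> 'a" where
  "der 0 w u = u"
| "der (Suc i) w u = D i (net i w) (der i w u)"

lemma V_add: "x \<in> V i \<Longrightarrow> w \<in> V i \<Longrightarrow> x + w \<in> V i" by (rule subspace_add[OF V_subspace])
lemma V_diff: "x \<in> V i \<Longrightarrow> w \<in> V i \<Longrightarrow> x - w \<in> V i" by (rule subspace_diff[OF V_subspace])
lemma V_scale: "x \<in> V i \<Longrightarrow> r *\<^sub>R x \<in> V i" by (rule subspace_scale[OF V_subspace])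
lemma V_zero: "0 \<in> V i" by (rule subspace_0[OF V_subspace])

lemma V_segment: "a \<in> V i \<Longrightarrow> b \<in> V i \<Longrightarrow> a + s *\<^sub>R (b - a) \<in> V i"
  by (intro V_add V_scale V_diff)

lemma net_zero: "net i 0 = 0"
  by (induction i) (auto simp: linear_0[OF D_linear])

lemma net_in: "i \<le> d \<Longrightarrow> x \<in> V 0 \<Longrightarrow> net i x \<in> V i"
  by (induction i) (auto intro: D_in)

lemma der_in: "i \<le> d \<Longrightarrow> w \<in> V 0 \<Longrightarrow> u \<in> V 0 \<Longrightarrow> der i w u \<in> V i"
  by (induction i) (auto intro!: D_in net_in)

lemma der_self: "der i w w = net i w"
  by (induction i) auto

text \<open>
Behind layer i the ray from z becomes a ray from net i z with a new direction, and D_germ applies to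
it again. Finitely many radii have a positive minimum.
\<close>
lemma net_germ:
  assumes "z \<in> V 0" "u \<in> V 0" "u \<noteq> 0"
  shows "\<exists>\<delta>>0. \<exists>U. \<forall>p. 0 < p \<and> p < \<delta> \<longrightarrow> z + p *\<^sub>R u \<noteq> 0 \<and>
    (\<forall>i\<le>d. der i (z + p *\<^sub>R u) u = U i \<and> net i (z + p *\<^sub>R u) = net i z + p *\<^sub>R U i)"
proof -
  have "\<exists>\<delta>>0. \<exists>U. \<forall>p. 0 < p \<and> p < \<delta> \<longrightarrow>
    (\<forall>i\<le>j. der i (z + p *\<^sub>R u) u = U i \<and> net i (z + p *\<^sub>R u) = net i z + p *\<^sub>R U i)" if "j \<le> d" for j
    using that
  proof (induction j)
    case 0
    show ?case by (intro exI[of _ 1] conjI exI[of _ "\<lambda>_. u"]) auto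
  next
    case (Suc j)
    then obtain \<delta> U where \<delta>: "\<delta> > 0" and U: "\<And>p i. 0 < p \<Longrightarrow> p < \<delta> \<Longrightarrow> i \<le> j \<Longrightarrow>
      der i (z + p *\<^sub>R u) u = U i \<and> net i (z + p *\<^sub>R u) = net i z + p *\<^sub>R U i" by auto
    have "der j (z + (\<delta>/2) *\<^sub>R u) u = U j" using U[of "\<delta>/2" j] \<delta> by auto
    then have "U j \<in> V j" using der_in[of j "z + (\<delta>/2) *\<^sub>R u" u] assms Suc.prems by (auto intro: V_add V_scale)
    moreover have "net j z \<in> V j" using assms Suc.prems by (intro net_in) auto
    ultimately obtain \<delta>' L where \<delta>': "\<delta>' > 0"
      and L: "\<And>p. 0 < p \<Longrightarrow> p < \<delta>' \<Longrightarrow> D j (net j z + p *\<^sub>R U j) = L" "D j (net j z) (net j z) = L (net j z)"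
      using D_germ[of j "net j z" "U j"] Suc.prems by auto
    have linL: "linear L" using L(1)[of "\<delta>'/2"] \<delta>' D_linear[of j "net j z + (\<delta>'/2) *\<^sub>R U j"] by simp
    show ?case
    proof (intro exI[of _ "min \<delta> \<delta>'"] conjI exI[of _ "U(Suc j := L (U j))"] allI impI)
      show "0 < min \<delta> \<delta>'" using \<delta> \<delta>' by simp
      fix p i assume p: "0 < p \<and> p < min \<delta> \<delta>'" and i: "i \<le> Suc j"
      have *: "der j (z + p *\<^sub>R u) u = U j" "net j (z + p *\<^sub>R u) = net j z + p *\<^sub>R U j"
        using U[of p j] p by auto
      have Lp: "D j (net j z + p *\<^sub>R U j) = L" using L(1)[of p] p by auto
      show "der i (z + p *\<^sub>R u) u = (U(Suc j := L (U j))) i"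
        using U[of p i] p i by (cases "i = Suc j") (auto simp: * Lp)
      show "net i (z + p *\<^sub>R u) = net i z + p *\<^sub>R (U(Suc j := L (U j))) i"
        using U[of p i] p i
        by (cases "i = Suc j") (auto simp: * Lp L(2) linear_add[OF linL] linear_cmul[OF linL])
    qed
  qed
  from this[of d] obtain \<delta> U where \<delta>: "\<delta> > 0" and U: "\<And>p. 0 < p \<Longrightarrow> p < \<delta> \<Longrightarrow>
      (\<forall>i\<le>d. der i (z + p *\<^sub>R u) u = U i \<and> net i (z + p *\<^sub>R u) = net i z + p *\<^sub>R U i)" by auto
  obtain \<delta>' where \<delta>': "\<delta>' > 0" "\<And>p. 0 < p \<Longrightarrow> p < \<delta>' \<Longrightarrow> z + p *\<^sub>R u \<noteq> 0"
  proof (cases "z = 0")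
    case True
    then show ?thesis using assms that[of 1] by auto
  next
    case False
    show ?thesis
    proof (rule that[of "norm z / norm u"])
      show "0 < norm z / norm u" using False assms by simp
      fix p assume p: "0 < p" "p < norm z / norm u"
      then have "norm (p *\<^sub>R u) < norm z" using assms by (simp add: less_divide_eq)
      then show "z + p *\<^sub>R u \<noteq> 0" by (metis add.commute add_cancel_left_right eq_neg_iff_add_eq_0 less_irrefl norm_minus_cancel)
    qed
  qed
  show ?thesis
    using \<delta> U \<delta>' by (intro exI[of _ "min \<delta> \<delta>'"] conjI exI[of _ U]) auto
qed

lemma iso: "i < d \<Longrightarrow> w \<in> V i \<Longrightarrow> v \<in> V i \<Longrightarrow> u \<in> V i \<Longrightarrow> w \<noteq> 0 \<Longrightarrow>
    \<bar>inner (D i w v) (D i w u) - inner v u\<bar> \<le> \<eta> * norm v * norm u"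
  using wdc_isometry[of i w w v u] by (simp add: cosine_self)

lemma iso_norm: "i < d \<Longrightarrow> w \<in> V i \<Longrightarrow> u \<in> V i \<Longrightarrow> w \<noteq> 0 \<Longrightarrow>
    (1 - \<eta>) * (norm u)\<^sup>2 \<le> (norm (D i w u))\<^sup>2 \<and> (norm (D i w u))\<^sup>2 \<le> (1 + \<eta>) * (norm u)\<^sup>2"
  using iso[of i w u u] by (simp add: dot_square_norm power2_eq_square algebra_simps abs_le_iff)

lemma d_pos_eta: "i < d \<Longrightarrow> \<eta> \<le> 1 / 100"
proof -
  assume "i < d"
  then have "1 * \<eta> \<le> real d * \<eta>" using eta_nonneg by (intro mult_right_mono) auto
  then show ?thesis using eta_small by simp
qed

lemma pow_upper: "i \<le> d \<Longrightarrow> (1 + \<eta>) ^ i \<le> 1 + 2 * (real d * \<eta>)"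
proof -
  assume i: "i \<le> d"
  have le: "real i * \<eta> \<le> real d * \<eta>" using i eta_nonneg by (intro mult_right_mono) auto
  have "(1 + \<eta>) ^ i \<le> exp \<eta> ^ i" using eta_nonneg by (intro power_mono) auto
  also have "\<dots> = exp (real i * \<eta>)" by (simp add: exp_of_nat_mult)
  also have "\<dots> \<le> exp (real d * \<eta>)" using le by simp
  also have "\<dots> \<le> 1 + real d * \<eta> + (real d * \<eta>)\<^sup>2"
    using eta_nonneg eta_small by (intro exp_bound) auto
  also have "\<dots> \<le> 1 + 2 * (real d * \<eta>)"
  proof -
    have "(real d * \<eta>) * (real d * \<eta>) \<le> (real d * \<eta>) * 1"
      using eta_nonneg eta_small by (intro mult_left_mono) auto
    then show ?thesis unfolding power2_eq_square by linarith
  qed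
  finally show ?thesis .
qed

lemma pow_lower: "i \<le> d \<Longrightarrow> 1 - real d * \<eta> \<le> (1 - \<eta>) ^ i"
proof (cases "i = 0")
  case False
  assume i: "i \<le> d"
  with False have "\<eta> \<le> 1/100" using d_pos_eta[of 0] by auto
  then have "1 + real i * (- \<eta>) \<le> (1 + (- \<eta>)) ^ i" by (intro Bernoulli_inequality) auto
  moreover have "real i * \<eta> \<le> real d * \<eta>" using i eta_nonneg by (intro mult_right_mono) auto
  ultimately show ?thesis by simp
qed (use eta_nonneg in auto)

lemma der_norm: "i \<le> d \<Longrightarrow> w \<in> V 0 \<Longrightarrow> u \<in> V 0 \<Longrightarrow> w \<noteq> 0 \<Longrightarrow>
   net i w \<noteq> 0 \<and> (1 - \<eta>) ^ i * (norm u)\<^sup>2 \<le> (norm (der i w u))\<^sup>2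
   \<and> (norm (der i w u))\<^sup>2 \<le> (1 + \<eta>) ^ i * (norm u)\<^sup>2"
proof (induction i arbitrary: u)
  case (Suc i)
  have e: "\<eta> \<le> 1/100" using d_pos_eta[of i] Suc.prems by simp
  have nz: "net i w \<noteq> 0" using Suc by simp
  have in1: "net i w \<in> V i" "der i w u \<in> V i" using Suc.prems net_in der_in by auto
  have a: "(1 - \<eta>) * (norm v)\<^sup>2 \<le> (norm (D i (net i w) v))\<^sup>2 \<and> (norm (D i (net i w) v))\<^sup>2 \<le> (1 + \<eta>) * (norm v)\<^sup>2"
    if "v \<in> V i" for v using iso_norm[of i "net i w" v] Suc.prems nz in1 that by simp
  have "0 < (1 - \<eta>) * (norm (net i w))\<^sup>2" using e nz by simp
  then have "net (Suc i) w \<noteq> 0" using a[OF in1(1)] by auto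
  moreover have "(1 - \<eta>) * ((1 - \<eta>) ^ i * (norm u)\<^sup>2) \<le> (1 - \<eta>) * (norm (der i w u))\<^sup>2"
    using Suc e by (intro mult_left_mono) auto
  moreover have "(1 + \<eta>) * (norm (der i w u))\<^sup>2 \<le> (1 + \<eta>) * ((1 + \<eta>) ^ i * (norm u)\<^sup>2)"
    using Suc eta_nonneg by (intro mult_left_mono) auto
  ultimately show ?case using a[OF in1(2)] by (auto simp: mult.assoc)
qed auto

lemma net_nonzero: "i \<le> d \<Longrightarrow> w \<in> V 0 \<Longrightarrow> w \<noteq> 0 \<Longrightarrow> net i w \<noteq> 0"
  using der_norm[of i w w] by simp

lemma norm_net_sq: "i \<le> d \<Longrightarrow> w \<in> V 0 \<Longrightarrow>
   (1 - \<eta>) ^ i * (norm w)\<^sup>2 \<le> (norm (net i w))\<^sup>2 \<and> (norm (net i w))\<^sup>2 \<le> (1 + \<eta>) ^ i * (norm w)\<^sup>2"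
  using der_norm[of i w w] by (cases "w = 0") (auto simp: der_self net_zero)

lemma norm_prod_le:
  assumes "i \<le> d" "a \<in> V 0" "w \<in> V 0" "u \<in> V 0" "w \<noteq> 0"
  shows "norm (net i a) * norm (der i w u) \<le> 2 * norm a * norm u"
proof (rule power2_le_imp_le)
  have "(norm (net i a) * norm (der i w u))\<^sup>2 \<le> ((1 + \<eta>) ^ i * (norm a)\<^sup>2) * ((1 + \<eta>) ^ i * (norm u)\<^sup>2)"
    unfolding power_mult_distrib using norm_net_sq[of i a] der_norm[of i w u] assms eta_nonneg
    by (intro mult_mono) auto
  also have "\<dots> = ((1 + \<eta>) ^ i * norm a * norm u)\<^sup>2" by (simp add: power_mult_distrib power2_eq_square)
  also have "\<dots> \<le> (2 * norm a * norm u)\<^sup>2"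
    using pow_upper[OF assms(1)] eta_small eta_nonneg
    by (intro power_mono mult_right_mono) auto
  finally show "(norm (net i a) * norm (der i w u))\<^sup>2 \<le> (2 * norm a * norm u)\<^sup>2" .
qed simp

text \<open>
With the pattern of w on both sides every layer is an isometry up to eta, and the errors add up.
\<close>
lemma inner_net_der:
  assumes "i \<le> d" "w \<in> V 0" "u \<in> V 0" "w \<noteq> 0"
  shows "\<bar>inner (net i w) (der i w u) - inner w u\<bar> \<le> 2 * (real i * \<eta>) * norm w * norm u"
  using assms(1)
proof (induction i)
  case (Suc i)
  have "\<bar>inner (net (Suc i) w) (der (Suc i) w u) - inner (net i w) (der i w u)\<bar> \<le> \<eta> * (norm (net i w) * norm (der i w u))"
    using iso[of i "net i w" "net i w" "der i w u"] Suc assms net_in[of i w] der_in[of i w u] net_nonzero[of i w]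
    by (simp add: mult.assoc)
  also have "\<dots> \<le> \<eta> * (2 * norm w * norm u)"
    using norm_prod_le[of i w w u] Suc assms eta_nonneg by (intro mult_left_mono) auto
  finally have "\<bar>inner (net (Suc i) w) (der (Suc i) w u) - inner (net i w) (der i w u)\<bar> \<le> 2 * \<eta> * norm w * norm u"
    by (simp add: algebra_simps)
  moreover have "2 * (real (Suc i) * \<eta>) * norm w * norm u = 2 * (real i * \<eta>) * norm w * norm u + 2 * \<eta> * norm w * norm u"
    by (simp add: algebra_simps)
  ultimately show ?case using Suc by linarith
qed simp

lemma inner_net_der_uniform:
  assumes "i \<le> d" "w \<in> V 0" "u \<in> V 0" "w \<noteq> 0"
  shows "\<bar>inner (net i w) (der i w u) - inner w u\<bar> \<le> 2 * (real d * \<eta>) * norm w * norm u"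
proof -
  have "2 * (real i * \<eta>) * norm w * norm u \<le> 2 * (real d * \<eta>) * norm w * norm u"
    using assms eta_nonneg by (intro mult_right_mono mult_left_mono) auto
  then show ?thesis using inner_net_der[OF assms] by linarith
qed

text \<open>
One layer changes the cosine by Phi up to an error 2 * eta, of which one half comes from the numerator and one
half from the norms. Since Phi is 1-Lipschitz the errors of the layers add up.
\<close>
lemma cosine_net:
  assumes "i \<le> d" "w \<in> V 0" "y \<in> V 0" "w \<noteq> 0" "y \<noteq> 0"
  shows "\<bar>cosine (net i y) (net i w) - iter_cos i (cosine w y)\<bar> \<le> 2 * (real i * \<eta>)"
  using assms(1)
proof (induction i)
  case (Suc i)
  define c where "c = cosine (net i y) (net i w)"
  define c' where "c' = cosine (net (Suc i) y) (net (Suc i) w)"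
  define Y where "Y = norm (net i y)" define W where "W = norm (net i w)"
  define Y' where "Y' = norm (net (Suc i) y)" define W' where "W' = norm (net (Suc i) w)"
  have i: "i < d" "i \<le> d" using Suc by auto
  have nz: "net i y \<noteq> 0" "net i w \<noteq> 0" using net_nonzero i assms by auto
  have mem: "net i y \<in> V i" "net i w \<in> V i" using net_in i assms by auto
  have pos: "Y > 0" "W > 0" using nz by (auto simp: Y_def W_def)
  have e: "\<eta> \<le> 1/100" using d_pos_eta i by auto
  have "\<bar>inner (net (Suc i) y) (net (Suc i) w) - Y * W * Phi c\<bar> \<le> \<eta> * Y * W"
    using wdc_kernel[of i "net i y" "net i w" "net i w"] i nz mem
    unfolding inner_eq_cosine[of "net i y" "net i w"]
    by (simp add: Phi_def c_def[symmetric] Y_def W_def dot_square_norm power2_eq_square algebra_simps)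
  moreover have "inner (net (Suc i) y) (net (Suc i) w) = Y' * W' * c'"
    unfolding c'_def Y'_def W'_def by (rule inner_eq_cosine)
  ultimately have 1: "\<bar>Y' * W' * c' - Y * W * Phi c\<bar> \<le> \<eta> * (Y * W)" by (simp add: mult.assoc)
  have sq: "(1 - \<eta>) * Y\<^sup>2 \<le> Y'\<^sup>2" "Y'\<^sup>2 \<le> (1 + \<eta>) * Y\<^sup>2" "(1 - \<eta>) * W\<^sup>2 \<le> W'\<^sup>2" "W'\<^sup>2 \<le> (1 + \<eta>) * W\<^sup>2"
    using iso_norm[of i "net i y" "net i y"] iso_norm[of i "net i w" "net i w"] i nz mem
    by (auto simp: Y_def Y'_def W_def W'_def)
  have up: "Y' * W' \<le> (1 + \<eta>) * (Y * W)"
  proof (rule power2_le_imp_le)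
    have "Y'\<^sup>2 * W'\<^sup>2 \<le> ((1 + \<eta>) * Y\<^sup>2) * ((1 + \<eta>) * W\<^sup>2)"
      using sq eta_nonneg by (intro mult_mono) auto
    then show "(Y' * W')\<^sup>2 \<le> ((1 + \<eta>) * (Y * W))\<^sup>2" by (simp add: power_mult_distrib power2_eq_square algebra_simps)
  qed (use eta_nonneg pos in auto)
  have lo: "(1 - \<eta>) * (Y * W) \<le> Y' * W'"
  proof (rule power2_le_imp_le)
    have "((1 - \<eta>) * Y\<^sup>2) * ((1 - \<eta>) * W\<^sup>2) \<le> Y'\<^sup>2 * W'\<^sup>2"
      using sq e by (intro mult_mono) auto
    then show "((1 - \<eta>) * (Y * W))\<^sup>2 \<le> (Y' * W')\<^sup>2" by (simp add: power_mult_distrib power2_eq_square algebra_simps)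
  qed (auto simp: Y'_def W'_def)
  have "\<bar>(Y' * W' - Y * W) * c'\<bar> \<le> \<eta> * (Y * W) * 1"
    unfolding abs_mult using up lo cosine_abs[of "net (Suc i) y" "net (Suc i) w"] eta_nonneg pos
    by (intro mult_mono) (auto simp: c'_def abs_le_iff algebra_simps)
  then have "\<bar>Y * W * (c' - Phi c)\<bar> \<le> Y * W * (2 * \<eta>)"
    using 1 by (simp add: algebra_simps abs_le_iff)
  then have "Y * W * \<bar>c' - Phi c\<bar> \<le> Y * W * (2 * \<eta>)" using pos by (simp add: abs_mult)
  then have 2: "\<bar>c' - Phi c\<bar> \<le> 2 * \<eta>" using pos by (simp add: mult_le_cancel_left)
  have "\<bar>Phi c - Phi (iter_cos i (cosine w y))\<bar> \<le> \<bar>c - iter_cos i (cosine w y)\<bar>"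
    by (intro Phi_lipschitz iter_cos_abs) (auto simp: c_def cosine_abs)
  also have "\<dots> \<le> 2 * (real i * \<eta>)" using Suc i by (simp add: c_def)
  finally show ?case using 2 unfolding c'_def[symmetric] by (simp add: algebra_simps abs_le_iff)
qed (simp add: cosine_commute)

text \<open>
The size of the error of the angles after d layers, divided by pi.
\<close>
definition tau :: real where "tau = sqrt (real d * \<eta>)"

lemma tau: "0 \<le> tau" "tau \<le> 1" "real d * \<eta> \<le> tau" "tau\<^sup>2 = real d * \<eta>"
proof -
  have nn: "0 \<le> real d * \<eta>" using eta_nonneg by simp
  show 0: "0 \<le> tau" using nn by (simp add: tau_def)
  show 1: "tau \<le> 1" using eta_small by (simp add: tau_def real_sqrt_le_1_iff)
  show 2: "tau\<^sup>2 = real d * \<eta>" using nn by (simp add: tau_def)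
  have "tau * tau \<le> tau * 1" using 0 1 by (intro mult_left_mono) auto
  then show "real d * \<eta> \<le> tau" using 2 by (simp add: power2_eq_square)
qed

lemma angle_net:
  assumes "i \<le> d" "w \<in> V 0" "y \<in> V 0" "w \<noteq> 0" "y \<noteq> 0"
  shows "\<bar>arccos (cosine (net i y) (net i w)) - arccos (iter_cos i (cosine w y))\<bar> \<le> pi * tau"
proof -
  let ?a = "cosine (net i y) (net i w)" and ?b = "iter_cos i (cosine w y)"
  have "2 * (arccos ?a - arccos ?b)\<^sup>2 / pi\<^sup>2 \<le> \<bar>?a - ?b\<bar>"
    by (intro arccos_holder cosine_abs iter_cos_abs)
  also have "\<dots> \<le> 2 * (real i * \<eta>)" by (rule cosine_net[OF assms])
  also have "\<dots> \<le> 2 * (real d * \<eta>)" using assms eta_nonneg by (intro mult_left_mono mult_right_mono) auto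
  also have "\<dots> = 2 * tau\<^sup>2" by (simp add: tau)
  finally have "\<bar>arccos ?a - arccos ?b\<bar>\<^sup>2 \<le> (pi * tau)\<^sup>2"
    by (simp add: power_mult_distrib divide_le_eq mult.commute)
  then show ?thesis by (rule power2_le_imp_le) (use tau pi_ge_zero in auto)
qed

lemma norm_ratio:
  assumes "i \<le> d" "w \<in> V 0" "y \<in> V 0" "w \<noteq> 0" "y \<noteq> 0"
  shows "\<bar>norm (net i y) / norm (net i w) * (norm w / norm y) - 1\<bar> \<le> 3 * (real d * \<eta>)"
proof -
  define t where "t = real d * \<eta>"
  have t: "0 \<le> t" "t \<le> 1/100" using eta_nonneg eta_small by (auto simp: t_def)
  define r where "r = norm (net i y) / norm (net i w) * (norm w / norm y)"
  have r0: "0 \<le> r" by (simp add: r_def)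
  have nz: "net i w \<noteq> 0" using net_nonzero assms by auto
  have b: "(1 - t) * (norm v)\<^sup>2 \<le> (norm (net i v))\<^sup>2 \<and> (norm (net i v))\<^sup>2 \<le> (1 + 2 * t) * (norm v)\<^sup>2"
    if "v \<in> V 0" for v
  proof -
    have "(1 - t) * (norm v)\<^sup>2 \<le> (1 - \<eta>) ^ i * (norm v)\<^sup>2"
      using pow_lower[OF assms(1)] by (intro mult_right_mono) (auto simp: t_def)
    moreover have "(1 + \<eta>) ^ i * (norm v)\<^sup>2 \<le> (1 + 2 * t) * (norm v)\<^sup>2"
      using pow_upper[OF assms(1)] by (intro mult_right_mono) (auto simp: t_def)
    ultimately show ?thesis using norm_net_sq[OF assms(1) that] by linarith
  qed
  have rr: "r\<^sup>2 * ((norm (net i w))\<^sup>2 * (norm y)\<^sup>2) = (norm (net i y))\<^sup>2 * (norm w)\<^sup>2"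
    using nz assms by (simp add: r_def power_mult_distrib power_divide)
  have pos: "0 < (norm w)\<^sup>2 * (norm y)\<^sup>2" using assms by simp
  have "r\<^sup>2 * (1 - t) * ((norm w)\<^sup>2 * (norm y)\<^sup>2) \<le> r\<^sup>2 * ((norm (net i w))\<^sup>2 * (norm y)\<^sup>2)"
    using b[OF assms(2)] mult_left_mono[of "(1 - t) * (norm w)\<^sup>2" "(norm (net i w))\<^sup>2" "r\<^sup>2 * (norm y)\<^sup>2"]
    by (simp add: mult.commute mult.left_commute)
  also have "\<dots> \<le> (1 + 2 * t) * ((norm w)\<^sup>2 * (norm y)\<^sup>2)"
    unfolding rr using b[OF assms(3)] mult_right_mono[of "(norm (net i y))\<^sup>2" "(1 + 2 * t) * (norm y)\<^sup>2" "(norm w)\<^sup>2"]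
    by (simp add: mult.commute mult.left_commute)
  finally have u: "r\<^sup>2 * (1 - t) \<le> 1 + 2 * t" using pos by (simp only: mult_le_cancel_right_pos)
  have "(1 - t) * ((norm w)\<^sup>2 * (norm y)\<^sup>2) \<le> (norm (net i y))\<^sup>2 * (norm w)\<^sup>2"
    using b[OF assms(3)] mult_right_mono[of "(1 - t) * (norm y)\<^sup>2" "(norm (net i y))\<^sup>2" "(norm w)\<^sup>2"]
    by (simp add: mult.commute mult.left_commute)
  also have "\<dots> \<le> r\<^sup>2 * (1 + 2 * t) * ((norm w)\<^sup>2 * (norm y)\<^sup>2)"
    unfolding rr[symmetric] using b[OF assms(2)] mult_left_mono[of "(norm (net i w))\<^sup>2" "(1 + 2 * t) * (norm w)\<^sup>2" "r\<^sup>2 * (norm y)\<^sup>2"]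
    by (simp add: mult.commute mult.left_commute)
  finally have l: "1 - t \<le> r\<^sup>2 * (1 + 2 * t)" using pos by (simp only: mult_le_cancel_right_pos)
  have tt: "t * t \<le> t * (1/100)" using t by (intro mult_left_mono) auto
  have "r \<le> 1 + 3 * t"
  proof (rule ccontr)
    assume "\<not> r \<le> 1 + 3 * t"
    then have "(1 + 3 * t)\<^sup>2 \<le> r\<^sup>2" using t by (intro power_mono) auto
    moreover have "1 + 6 * t \<le> (1 + 3 * t)\<^sup>2" by (simp add: power2_eq_square algebra_simps)
    ultimately have "(1 + 6 * t) * (1 - t) \<le> r\<^sup>2 * (1 - t)"
      using t by (intro mult_right_mono) auto
    then have "(1 + 6 * t) * (1 - t) \<le> 1 + 2 * t" using u by linarith
    then have "t = 0" using t tt by (simp add: algebra_simps)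
    then show False using u \<open>\<not> r \<le> 1 + 3 * t\<close> r0 by (simp add: power_le_one_iff abs_square_le_1)
  qed
  moreover have "1 - 3 * t \<le> r"
  proof (rule ccontr)
    assume n: "\<not> 1 - 3 * t \<le> r"
    then have "r\<^sup>2 \<le> (1 - 3 * t)\<^sup>2" using t r0 by (intro power_mono) auto
    also have "\<dots> \<le> 1 - 4 * t" using t tt by (simp add: power2_eq_square algebra_simps)
    finally have "r\<^sup>2 * (1 + 2 * t) \<le> (1 - 4 * t) * (1 + 2 * t)" using t by (intro mult_right_mono) auto
    then have "1 - t \<le> (1 - 4 * t) * (1 + 2 * t)" using l by linarith
    then have "t + 8 * (t * t) \<le> 0" by (simp add: algebra_simps)
    then have "t = 0" using t zero_le_square[of t] by linarith
    then have "1 \<le> r\<^sup>2" using l by simp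
    moreover have r1: "r < 1" using n \<open>t = 0\<close> by simp
    moreover have "r * r \<le> r * 1" using r0 r1 by (intro mult_left_mono) auto
    ultimately show False by (simp add: power2_eq_square)
  qed
  ultimately show ?thesis unfolding r_def[symmetric] t_def[symmetric] by linarith
qed

text \<open>
The derivative of the inner product with net i y follows the recursion inner_kern_grad_Suc of the
kernel. One layer adds an error of at most 13 * tau: 2 from the WDC, 2 from the slope, 8 from the
inner product with net i w and the ratio of the norms, 1 from the sine.
\<close>
lemma inner_net_der_kernel:
  assumes "i \<le> d" "w \<in> V 0" "y \<in> V 0" "u \<in> V 0" "w \<noteq> 0" "y \<noteq> 0"
  shows "\<bar>inner (net i y) (der i w u) - inner (kern_grad i y w) u\<bar> \<le> 13 * real i * tau * norm y * norm u"
  using assms(1)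
proof (induction i)
  case 0
  have "inner (kern_grad 0 y w) u = inner y u" unfolding inner_kern_grad by simp
  then show ?case by simp
next
  case (Suc i)
  define c where "c = cosine (net i y) (net i w)"
  define b where "b = iter_cos i (cosine w y)"
  define k where "k = inner (net i y) (der i w u)"
  define K where "K = inner (kern_grad i y w) u"
  define X where "X = norm (net i y) / norm (net i w) * inner (net i w) (der i w u)"
  define Z where "Z = norm y / norm w * inner w u"
  define N where "N = norm y * norm u"
  have N0: "0 \<le> N" by (simp add: N_def)
  have i: "i < d" "i \<le> d" using Suc by auto
  have nz: "net i y \<noteq> 0" "net i w \<noteq> 0" using net_nonzero i assms by auto
  have mem: "net i y \<in> V i" "net i w \<in> V i" "der i w u \<in> V i" using net_in der_in i assms by auto
  have t1: "real d * \<eta> \<le> tau" by (rule tau)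
  have eta_tau: "\<eta> \<le> tau"
  proof -
    have "1 * \<eta> \<le> real d * \<eta>" using i eta_nonneg by (intro mult_right_mono) auto
    then show ?thesis using t1 by simp
  qed
  have pr: "norm (net i y) * norm (der i w u) \<le> 2 * N"
    using norm_prod_le[of i y w u] i assms by (simp add: N_def mult.assoc)
  have step: "\<bar>inner (net (Suc i) y) (der (Suc i) w u) - (slope c * k + sin (arccos c) / pi * X)\<bar> \<le> tau * (2 * N)"
  proof -
    have "\<bar>inner (net (Suc i) y) (der (Suc i) w u) - (slope c * k + sin (arccos c) / pi * X)\<bar>
        \<le> \<eta> * (norm (net i y) * norm (der i w u))"
      using wdc_kernel[of i "net i y" "net i w" "der i w u"] i nz mem by (simp add: c_def k_def X_def mult.assoc)
    also have "\<dots> \<le> tau * (2 * N)" using eta_tau eta_nonneg pr tau N0 by (intro mult_mono[of \<eta> tau "norm (net i y) * norm (der i w u)" "2 * N"]) auto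
    finally show ?thesis .
  qed
  have ideal: "inner (kern_grad (Suc i) y w) u = slope b * K + sin (arccos b) / pi * Z"
    unfolding inner_kern_grad_Suc b_def K_def Z_def ..
  have ang: "\<bar>arccos c - arccos b\<bar> \<le> pi * tau" unfolding c_def b_def using angle_net i assms by auto
  have babs: "\<bar>b\<bar> \<le> 1" unfolding b_def by (intro iter_cos_abs cosine_abs)
  have s1: "\<bar>(slope c - slope b) * k\<bar> \<le> tau * (2 * N)"
    unfolding abs_mult
  proof (intro mult_mono)
    have "\<bar>slope c - slope b\<bar> = \<bar>arccos c - arccos b\<bar> / pi"
      by (simp add: slope_def diff_divide_distrib[symmetric] abs_minus_commute)
    also have "\<dots> \<le> tau" using ang by (simp add: divide_le_eq mult.commute)
    finally show "\<bar>slope c - slope b\<bar> \<le> tau" .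
    show "\<bar>k\<bar> \<le> 2 * N" unfolding k_def using Cauchy_Schwarz_ineq2[of "net i y" "der i w u"] pr by linarith
  qed (use tau in auto)
  have s2: "\<bar>slope b * (k - K)\<bar> \<le> \<bar>k - K\<bar>"
    unfolding abs_mult using slope_bounds[OF babs] by (intro mult_left_le_one_le) auto
  have Zb: "\<bar>Z\<bar> \<le> N"
  proof -
    have "\<bar>Z\<bar> \<le> norm y / norm w * (norm w * norm u)"
      unfolding Z_def abs_mult using Cauchy_Schwarz_ineq2[of w u] by (intro mult_mono) auto
    then show ?thesis using assms by (simp add: N_def)
  qed
  have XZ: "\<bar>X - Z\<bar> \<le> 8 * tau * N"
  proof -
    define r where "r = norm (net i y) / norm (net i w) * (norm w / norm y)"
    define l where "l = inner (net i w) (der i w u)"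
    have X: "X = r * (norm y / norm w * l)" using assms by (simp add: X_def r_def l_def)
    have yw: "norm y / norm w * (norm w * norm u) = N" using assms by (simp add: N_def)
    have r: "\<bar>r - 1\<bar> \<le> 3 * tau" using norm_ratio[of i w y] i assms t1 by (simp add: r_def)
    have l: "\<bar>l\<bar> \<le> 2 * norm w * norm u"
      using Cauchy_Schwarz_ineq2[of "net i w" "der i w u"] norm_prod_le[of i w w u] i assms by (simp add: l_def)
    have l2: "\<bar>l - inner w u\<bar> \<le> 2 * tau * norm w * norm u"
    proof -
      have "2 * (real d * \<eta>) * norm w * norm u \<le> 2 * tau * norm w * norm u"
        using t1 by (intro mult_right_mono) auto
      moreover have "\<bar>l - inner w u\<bar> \<le> 2 * (real d * \<eta>) * norm w * norm u"
        unfolding l_def by (rule inner_net_der_uniform[OF i(2) assms(2,4,5)])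
      ultimately show ?thesis by linarith
    qed
    have "\<bar>(r - 1) * (norm y / norm w * l)\<bar> \<le> (3 * tau) * (norm y / norm w * (2 * norm w * norm u))"
      unfolding abs_mult using r l tau by (intro mult_mono) auto
    also have "\<dots> = 6 * tau * N" using assms by (simp add: N_def)
    finally have 1: "\<bar>(r - 1) * (norm y / norm w * l)\<bar> \<le> 6 * tau * N" .
    have "\<bar>norm y / norm w * (l - inner w u)\<bar> \<le> norm y / norm w * (2 * tau * norm w * norm u)"
      unfolding abs_mult using l2 by (intro mult_mono) auto
    also have "\<dots> = 2 * tau * N" using assms by (simp add: N_def)
    finally have 2: "\<bar>norm y / norm w * (l - inner w u)\<bar> \<le> 2 * tau * N" .
    have "X - Z = (r - 1) * (norm y / norm w * l) + norm y / norm w * (l - inner w u)"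
      unfolding X Z_def by (simp only: algebra_simps)
    moreover have "\<bar>P + Q\<bar> \<le> 8 * tau * N" if "\<bar>P\<bar> \<le> 6 * tau * N" "\<bar>Q\<bar> \<le> 2 * tau * N" for P Q
      using that by linarith
    ultimately show ?thesis using 1 2 by metis
  qed
  have s3: "\<bar>sin (arccos c) / pi * (X - Z)\<bar> \<le> 8 * tau * N"
  proof -
    have "\<bar>sin (arccos c)\<bar> \<le> pi"
      using pi_ge_two by (intro order_trans[OF abs_sin_le_one]) simp
    then have "\<bar>sin (arccos c) / pi\<bar> \<le> 1" by (simp add: divide_le_eq)
    then have "\<bar>sin (arccos c) / pi * (X - Z)\<bar> \<le> \<bar>X - Z\<bar>"
      unfolding abs_mult by (intro mult_left_le_one_le) auto
    then show ?thesis using XZ by linarith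
  qed
  have s4: "\<bar>(sin (arccos c) - sin (arccos b)) / pi * Z\<bar> \<le> tau * N"
    unfolding abs_mult
  proof (intro mult_mono Zb)
    have "\<bar>sin (arccos c) - sin (arccos b)\<bar> \<le> pi * tau" using sin_lipschitz[of "arccos c" "arccos b"] ang by linarith
    then show "\<bar>(sin (arccos c) - sin (arccos b)) / pi\<bar> \<le> tau" by (simp add: divide_le_eq mult.commute)
  qed (use tau in auto)
  have dec: "(slope c * k + sin (arccos c) / pi * X) - (slope b * K + sin (arccos b) / pi * Z)
     = (slope c - slope b) * k + slope b * (k - K) + sin (arccos c) / pi * (X - Z)
       + (sin (arccos c) - sin (arccos b)) / pi * Z"
    by (simp add: algebra_simps diff_divide_distrib)
  have IH: "\<bar>k - K\<bar> \<le> 13 * real i * tau * N" using Suc i by (simp add: k_def K_def N_def mult.assoc)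
  have "\<bar>inner (net (Suc i) y) (der (Suc i) w u) - inner (kern_grad (Suc i) y w) u\<bar>
     \<le> tau * (2 * N) + (tau * (2 * N) + 13 * real i * tau * N + 8 * tau * N + tau * N)"
  proof -
    have "\<bar>p - q\<bar> \<le> e0 + (e1 + e2 + e3 + e4)"
      if "\<bar>p - m\<bar> \<le> e0" "m - q = x1 + x2 + x3 + x4" "\<bar>x1\<bar> \<le> e1" "\<bar>x2\<bar> \<le> e2" "\<bar>x3\<bar> \<le> e3" "\<bar>x4\<bar> \<le> e4"
      for p q m x1 x2 x3 x4 e0 e1 e2 e3 e4 :: real using that by linarith
    from this[OF step dec s1 order_trans[OF s2 IH] s3 s4] show ?thesis unfolding ideal .
  qed
  also have "\<dots> = 13 * real (Suc i) * tau * norm y * norm u" by (simp add: N_def algebra_simps)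
  finally show ?case .
qed

end


section \<open>Differences of a network follow the kernel\<close>

lemma ge_if_ge_minus_small:
  fixes X Y C p :: real
  assumes "0 < p" "\<And>q. 0 < q \<Longrightarrow> q < p \<Longrightarrow> Y - q * C \<le> X"
  shows "Y \<le> X"
proof (rule field_le_epsilon)
  fix g :: real assume g: "0 < g"
  define q where "q = min (p/2) (g / (\<bar>C\<bar> + 1))"
  have q: "0 < q" "q < p" "q \<le> g / (\<bar>C\<bar> + 1)" using assms(1) g by (auto simp: q_def)
  have "q * C \<le> q * (\<bar>C\<bar> + 1)" using q by (intro mult_left_mono) auto
  also have "\<dots> \<le> g" using q by (simp add: le_divide_eq)
  finally show "Y \<le> X + g" using assms(2)[OF q(1,2)] by linarith
qed

context network
begin

lemma net_lipschitz:
  assumes "a \<in> V 0" "b \<in> V 0"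
  shows "norm (net d b - net d a) \<le> 2 * norm (b - a)"
proof -
  define v where "v = net d b - net d a"
  have "\<bar>inner v (net d b) - inner v (net d a)\<bar> \<le> (2 * norm v) * norm (b - a)"
  proof (rule segment_lipschitz[where S = "V 0"])
    show "a + s *\<^sub>R (b - a) \<in> V 0" for s using assms by (rule V_segment)
    fix z w assume zw: "z \<in> V 0" "w \<in> V 0" "z \<noteq> w"
    define u where "u = w - z"
    have u: "u \<in> V 0" "u \<noteq> 0" using zw by (auto simp: u_def intro: V_diff)
    obtain \<delta> U where \<delta>: "\<delta> > 0" and g: "\<And>p. 0 < p \<Longrightarrow> p < \<delta> \<Longrightarrow> z + p *\<^sub>R u \<noteq> 0 \<and>
        (\<forall>i\<le>d. der i (z + p *\<^sub>R u) u = U i \<and> net i (z + p *\<^sub>R u) = net i z + p *\<^sub>R U i)"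
      using net_germ[OF zw(1) u] by blast
    show "\<exists>\<delta>>0. \<forall>p. 0 < p \<and> p < \<delta> \<longrightarrow> \<bar>inner v (net d (z + p *\<^sub>R (w - z))) - inner v (net d z)\<bar> \<le> 2 * norm v * p * norm (w - z)"
    proof (intro exI[of _ \<delta>] conjI allI impI \<delta>)
      fix p assume p: "0 < p \<and> p < \<delta>"
      have w': "z + p *\<^sub>R u \<in> V 0" using zw u by (auto intro: V_add V_scale)
      have "(norm (U d))\<^sup>2 \<le> (1 + \<eta>) ^ d * (norm u)\<^sup>2"
        using der_norm[of d "z + p *\<^sub>R u" u] g[of p] p w' u by auto
      also have "\<dots> \<le> 4 * (norm u)\<^sup>2"
        using pow_upper[of d] eta_small by (intro mult_right_mono) auto
      finally have "norm (U d) \<le> 2 * norm u" by (intro power2_le_imp_le[of "norm (U d)" "2 * norm u"]) (auto simp: power_mult_distrib)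
      then have "\<bar>inner v (p *\<^sub>R U d)\<bar> \<le> norm v * (p * (2 * norm u))"
        using p Cauchy_Schwarz_ineq2[of v "p *\<^sub>R U d"]
        by (intro order_trans[OF Cauchy_Schwarz_ineq2] mult_left_mono) auto
      moreover have "net d (z + p *\<^sub>R u) = net d z + p *\<^sub>R U d" using g[of p] p by auto
      ultimately show "\<bar>inner v (net d (z + p *\<^sub>R (w - z))) - inner v (net d z)\<bar> \<le> 2 * norm v * p * norm (w - z)"
        unfolding u_def[symmetric] by (simp add: inner_add_right algebra_simps)
    qed
  qed
  then have "inner v v \<le> (2 * norm (b - a)) * norm v"
    unfolding v_def by (simp add: inner_diff_right algebra_simps)
  then show ?thesis unfolding v_def[symmetric] by (rule norm_le_if_inner_le) simp
qed

lemma norm_net_le: "a \<in> V 0 \<Longrightarrow> norm (net d a) \<le> 2 * norm a"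
  using net_lipschitz[of 0 a] V_zero by (simp add: net_zero)

text \<open>
On a linear piece starting at z the squared norm is quadratic. Its expansion is taken around the
end point of the piece, where inner_net_der applies, and the radius is chosen so that the quadratic terms
are of the size of the linear ones.
\<close>
lemma energy_lipschitz:
  assumes "a \<in> V 0" "b \<in> V 0" "norm a \<le> M" "norm b \<le> M" "0 < M"
  shows "\<bar>((norm (net d b))\<^sup>2 - (norm b)\<^sup>2) - ((norm (net d a))\<^sup>2 - (norm a)\<^sup>2)\<bar>
     \<le> (6 * (real d * \<eta>) * M) * norm (b - a)"
proof (rule segment_lipschitz[where S = "{x \<in> V 0. norm x \<le> M}"])
  note conv = norm_segment_le[where c = 0, unfolded diff_zero]
  show "a + s *\<^sub>R (b - a) \<in> {x \<in> V 0. norm x \<le> M}" if "0 \<le> s" "s \<le> 1" for s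
    using assms that by (auto intro: V_segment conv)
  fix z w assume zw: "z \<in> {x \<in> V 0. norm x \<le> M}" "w \<in> {x \<in> V 0. norm x \<le> M}" "z \<noteq> w"
  define u where "u = w - z"
  have u: "u \<in> V 0" "u \<noteq> 0" using zw by (auto simp: u_def intro: V_diff)
  obtain \<delta> U where \<delta>: "\<delta> > 0" and g: "\<And>p. 0 < p \<Longrightarrow> p < \<delta> \<Longrightarrow> z + p *\<^sub>R u \<noteq> 0 \<and>
      (\<forall>i\<le>d. der i (z + p *\<^sub>R u) u = U i \<and> net i (z + p *\<^sub>R u) = net i z + p *\<^sub>R U i)"
    using net_germ[OF _ u, of z] zw by blast
  define t where "t = real d * \<eta>"
  have t0: "0 \<le> t" using eta_nonneg by (simp add: t_def)
  show "\<exists>\<delta>>0. \<forall>p. 0 < p \<and> p < \<delta> \<longrightarrow>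
     \<bar>(norm (net d (z + p *\<^sub>R (w - z))))\<^sup>2 - (norm (z + p *\<^sub>R (w - z)))\<^sup>2 - ((norm (net d z))\<^sup>2 - (norm z)\<^sup>2)\<bar>
       \<le> 6 * (real d * \<eta>) * M * p * norm (w - z)"
  proof (intro exI[of _ "min \<delta> (min 1 (M / norm u))"] conjI allI impI)
    show "0 < min \<delta> (min 1 (M / norm u))" using \<delta> u assms by simp
    fix p assume p: "0 < p \<and> p < min \<delta> (min 1 (M / norm u))"
    define x where "x = z + p *\<^sub>R u"
    have x: "x \<in> V 0" "x \<noteq> 0" "norm x \<le> M"
      using zw u g[of p] p conv[of z M w p] by (auto simp: x_def u_def intro: V_segment)
    have pu: "p * norm u \<le> M" using p u by (simp add: less_divide_eq)
    have d1: "der d x u = U d" "net d x = net d z + p *\<^sub>R U d" using g[of p] p by (auto simp: x_def)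
    have i1: "\<bar>inner (net d x) (U d) - inner x u\<bar> \<le> 2 * t * M * norm u"
    proof -
      have "\<bar>inner (net d x) (U d) - inner x u\<bar> \<le> 2 * t * norm x * norm u"
        using inner_net_der_uniform[of d x u] x u d1 by (simp add: t_def)
      also have "\<dots> \<le> 2 * t * M * norm u" using x t0 by (intro mult_right_mono mult_left_mono) auto
      finally show ?thesis .
    qed
    have i2: "\<bar>(norm (U d))\<^sup>2 - (norm u)\<^sup>2\<bar> \<le> 2 * t * (norm u)\<^sup>2"
    proof -
      have "(1 - t) * (norm u)\<^sup>2 \<le> (1 - \<eta>) ^ d * (norm u)\<^sup>2"
        using pow_lower[of d] by (intro mult_right_mono) (auto simp: t_def)
      moreover have "(1 + \<eta>) ^ d * (norm u)\<^sup>2 \<le> (1 + 2 * t) * (norm u)\<^sup>2"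
        using pow_upper[of d] by (intro mult_right_mono) (auto simp: t_def)
      moreover have "0 \<le> t * (norm u)\<^sup>2" using t0 by simp
      ultimately show ?thesis using der_norm[of d x u] x u d1 by (simp add: algebra_simps abs_le_iff)
    qed
    have nz: "net d z = net d x - p *\<^sub>R U d" "z = x - p *\<^sub>R u" using d1 by (auto simp: x_def)
    have "((norm (net d x))\<^sup>2 - (norm x)\<^sup>2) - ((norm (net d z))\<^sup>2 - (norm z)\<^sup>2)
       = 2 * p * (inner (net d x) (U d) - inner x u) - p\<^sup>2 * ((norm (U d))\<^sup>2 - (norm u)\<^sup>2)"
    proof -
      have sq: "(norm (a - p *\<^sub>R b))\<^sup>2 = (norm a)\<^sup>2 - 2 * p * inner a b + p\<^sup>2 * (norm b)\<^sup>2" for a b :: 'a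
        unfolding power2_norm_eq_inner by (simp add: inner_diff inner_commute algebra_simps power2_eq_square)
      have q1: "(norm (net d z))\<^sup>2 = (norm (net d x))\<^sup>2 - 2 * p * inner (net d x) (U d) + p\<^sup>2 * (norm (U d))\<^sup>2"
        by (subst nz(1)) (rule sq)
      have q2: "(norm z)\<^sup>2 = (norm x)\<^sup>2 - 2 * p * inner x u + p\<^sup>2 * (norm u)\<^sup>2"
        by (subst nz(2)) (rule sq)
      show ?thesis unfolding q1 q2 by (simp only: right_diff_distrib)
    qed
    also have "\<bar>\<dots>\<bar> \<le> 2 * p * (2 * t * M * norm u) + p\<^sup>2 * (2 * t * (norm u)\<^sup>2)"
    proof -
      have "\<bar>2 * p * (inner (net d x) (U d) - inner x u)\<bar> \<le> 2 * p * (2 * t * M * norm u)"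
        unfolding abs_mult using i1 p by (intro mult_mono) auto
      moreover have "\<bar>p\<^sup>2 * ((norm (U d))\<^sup>2 - (norm u)\<^sup>2)\<bar> \<le> p\<^sup>2 * (2 * t * (norm u)\<^sup>2)"
        unfolding abs_mult using i2 by (intro mult_mono) auto
      ultimately show ?thesis by (intro order_trans[OF abs_triangle_ineq4] add_mono)
    qed
    also have "p\<^sup>2 * (2 * t * (norm u)\<^sup>2) = (2 * t * p * norm u) * (p * norm u)"
      by (simp add: power2_eq_square)
    also have "\<dots> \<le> (2 * t * p * norm u) * M" using pu t0 p by (intro mult_left_mono) auto
    also have "2 * p * (2 * t * M * norm u) + (2 * t * p * norm u) * M = 6 * t * M * p * norm u" by simp
    finally show "\<bar>(norm (net d (z + p *\<^sub>R (w - z))))\<^sup>2 - (norm (z + p *\<^sub>R (w - z)))\<^sup>2 - ((norm (net d z))\<^sup>2 - (norm z)\<^sup>2)\<bar>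
       \<le> 6 * (real d * \<eta>) * M * p * norm (w - z)"
      unfolding x_def u_def t_def by simp
  qed
qed

text \<open>
On a linear piece the derivative of the left inner product is constant, and it is close to the
derivative of the kernel. Convexity of the kernel replaces differentiation.
\<close>
lemma kernel_lipschitz:
  assumes "a \<in> V 0" "b \<in> V 0" "y \<in> V 0" "y \<noteq> 0"
  shows "\<bar>(inner (net d y) (net d b) - kern d y b) - (inner (net d y) (net d a) - kern d y a)\<bar>
     \<le> (13 * real d * tau * norm y) * norm (b - a)"
proof (rule segment_lipschitz[where S = "V 0"])
  show "a + s *\<^sub>R (b - a) \<in> V 0" for s using assms(1,2) by (rule V_segment)
  fix z w assume zw: "z \<in> V 0" "w \<in> V 0" "z \<noteq> w"
  define u where "u = w - z"
  have u: "u \<in> V 0" "u \<noteq> 0" using zw by (auto simp: u_def intro: V_diff)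
  obtain \<delta> U where \<delta>: "\<delta> > 0" and g: "\<And>p. 0 < p \<Longrightarrow> p < \<delta> \<Longrightarrow> z + p *\<^sub>R u \<noteq> 0 \<and>
      (\<forall>i\<le>d. der i (z + p *\<^sub>R u) u = U i \<and> net i (z + p *\<^sub>R u) = net i z + p *\<^sub>R U i)"
    using net_germ[OF zw(1) u] by blast
  define k where "k = inner (net d y) (U d)"
  define E where "E = 13 * real d * tau * norm y * norm u"
  have grad: "k - E \<le> inner (kern_grad d y (z + q *\<^sub>R u)) u \<and> inner (kern_grad d y (z + q *\<^sub>R u)) u \<le> k + E"
    if "0 < q" "q < \<delta>" for q
  proof -
    have "z + q *\<^sub>R u \<in> V 0" using zw u by (auto intro: V_add V_scale)
    then show ?thesis
      using inner_net_der_kernel[of d "z + q *\<^sub>R u" y u] g[OF that] assms(3,4) u by (simp add: k_def E_def abs_le_iff)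
  qed
  show "\<exists>\<delta>>0. \<forall>p. 0 < p \<and> p < \<delta> \<longrightarrow>
     \<bar>inner (net d y) (net d (z + p *\<^sub>R (w - z))) - kern d y (z + p *\<^sub>R (w - z)) - (inner (net d y) (net d z) - kern d y z)\<bar>
       \<le> 13 * real d * tau * norm y * p * norm (w - z)"
  proof (intro exI[of _ \<delta>] conjI allI impI \<delta>)
    fix p assume p: "0 < p \<and> p < \<delta>"
    define x where "x = z + p *\<^sub>R u"
    have x0: "x \<noteq> 0" using g[of p] p by (simp add: x_def)
    have up: "kern d y x - kern d y z \<le> p * (k + E)"
    proof -
      have "kern d y x - kern d y z \<le> inner (kern_grad d y x) (x - z)"
        using kern_grad_euler[OF x0, of d y] kern_grad_le[OF x0, of d y z] by (simp add: inner_diff_right)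
      also have "\<dots> = p * inner (kern_grad d y x) u" by (simp add: x_def)
      also have "\<dots> \<le> p * (k + E)" using grad[of p] p by (intro mult_left_mono) (auto simp: x_def)
      finally show ?thesis .
    qed
    \<comment> \<open>The piece ends at z, where the pattern may be different, so the subgradient is taken at a point inside the piece that tends to z.\<close>
    have lo: "p * (k - E) \<le> kern d y x - kern d y z"
    proof (rule ge_if_ge_minus_small[where p = p and C = "k - E + 3 * norm y * norm u"])
      show "0 < p" using p by simp
      fix q assume q: "0 < q" "q < p"
      define s where "s = z + q *\<^sub>R u"
      have s0: "s \<noteq> 0" using g[of q] p q by (simp add: s_def)
      have "inner (kern_grad d y s) (x - s) \<le> kern d y x - kern d y s"
        using kern_grad_euler[OF s0, of d y] kern_grad_le[OF s0, of d y x] by (simp add: inner_diff_right)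
      moreover have "x - s = (p - q) *\<^sub>R u" by (simp add: x_def s_def algebra_simps)
      moreover have "(p - q) * (k - E) \<le> (p - q) * inner (kern_grad d y s) u"
        using grad[of q] p q by (intro mult_left_mono) (auto simp: s_def)
      moreover have "kern d y z - kern d y s \<le> 3 * norm y * (q * norm u)"
        using kern_lipschitz[of d y z s] q by (simp add: s_def)
      ultimately show "p * (k - E) - q * (k - E + 3 * norm y * norm u) \<le> kern d y x - kern d y z"
        by (simp add: algebra_simps)
    qed
    have "inner (net d y) (net d x) - inner (net d y) (net d z) = p * k"
      using g[of p] p by (simp add: x_def k_def inner_add_right)
    then have "\<bar>inner (net d y) (net d x) - kern d y x - (inner (net d y) (net d z) - kern d y z)\<bar> \<le> p * E"
      using up lo by (simp add: algebra_simps abs_le_iff)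
    then show "\<bar>inner (net d y) (net d (z + p *\<^sub>R (w - z))) - kern d y (z + p *\<^sub>R (w - z)) - (inner (net d y) (net d z) - kern d y z)\<bar>
       \<le> 13 * real d * tau * norm y * p * norm (w - z)"
      unfolding x_def u_def E_def by (simp add: mult.commute mult.left_commute)
  qed
qed

section \<open>The model and Clarke subgradients\<close>

text \<open>
The property of Clarke subgradients that the proof uses: in every direction u, a local upper bound
L for the difference quotients bounds the inner product with u. Directions and base points are taken from the input
space only.
\<close>
definition clarke_at :: "('a \<Rightarrow> real) \<Rightarrow> 'a \<Rightarrow> 'a \<Rightarrow> bool" where
  "clarke_at f x v \<longleftrightarrow> (\<forall>u\<in>V 0. \<forall>L.
     (\<forall>\<gamma>>0. \<exists>r>0. \<forall>z\<in>V 0. \<forall>t. norm (z - x) < r \<and> 0 < t \<and> t < r \<longrightarrow> (f (z + t *\<^sub>R u) - f z) / t \<le> L + \<gamma>)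
     \<longrightarrow> inner v u \<le> L)"

text \<open>
For the estimates below the quotients are bounded by a continuous function of the base point, up to a
term that vanishes with t.
\<close>
lemma clarke_atD:
  assumes "clarke_at f x v" "u \<in> V 0" "isCont g x" "0 < r0" "0 \<le> C"
    and "\<And>z t. z \<in> V 0 \<Longrightarrow> norm (z - x) < r0 \<Longrightarrow> 0 < t \<Longrightarrow> t < r0 \<Longrightarrow>
      f (z + t *\<^sub>R u) - f z \<le> t * (g z + C * t)"
  shows "inner v u \<le> g x"
proof -
  have "\<exists>r>0. \<forall>z\<in>V 0. \<forall>t. norm (z - x) < r \<and> 0 < t \<and> t < r \<longrightarrow> (f (z + t *\<^sub>R u) - f z) / t \<le> g x + \<gamma>"
    if \<gamma>: "\<gamma> > 0" for \<gamma>
  proof -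
    obtain r1 where r1: "r1 > 0" "\<And>z. dist z x < r1 \<Longrightarrow> dist (g z) (g x) < \<gamma> / 2"
      using assms(3) \<gamma> unfolding isCont_def LIM_def
      by (metis dist_self half_gt_zero)
    show ?thesis
    proof (intro exI[of _ "min r0 (min r1 (\<gamma> / (2 * (C + 1))))"] conjI ballI allI impI)
      show "0 < min r0 (min r1 (\<gamma> / (2 * (C + 1))))" using assms(4,5) r1 \<gamma> by simp
      fix z t assume z: "z \<in> V 0" and zt: "norm (z - x) < min r0 (min r1 (\<gamma> / (2 * (C + 1)))) \<and> 0 < t \<and> t < min r0 (min r1 (\<gamma> / (2 * (C + 1))))"
      have "\<bar>g z - g x\<bar> < \<gamma>/2" using r1(2)[of z] zt by (simp add: dist_norm)
      then have "g z < g x + \<gamma>/2" by linarith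
      moreover have "(C + 1) * t < \<gamma> / 2" using zt assms(5) by (simp add: less_divide_eq field_simps)
      moreover have "C * t \<le> (C + 1) * t" using zt by (intro mult_right_mono) auto
      moreover have "(f (z + t *\<^sub>R u) - f z) / t \<le> g z + C * t"
        using assms(6)[of z t] z zt by (simp add: divide_le_eq mult.commute)
      ultimately show "(f (z + t *\<^sub>R u) - f z) / t \<le> g x + \<gamma>" by linarith
    qed
  qed
  then show ?thesis using assms(1,2) unfolding clarke_at_def by blast
qed

end

lemma tendsto_iter:
  fixes h :: "'b \<Rightarrow> real"
  assumes "(h \<longlongrightarrow> l) F" "\<And>z. \<bar>h z\<bar> \<le> 1" "\<bar>l\<bar> \<le> 1"
  shows "((\<lambda>z. iter_cos j (h z)) \<longlongrightarrow> iter_cos j l) F \<and> ((\<lambda>z. iter_slope j (h z)) \<longlongrightarrow> iter_slope j l) F"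
proof (induction j)
  case (Suc j)
  have ar: "((\<lambda>z. arccos (iter_cos j (h z))) \<longlongrightarrow> arccos (iter_cos j l)) F"
  proof (rule continuous_on_tendsto_compose[OF continuous_on_arccos'])
    show "((\<lambda>z. iter_cos j (h z)) \<longlongrightarrow> iter_cos j l) F" using Suc by simp
    show "iter_cos j l \<in> {-1..1}" using iter_cos_abs[OF assms(3), of j] by auto
    show "\<forall>\<^sub>F z in F. iter_cos j (h z) \<in> {-1..1}"
      using iter_cos_abs[OF assms(2), of j] by (intro always_eventually allI) (auto simp: abs_le_iff minus_le_iff)
  qed
  show ?case using Suc unfolding iter_cos.simps iter_slope.simps Phi_def slope_def
    by (intro conjI tendsto_intros ar isCont_tendsto_compose[OF isCont_sin ar]) auto
qed (use assms in auto)

lemma isCont_inner_kern_grad: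
  assumes "x \<noteq> 0" "y \<noteq> 0"
  shows "isCont (\<lambda>z. inner (kern_grad j y z) u) x"
proof -
  have c: "((\<lambda>z. cosine z y) \<longlongrightarrow> cosine x y) (at x)"
    unfolding cosine_def using assms by (auto intro!: tendsto_intros)
  have i: "((\<lambda>z. iter_cos j (cosine z y)) \<longlongrightarrow> iter_cos j (cosine x y)) (at x)"
    "((\<lambda>z. iter_slope j (cosine z y)) \<longlongrightarrow> iter_slope j (cosine x y)) (at x)"
    using tendsto_iter[OF c cosine_abs cosine_abs, of j] by auto
  show ?thesis unfolding isCont_def inner_kern_grad using assms
    by (intro tendsto_intros c i) auto
qed

text \<open>
R is the measured output of the normalized network and e the normalized noise. The number delta collects the
error of the layers and the noise relative to y; it is a free parameter because the bound on the number of
steps is better for a larger delta.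
\<close>
locale sensing = network V D d \<eta> for V :: "nat \<Rightarrow> 'a::real_inner set" and D d \<eta> +
  fixes R :: "'a \<Rightarrow> 'b::real_inner" and y :: 'a and e :: 'b and \<delta> :: real
  assumes rric: "x1 \<in> V 0 \<Longrightarrow> x2 \<in> V 0 \<Longrightarrow> x3 \<in> V 0 \<Longrightarrow> x4 \<in> V 0 \<Longrightarrow>
      \<bar>inner (R x1 - R x2) (R x3 - R x4) - inner (net d x1 - net d x2) (net d x3 - net d x4)\<bar>
        \<le> \<eta> * norm (net d x1 - net d x2) * norm (net d x3 - net d x4)"
    and R_zero: "R 0 = 0"
    and y_in: "y \<in> V 0" and y_nz: "y \<noteq> 0" and d_pos: "0 < d"
    and delta_pos: "0 < \<delta>"
    and delta_ge: "24 * real d * tau * norm y + 3 * norm e \<le> \<delta> * norm y"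
    and delta_small: "\<delta> * real d ^ 4 \<le> 1 / 10 ^ 6"
begin

definition objective :: "'a \<Rightarrow> real" where
  "objective x = (norm (R x - R y - e))\<^sup>2 / 2"

text \<open>
The objective with ideal layers, without noise, and up to a constant.
\<close>
definition model :: "'a \<Rightarrow> real" where
  "model x = (norm x)\<^sup>2 / 2 - kern d y x"

lemma eta_le: "\<eta> \<le> 1 / 100" "\<eta> \<le> tau"
proof -
  show "\<eta> \<le> 1 / 100" by (rule d_pos_eta[OF d_pos])
  have "1 * \<eta> \<le> real d * \<eta>" using d_pos eta_nonneg by (intro mult_right_mono) auto
  then show "\<eta> \<le> tau" using tau by simp
qed

lemma R_lipschitz:
  assumes "a \<in> V 0" "b \<in> V 0"
  shows "norm (R b - R a) \<le> 3 * norm (b - a)"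
proof (rule power2_le_imp_le)
  have "(norm (R b - R a))\<^sup>2 \<le> (norm (net d b - net d a))\<^sup>2 + \<eta> * (norm (net d b - net d a))\<^sup>2"
    using rric[OF assms(2,1,2,1)] by (simp add: power2_norm_eq_inner[symmetric] power2_eq_square abs_le_iff)
  also have "\<dots> = (1 + \<eta>) * (norm (net d b - net d a))\<^sup>2" by (simp add: algebra_simps)
  also have "\<dots> \<le> 2 * (2 * norm (b - a))\<^sup>2"
    using eta_le eta_nonneg net_lipschitz[OF assms] by (intro mult_mono power_mono) auto
  also have "\<dots> \<le> (3 * norm (b - a))\<^sup>2" by (simp add: power_mult_distrib)
  finally show "(norm (R b - R a))\<^sup>2 \<le> (3 * norm (b - a))\<^sup>2" .
qed simp

text \<open>
The RRIC with suitable arguments replaces the measured outputs by the outputs themselves; then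
energy_lipschitz and kernel_lipschitz apply. The RRIC contributes 4 + 4, the energy 3 and
the kernel 13 to the factor 24 of d * tau in delta_ge.
\<close>
lemma objective_model:
  assumes "a \<in> V 0" "b \<in> V 0" "norm a \<le> M" "norm b \<le> M" "norm y \<le> M"
  shows "\<bar>objective b - objective a - (model b - model a)\<bar> \<le> \<delta> * M * norm (b - a)"
proof -
  define n where "n = norm (b - a)"
  define Y where "Y = norm y"
  have n0: "0 \<le> n" by (simp add: n_def)
  have Y: "0 < Y" using y_nz by (simp add: Y_def)
  have M: "0 < M" "Y \<le> M" using assms(5) Y unfolding Y_def by linarith+
  have Gn: "norm (net d b - net d a) \<le> 2 * n" using net_lipschitz[OF assms(1,2)] by (simp add: n_def)
  have tau0: "0 \<le> tau" by (rule tau)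
  have dt: "tau \<le> real d * tau" using d_pos tau0 by (simp add: mult_le_cancel_right1)
  have err: "\<bar>inner (R b - R a) (R x - R 0) - inner (net d b - net d a) (net d x - net d 0)\<bar>
      \<le> real d * tau * 4 * n * norm x" if "x \<in> V 0" for x
  proof -
    have "\<bar>inner (R b - R a) (R x - R 0) - inner (net d b - net d a) (net d x - net d 0)\<bar>
      \<le> \<eta> * norm (net d b - net d a) * norm (net d x - net d 0)"
      by (intro rric assms that V_zero)
    also have "\<dots> \<le> (real d * tau) * (2 * n) * (2 * norm x)"
      using eta_le dt Gn norm_net_le[OF that] eta_nonneg n0 tau0
      by (intro mult_mono) (auto simp: net_zero)
    finally show ?thesis by simp
  qed
  have e1: "\<bar>inner (R b - R a) (R x) - inner (net d b - net d a) (net d x)\<bar> \<le> real d * tau * 4 * n * M"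
    if "x \<in> V 0" "norm x \<le> M" for x
  proof -
    have "real d * tau * 4 * n * norm x \<le> real d * tau * 4 * n * M"
      using that n0 tau0 by (intro mult_left_mono) auto
    moreover have "\<bar>inner (R b - R a) (R x) - inner (net d b - net d a) (net d x)\<bar> \<le> real d * tau * 4 * n * norm x"
      using err[OF that(1)] by (simp add: R_zero net_zero)
    ultimately show ?thesis by linarith
  qed
  have en: "\<bar>((norm (net d b))\<^sup>2 - (norm b)\<^sup>2) - ((norm (net d a))\<^sup>2 - (norm a)\<^sup>2)\<bar> \<le> 6 * (real d * tau * n * M)"
  proof -
    have "real d * \<eta> \<le> real d * tau" using eta_le by (intro mult_left_mono) auto
    then have "6 * (real d * \<eta>) * M * n \<le> 6 * (real d * tau) * M * n"
      using M n0 eta_le by (intro mult_right_mono mult_left_mono) auto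
    then show ?thesis using energy_lipschitz[OF assms(1-4) M(1)] by (simp add: n_def mult_ac)
  qed
  have ke: "\<bar>(inner (net d y) (net d b) - kern d y b) - (inner (net d y) (net d a) - kern d y a)\<bar> \<le> 13 * (real d * tau * n * Y)"
    using kernel_lipschitz[OF assms(1,2) y_in y_nz] by (simp add: n_def Y_def mult_ac)
  have ke2: "real d * tau * n * Y \<le> real d * tau * n * M" using M n0 tau0 by (intro mult_left_mono) auto
  have ee: "\<bar>inner (R b - R a) e\<bar> \<le> 3 * (norm e * n)"
    using order_trans[OF Cauchy_Schwarz_ineq2[of "R b - R a" e] mult_right_mono[OF R_lipschitz[OF assms(1,2)] norm_ge_zero[of e]]]
    by (simp add: n_def mult_ac)
  have id: "objective b - objective a = (inner (R b - R a) (R b) + inner (R b - R a) (R a)) / 2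
      - inner (R b - R a) (R y) - inner (R b - R a) e"
    unfolding objective_def power2_norm_eq_inner
    by (simp add: inner_diff inner_commute algebra_simps add_divide_distrib diff_divide_distrib)
  have id2: "(norm (net d b))\<^sup>2 - (norm (net d a))\<^sup>2 = inner (net d b - net d a) (net d b) + inner (net d b - net d a) (net d a)"
    by (simp add: power2_norm_eq_inner inner_diff inner_commute algebra_simps)
  have id3: "inner (net d b - net d a) (net d y) = inner (net d y) (net d b) - inner (net d y) (net d a)"
    by (simp add: inner_diff inner_commute)
  define Q where "Q = real d * tau * n * M"
  have "\<bar>objective b - objective a - (model b - model a)\<bar> \<le> 24 * Q + 3 * (norm e * n)"
  proof -
    have arith: "\<bar>l - (nb / 2 - kb - (na / 2 - ka))\<bar> \<le> 24 * q + 3 * s"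
      if "\<bar>rb - gb\<bar> \<le> 4 * q" "\<bar>ra - ga\<bar> \<le> 4 * q" "\<bar>ry - gy\<bar> \<le> 4 * q"
        "\<bar>(Gb - nb) - (Ga - na)\<bar> \<le> 6 * q" "Gb - Ga = gb + ga" "gy = ib - ia"
        "\<bar>(ib - kb) - (ia - ka)\<bar> \<le> 13 * q" "\<bar>re\<bar> \<le> 3 * s" "l = (rb + ra) / 2 - ry - re"
      for l nb na kb ka q s rb gb ra ga ry gy Gb Ga ib ia re :: real
    proof -
      have sum: "\<bar>x1 / 2 + x2 / 2 + x3 / 2 - x4 - x5 - x6\<bar> \<le> 24 * q + 3 * s"
        if "\<bar>x1\<bar> \<le> 4 * q" "\<bar>x2\<bar> \<le> 4 * q" "\<bar>x4\<bar> \<le> 4 * q" "\<bar>x3\<bar> \<le> 6 * q" "\<bar>x5\<bar> \<le> 13 * q" "\<bar>x6\<bar> \<le> 3 * s"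
        for x1 x2 x3 x4 x5 x6 :: real
        using that by linarith
      have "l - (nb / 2 - kb - (na / 2 - ka)) = (rb - gb) / 2 + (ra - ga) / 2 + ((Gb - nb) - (Ga - na)) / 2
          - (ry - gy) - ((ib - kb) - (ia - ka)) - re"
        using that(5,6,9) by (simp add: field_simps)
      then show ?thesis using sum[OF that(1,2,3,4,7,8)] by (simp only:)
    qed
    have "13 * (real d * tau * n * Y) \<le> 13 * Q" using ke2 unfolding Q_def by (rule mult_left_mono) simp
    then have ke': "\<bar>(inner (net d y) (net d b) - kern d y b) - (inner (net d y) (net d a) - kern d y a)\<bar> \<le> 13 * Q"
      using ke by linarith
    have Q4: "real d * tau * 4 * n * M = 4 * Q" by (simp add: Q_def)
    note e1' = e1[unfolded Q4]
    show ?thesis unfolding model_def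
      by (rule arith[OF e1'[OF assms(2,4)] e1'[OF assms(1,3)] e1'[OF y_in assms(5)] en[folded Q_def] id2 id3 ke' ee id])
  qed
  also have "\<dots> \<le> \<delta> * M * n"
  proof -
    have "(24 * real d * tau * Y + 3 * norm e) * M \<le> \<delta> * Y * M"
      using delta_ge M by (intro mult_right_mono) (auto simp: Y_def)
    moreover have "norm e * Y \<le> norm e * M" using M by (intro mult_left_mono) auto
    ultimately have "Y * (24 * real d * tau * M + 3 * norm e) \<le> Y * (\<delta> * M)"
      by (simp add: algebra_simps)
    then have "24 * real d * tau * M + 3 * norm e \<le> \<delta> * M" using Y by simp
    then have "(24 * real d * tau * M + 3 * norm e) * n \<le> \<delta> * M * n" using n0 by (intro mult_right_mono) auto
    then show ?thesis by (simp add: Q_def algebra_simps)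
  qed
  finally show ?thesis by (simp add: n_def)
qed

text \<open>
The kernel enters with a minus sign, so its convexity bounds the model from above.
\<close>
lemma model_convex_upper:
  assumes "z \<noteq> 0"
  shows "model w - model z \<le> inner (z - kern_grad d y z) (w - z) + (norm (w - z))\<^sup>2 / 2"
proof -
  have "inner (kern_grad d y z) (w - z) \<le> kern d y w - kern d y z"
    using kern_grad_euler[OF assms, of d y] kern_grad_le[OF assms, of d y w] by (simp add: inner_diff_right)
  moreover have "(norm w)\<^sup>2 = (norm z)\<^sup>2 + 2 * inner z (w - z) + (norm (w - z))\<^sup>2"
    by (simp add: power2_norm_eq_inner inner_diff inner_commute algebra_simps)
  ultimately show ?thesis by (simp add: model_def inner_diff_left field_simps)
qed

lemma kern_grad_in: "x \<in> V 0 \<Longrightarrow> kern_grad d y x \<in> V 0"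
  unfolding kern_grad_def by (intro V_add V_scale y_in)

text \<open>
Difference quotients of the objective are those of the model up to delta * M, and the latter are bounded by the model gradient,
which is continuous away from 0. Testing with the difference itself as direction
gives the norm bound.
\<close>
lemma clarke_near_model_grad:
  assumes "clarke_at objective x v" "x \<in> V 0" "v \<in> V 0" "x \<noteq> 0"
  shows "norm (v - (x - kern_grad d y x)) \<le> \<delta> * max (norm x) (norm y)"
proof -
  define M where "M = max (norm x) (norm y)"
  define u where "u = v - (x - kern_grad d y x)"
  have u: "u \<in> V 0" using assms by (auto simp: u_def intro: V_diff kern_grad_in)
  define g where "g = (\<lambda>z. inner z u - inner (kern_grad d y z) u + \<delta> * (M + norm (z - x)) * norm u)"
  have "inner v u \<le> g x"
  proof (rule clarke_atD[OF assms(1) u])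
    have "isCont (\<lambda>z. inner z u) x" "isCont (\<lambda>z. norm (z - x)) x"
      unfolding isCont_def by (auto intro!: tendsto_eq_intros)
    then show "isCont g x" unfolding g_def
      by (intro continuous_intros isCont_inner_kern_grad assms y_nz)
    show "0 < norm x" using assms by simp
    show "0 \<le> (norm u)\<^sup>2 / 2 + \<delta> * (norm u)\<^sup>2" using delta_pos by simp
    fix z t assume z: "z \<in> V 0" "norm (z - x) < norm x" "0 < t" "t < norm x"
    have z0: "z \<noteq> 0" using z by auto
    define M' where "M' = M + norm (z - x) + t * norm u"
    have nz: "norm z \<le> norm x + norm (z - x)" using norm_triangle_sub[of z x] by simp
    have "\<bar>objective (z + t *\<^sub>R u) - objective z - (model (z + t *\<^sub>R u) - model z)\<bar> \<le> \<delta> * M' * norm (z + t *\<^sub>R u - z)"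
    proof (rule objective_model)
      show "z \<in> V 0" "z + t *\<^sub>R u \<in> V 0" using z u by (auto intro: V_add V_scale)
      show "norm z \<le> M'" using nz z by (auto simp: M'_def M_def intro: add_increasing2)
      show "norm y \<le> M'" using z by (simp add: M'_def M_def add_increasing2)
      have "norm (z + t *\<^sub>R u) \<le> norm z + t * norm u" using norm_triangle_ineq[of z "t *\<^sub>R u"] z by simp
      then show "norm (z + t *\<^sub>R u) \<le> M'" using nz by (simp add: M'_def M_def)
    qed
    moreover have "model (z + t *\<^sub>R u) - model z \<le> t * inner (z - kern_grad d y z) u + t\<^sup>2 * (norm u)\<^sup>2 / 2"
      using model_convex_upper[OF z0, of "z + t *\<^sub>R u"] z by (simp add: power_mult_distrib)
    ultimately have "objective (z + t *\<^sub>R u) - objective z \<le> t * inner (z - kern_grad d y z) u + t\<^sup>2 * (norm u)\<^sup>2 / 2 + \<delta> * M' * (t * norm u)"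
      using z by simp
    also have "\<dots> = t * (g z + ((norm u)\<^sup>2 / 2 + \<delta> * (norm u)\<^sup>2) * t)"
      by (simp add: g_def M'_def inner_diff_left algebra_simps power2_eq_square)
    finally show "objective (z + t *\<^sub>R u) - objective z \<le> t * (g z + ((norm u)\<^sup>2 / 2 + \<delta> * (norm u)\<^sup>2) * t)" .
  qed
  then have "inner u u \<le> (\<delta> * M) * norm u"
    unfolding g_def by (subst (1) u_def) (simp add: inner_diff_left)
  then have "norm u \<le> \<delta> * M"
    by (rule norm_le_if_inner_le) (use delta_pos in \<open>simp add: M_def le_max_iff_disj\<close>)
  then show ?thesis by (simp add: u_def M_def)
qed

end


section \<open>Near isometry around a nonzero point\<close>

lemma angle_close:
  fixes u w c :: "'a::real_inner"
  assumes "norm (u - c) \<le> r * norm c" "norm (w - c) \<le> r * norm c" "c \<noteq> 0" "0 \<le> r" "r \<le> 1/2"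
  shows "arccos (cosine u w) \<le> 8 * r"
proof -
  let ?N = "norm c" and ?c = "cosine u w"
  have N: "?N > 0" using assms by simp
  have half: "r * ?N \<le> 1/2 * ?N" using assms by (intro mult_right_mono) auto
  have u2: "?N / 2 \<le> norm u" using norm_triangle_sub[of c u] assms(1) half by (simp add: norm_minus_commute)
  have w2: "?N / 2 \<le> norm w" using norm_triangle_sub[of c w] assms(2) half by (simp add: norm_minus_commute)
  have uw: "norm (u - w) \<le> 2 * r * ?N"
    using norm_triangle_ineq4[of "u - c" "w - c"] assms by simp
  have "(norm (u - w))\<^sup>2 = (norm u - norm w)\<^sup>2 + 2 * (norm u * norm w * (1 - ?c))"
  proof -
    have "(norm (u - w))\<^sup>2 = (norm u)\<^sup>2 + (norm w)\<^sup>2 - 2 * inner u w"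
      by (simp add: power2_norm_eq_inner inner_diff inner_commute)
    then show ?thesis unfolding inner_eq_cosine[of u w] by (simp add: power2_diff algebra_simps)
  qed
  then have a: "2 * (norm u * norm w * (1 - ?c)) \<le> (2 * r * ?N)\<^sup>2"
    using power_mono[OF uw norm_ge_zero, of 2] zero_le_power2[of "norm u - norm w"] by linarith
  have "?N / 2 * (?N / 2) * (1 - ?c) \<le> norm u * norm w * (1 - ?c)"
    using u2 w2 N cosine_abs[of u w] by (intro mult_right_mono mult_mono) auto
  moreover have "?N / 2 * (?N / 2) * (1 - ?c) = ?N * ?N * (1 - ?c) / 4" by simp
  moreover have "(2 * r * ?N)\<^sup>2 = 4 * (?N * ?N * r\<^sup>2)" by (simp add: power2_eq_square)
  ultimately have "?N * ?N * (1 - ?c) \<le> 8 * (?N * ?N * r\<^sup>2)" using a by linarith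
  then have "?N * ?N * (1 - ?c) \<le> ?N * ?N * (8 * r\<^sup>2)" by (simp only: mult_ac)
  then have c: "1 - ?c \<le> 8 * r\<^sup>2" using N by simp
  have "2 * (arccos ?c - arccos 1)\<^sup>2 / pi\<^sup>2 \<le> \<bar>?c - 1\<bar>" by (intro arccos_holder cosine_abs) simp
  also have "\<dots> \<le> 8 * r\<^sup>2" using c cosine_abs[of u w] by simp
  finally have "2 * (arccos ?c)\<^sup>2 / pi\<^sup>2 \<le> 8 * r\<^sup>2" by simp
  then have "2 * (arccos ?c)\<^sup>2 / pi\<^sup>2 * (pi\<^sup>2 / 2) \<le> 8 * r\<^sup>2 * (pi\<^sup>2 / 2)"
    by (rule mult_right_mono) simp
  then have "(arccos ?c)\<^sup>2 \<le> (2 * pi * r)\<^sup>2" by (simp add: power_mult_distrib)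
  then have a1: "arccos ?c \<le> 2 * pi * r" by (rule power2_le_imp_le) (use assms in simp)
  have "pi * r \<le> 4 * r" using pi_less_4 assms by (intro mult_right_mono) simp_all
  with a1 have "arccos ?c \<le> 8 * r" by linarith
  then show ?thesis .
qed

context network
begin

text \<open>
If all linear pieces D i w that are active on S are close to a fixed map when tested against g, then so
is the layer itself, for differences of points of S.
\<close>
lemma layer_segment:
  assumes i: "i < d" and sub: "S \<subseteq> V i" and nz: "0 \<notin> S"
    and conv: "\<And>z w s. z \<in> S \<Longrightarrow> w \<in> S \<Longrightarrow> 0 \<le> s \<Longrightarrow> s \<le> 1 \<Longrightarrow> z + s *\<^sub>R (w - z) \<in> S"
    and B: "\<And>w u. w \<in> S \<Longrightarrow> u \<in> V i \<Longrightarrow> \<bar>inner (D i w u) g - inner u h\<bar> \<le> B * norm u"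
    and ab: "a \<in> S" "b \<in> S"
  shows "\<bar>inner (D i a a - D i b b) g - inner (a - b) h\<bar> \<le> B * norm (a - b)"
proof -
  have "\<bar>inner (D i a a) g - inner a h - (inner (D i b b) g - inner b h)\<bar> \<le> B * norm (a - b)"
  proof (rule segment_lipschitz[where S = S])
    show "b + s *\<^sub>R (a - b) \<in> S" if "0 \<le> s" "s \<le> 1" for s using conv ab that by blast
    fix z x assume zx: "z \<in> S" "x \<in> S" "z \<noteq> x"
    define u where "u = x - z"
    have u: "u \<in> V i" using zx sub by (auto simp: u_def intro: V_diff)
    obtain \<delta> L where \<delta>: "\<delta> > 0" and L: "\<And>p. 0 < p \<Longrightarrow> p < \<delta> \<Longrightarrow> D i (z + p *\<^sub>R u) = L" "D i z z = L z"
      using D_germ[OF i subsetD[OF sub zx(1)] u] by blast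
    show "\<exists>\<delta>>0. \<forall>p. 0 < p \<and> p < \<delta> \<longrightarrow>
      \<bar>inner (D i (z + p *\<^sub>R (x - z)) (z + p *\<^sub>R (x - z))) g - inner (z + p *\<^sub>R (x - z)) h - (inner (D i z z) g - inner z h)\<bar>
        \<le> B * p * norm (x - z)"
    proof (intro exI[of _ "min \<delta> 1"] conjI allI impI)
      show "0 < min \<delta> 1" using \<delta> by simp
      fix p assume p: "0 < p \<and> p < min \<delta> 1"
      have xS: "z + p *\<^sub>R u \<in> S" unfolding u_def using p zx by (intro conv) auto
      have lin: "linear L" using L(1)[of p] p D_linear[of i "z + p *\<^sub>R u"] by simp
      have "\<bar>inner (L u) g - inner u h\<bar> \<le> B * norm u" using B[OF xS u] L(1)[of p] p by simp
      then have "p * \<bar>inner (L u) g - inner u h\<bar> \<le> p * (B * norm u)" using p by (intro mult_left_mono) auto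
      moreover have "inner (D i (z + p *\<^sub>R u) (z + p *\<^sub>R u)) g - inner (z + p *\<^sub>R u) h - (inner (D i z z) g - inner z h)
        = p * (inner (L u) g - inner u h)"
        using L(1)[of p] p by (simp add: L(2) linear_add[OF lin] linear_cmul[OF lin] inner_add_left algebra_simps)
      ultimately show "\<bar>inner (D i (z + p *\<^sub>R (x - z)) (z + p *\<^sub>R (x - z))) g - inner (z + p *\<^sub>R (x - z)) h - (inner (D i z z) g - inner z h)\<bar>
        \<le> B * p * norm (x - z)"
        using p unfolding u_def[symmetric] by (simp add: abs_mult mult_ac)
    qed
  qed
  then show ?thesis by (simp add: inner_diff_left)
qed

text \<open>
In a ball around c of relative radius r all angles are at most 8 r, so any two active pieces are
jointly an isometry up to eta + 16 r. The passage to the layer is made in one argument after the other.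
\<close>
lemma layer_near_isometry:
  assumes i: "i < d" and c: "c \<in> V i" "c \<noteq> 0" and r: "0 \<le> r" "r \<le> 1/2"
    and mem: "a \<in> V i" "b \<in> V i" "a' \<in> V i" "b' \<in> V i"
    and near: "norm (a - c) \<le> r * norm c" "norm (b - c) \<le> r * norm c"
      "norm (a' - c) \<le> r * norm c" "norm (b' - c) \<le> r * norm c"
  shows "\<bar>inner (D i a a - D i b b) (D i a' a' - D i b' b') - inner (a - b) (a' - b')\<bar>
    \<le> (\<eta> + 16 * r) * norm (a - b) * norm (a' - b')"
proof -
  define S where "S = {x \<in> V i. norm (x - c) \<le> r * norm c}"
  define K where "K = \<eta> + 16 * r"
  have Snz: "0 \<notin> S"
  proof
    assume "0 \<in> S"
    then have "1 * norm c \<le> r * norm c" by (simp add: S_def)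
    then show False using c r by (simp add: mult_le_cancel_right)
  qed
  have Ssub: "S \<subseteq> V i" by (auto simp: S_def)
  have Sseg: "z + s *\<^sub>R (w - z) \<in> S" if "z \<in> S" "w \<in> S" "0 \<le> s" "s \<le> 1" for z w s
    using that norm_segment_le[of z c "r * norm c" w s] by (auto simp: S_def intro: V_segment)
  have wdc: "\<bar>inner (D i x v) (D i w u) - inner v u\<bar> \<le> K * norm v * norm u"
    if "x \<in> S" "w \<in> S" "v \<in> V i" "u \<in> V i" for x w v u
  proof -
    have "arccos (cosine x w) \<le> 8 * r"
      using that c r by (intro angle_close[of x c r w]) (auto simp: S_def)
    then have "(\<eta> + 2 * arccos (cosine x w)) * norm v * norm u \<le> K * norm v * norm u"
      by (intro mult_right_mono) (auto simp: K_def)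
    moreover have "x \<in> V i" "w \<in> V i" "x \<noteq> 0" "w \<noteq> 0" using that Snz Ssub by auto
    note wdc_isometry[OF i this(1,2) that(3,4) this(3,4)]
    ultimately show ?thesis by linarith
  qed
  have S4: "a \<in> S" "b \<in> S" "a' \<in> S" "b' \<in> S" using mem near by (auto simp: S_def)
  have one: "\<bar>inner (D i a a - D i b b) (D i w u) - inner (a - b) u\<bar> \<le> (K * norm u) * norm (a - b)"
    if "w \<in> S" "u \<in> V i" for w u
    using wdc that S4 by (intro layer_segment[OF i Ssub Snz Sseg]) (auto simp: mult_ac)
  have "\<bar>inner (D i a' a' - D i b' b') (D i a a - D i b b) - inner (a' - b') (a - b)\<bar> \<le> (K * norm (a - b)) * norm (a' - b')"
  proof (rule layer_segment[OF i Ssub Snz Sseg])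
    fix w u assume "w \<in> S" "u \<in> V i"
    then show "\<bar>inner (D i w u) (D i a a - D i b b) - inner u (a - b)\<bar> \<le> K * norm (a - b) * norm u"
      using one[of w u] by (simp add: inner_commute[of "D i w u"] inner_commute[of u] mult_ac)
  qed (use S4 in auto)
  then show ?thesis
    unfolding K_def by (subst (1) inner_commute, subst (2) inner_commute)
qed

text \<open>
By induction the image of the ball stays in a ball of twice the relative radius around net i y, so that
layer_near_isometry applies to the next layer.
\<close>
lemma net_near_isometry:
  assumes y: "y \<in> V 0" "y \<noteq> 0" and \<rho>: "0 \<le> \<rho>" "real d * (\<eta> + 32 * \<rho>) \<le> 1 / 64"
    and "i \<le> d"
    and "a \<in> V 0" "b \<in> V 0" "a' \<in> V 0" "b' \<in> V 0"
    and "norm (a - y) \<le> \<rho> * norm y" "norm (b - y) \<le> \<rho> * norm y"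
      "norm (a' - y) \<le> \<rho> * norm y" "norm (b' - y) \<le> \<rho> * norm y"
  shows "\<bar>inner (net i a - net i b) (net i a' - net i b') - inner (a - b) (a' - b')\<bar>
    \<le> 1 / 32 * norm (a - b) * norm (a' - b')"
proof -
  define K where "K = \<eta> + 32 * \<rho>"
  have K0: "0 \<le> K" using \<rho> eta_nonneg by (simp add: K_def)
  define B where "B = {x \<in> V 0. norm (x - y) \<le> \<rho> * norm y}"
  have yB: "y \<in> B" using y \<rho> by (simp add: B_def)
  have bnd: "2 * real i * K \<le> 1 / 32" if "i \<le> d" for i
  proof -
    have "real i * K \<le> real d * K" using that K0 by (intro mult_right_mono) auto
    then show ?thesis using \<rho> by (simp add: K_def)
  qed
  have "\<bar>inner (net i a - net i b) (net i a' - net i b') - inner (a - b) (a' - b')\<bar>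
    \<le> (2 * real i * K) * (norm (a - b) * norm (a' - b'))"
    if "i \<le> d" "a \<in> B" "b \<in> B" "a' \<in> B" "b' \<in> B" for i a b a' b'
    using that
  proof (induction i arbitrary: a b a' b')
    case (Suc i)
    have i: "i < d" "i \<le> d" using Suc.prems by auto
    have "real 1 * K \<le> real d * K" using i K0 by (intro mult_right_mono) auto
    then have \<rho>s: "\<rho> \<le> 1/4" using \<rho> eta_nonneg by (simp add: K_def)
    have lip: "(norm (net i u - net i w))\<^sup>2 \<le> 33 / 32 * (norm (u - w))\<^sup>2" if "u \<in> B" "w \<in> B" for u w
    proof -
      have "2 * real i * K * (norm (u - w) * norm (u - w)) \<le> 1 / 32 * (norm (u - w) * norm (u - w))"
        using bnd[OF i(2)] by (intro mult_right_mono) auto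
      then show ?thesis using Suc.IH[OF i(2) that that]
        by (simp add: power2_norm_eq_inner[symmetric] power2_eq_square abs_le_iff)
    qed
    have lip': "norm (net i u - net i w) \<le> 5 / 4 * norm (u - w)" if "u \<in> B" "w \<in> B" for u w
    proof (rule power2_le_imp_le)
      have "(norm (net i u - net i w))\<^sup>2 \<le> 33 / 32 * (norm (u - w))\<^sup>2" by (rule lip[OF that])
      also have "\<dots> \<le> (5 / 4 * norm (u - w))\<^sup>2" by (simp add: power_mult_distrib power_divide)
      finally show "(norm (net i u - net i w))\<^sup>2 \<le> (5 / 4 * norm (u - w))\<^sup>2" .
    qed simp
    have ylow: "norm y \<le> 5 / 4 * norm (net i y)"
    proof (rule power2_le_imp_le)
      have "(99 / 100) * (norm y)\<^sup>2 \<le> (1 - \<eta>) ^ i * (norm y)\<^sup>2"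
        using pow_lower[OF i(2)] eta_small by (intro mult_right_mono) auto
      then have "(99 / 100) * (norm y)\<^sup>2 \<le> (norm (net i y))\<^sup>2" using norm_net_sq[OF i(2) y(1)] by linarith
      moreover have "(5 / 4 * norm (net i y))\<^sup>2 = 25 / 16 * (norm (net i y))\<^sup>2"
        by (simp add: power_mult_distrib power_divide)
      ultimately show "(norm y)\<^sup>2 \<le> (5 / 4 * norm (net i y))\<^sup>2"
        using zero_le_power2[of "norm (net i y)"] by linarith
    qed simp
    have near: "net i u \<in> V i \<and> norm (net i u - net i y) \<le> (2 * \<rho>) * norm (net i y)" if "u \<in> B" for u
    proof
      show "net i u \<in> V i" using that i by (auto simp: B_def intro: net_in)
      have "norm (net i u - net i y) \<le> 5 / 4 * norm (u - y)" using lip'[OF that yB] .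
      also have "\<dots> \<le> 5 / 4 * (\<rho> * norm y)" using that by (simp add: B_def)
      also have "\<dots> \<le> 5 / 4 * (\<rho> * (5 / 4 * norm (net i y)))" using ylow \<rho> by (intro mult_left_mono) auto
      also have "\<dots> \<le> (2 * \<rho>) * norm (net i y)" using \<rho> by (simp add: mult_right_mono)
      finally show "norm (net i u - net i y) \<le> (2 * \<rho>) * norm (net i y)" .
    qed
    have "\<bar>inner (net (Suc i) a - net (Suc i) b) (net (Suc i) a' - net (Suc i) b') - inner (net i a - net i b) (net i a' - net i b')\<bar>
       \<le> (\<eta> + 16 * (2 * \<rho>)) * norm (net i a - net i b) * norm (net i a' - net i b')"
      unfolding net.simps
      using near[OF yB] near[OF Suc.prems(2)] near[OF Suc.prems(3)] near[OF Suc.prems(4)] near[OF Suc.prems(5)] \<rho> \<rho>s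
      by (intro layer_near_isometry[where c = "net i y"] i net_nonzero y) auto
    also have "\<dots> = K * (norm (net i a - net i b) * norm (net i a' - net i b'))" by (simp add: K_def)
    also have "\<dots> \<le> K * ((5 / 4 * norm (a - b)) * (5 / 4 * norm (a' - b')))"
      using lip' Suc.prems K0 by (intro mult_left_mono mult_mono) auto
    also have "\<dots> \<le> 2 * K * (norm (a - b) * norm (a' - b'))" using K0 by (simp add: mult_right_mono)
    finally have "\<bar>inner (net (Suc i) a - net (Suc i) b) (net (Suc i) a' - net (Suc i) b') - inner (net i a - net i b) (net i a' - net i b')\<bar>
       \<le> 2 * K * (norm (a - b) * norm (a' - b'))" .
    moreover have "2 * real (Suc i) * K * (norm (a - b) * norm (a' - b'))
       = 2 * real i * K * (norm (a - b) * norm (a' - b')) + 2 * K * (norm (a - b) * norm (a' - b'))"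
      by (simp add: algebra_simps)
    ultimately show ?case using Suc.IH[OF i(2) Suc.prems(2-5)] by linarith
  qed simp
  moreover have "a \<in> B" "b \<in> B" "a' \<in> B" "b' \<in> B" using assms by (auto simp: B_def)
  ultimately have "\<bar>inner (net i a - net i b) (net i a' - net i b') - inner (a - b) (a' - b')\<bar>
    \<le> (2 * real i * K) * (norm (a - b) * norm (a' - b'))" using \<open>i \<le> d\<close> by blast
  also have "\<dots> \<le> 1 / 32 * (norm (a - b) * norm (a' - b'))"
    using bnd[OF \<open>i \<le> d\<close>] by (intro mult_right_mono) auto
  finally show ?thesis by simp
qed

end

section \<open>One step of the method\<close>

context sensing
begin

text \<open>
The relative radius of the ball in which the method contracts: small enough for net_near_isometry, and larger than
the radius that step_near provides.
\<close>
definition rho :: real where "rho = 1 / (2500 * real d)"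

lemma d_ge: "1 \<le> real d" using d_pos by simp

lemma delta_bounds: "\<delta> \<le> 1 / 10 ^ 6" "\<delta> * real d ^ 3 \<le> 1 / 10 ^ 6 / real d" "\<delta> \<le> \<delta> * real d ^ 3"
  "\<delta> * real d ^ 3 \<le> 1 / 10 ^ 6"
proof -
  have p: "1 \<le> real d ^ n" for n using d_ge by (rule one_le_power)
  have "\<delta> * 1 \<le> \<delta> * real d ^ 4" using p delta_pos by (intro mult_left_mono) auto
  then show "\<delta> \<le> 1 / 10 ^ 6" using delta_small by simp
  show d3: "\<delta> * real d ^ 3 \<le> 1 / 10 ^ 6 / real d"
    using delta_small d_ge by (simp add: field_simps power_Suc eval_nat_numeral)
  have "1 / 10 ^ 6 / real d \<le> 1 / 10 ^ 6 / 1" using d_ge by (intro divide_left_mono) auto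
  then show "\<delta> * real d ^ 3 \<le> 1 / 10 ^ 6" using d3 by simp
  show "\<delta> \<le> \<delta> * real d ^ 3" using p[of 3] delta_pos by (simp add: mult_le_cancel_left1)
qed

lemma rho: "0 \<le> rho" "rho \<le> 1 / 2500" "real d * (\<eta> + 32 * rho) \<le> 1 / 64" "0 < rho"
proof -
  show "0 \<le> rho" "0 < rho" using d_ge by (auto simp: rho_def)
  show "rho \<le> 1 / 2500" using d_ge by (simp add: rho_def field_simps)
  have "24 * real d * tau * norm y \<le> \<delta> * norm y" using delta_ge norm_ge_zero[of e] by linarith
  then have "24 * real d * tau \<le> \<delta>" using y_nz by simp
  moreover have "tau \<le> real d * tau" using d_ge tau by (simp add: mult_le_cancel_right1)
  ultimately have "tau \<le> 1 / 1000" using delta_bounds by simp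
  then have "real d * \<eta> \<le> 1 / 1000" using tau by linarith
  moreover have "real d * (32 * rho) = 32 / 2500" using d_ge by (simp add: rho_def)
  ultimately show "real d * (\<eta> + 32 * rho) \<le> 1 / 64" by (simp add: algebra_simps)
qed

text \<open>
Inside the ball the increments of the outputs have almost the inner products of the increments of the inputs.
\<close>
lemma clarke_near_target:
  assumes "clarke_at objective x v" "x \<in> V 0" "v \<in> V 0" "norm (x - y) < rho * norm y"
  shows "norm (v - (x - y)) \<le> norm (x - y) / 8 + 3 * norm e"
proof -
  define u where "u = v - (x - y)"
  have u: "u \<in> V 0" using assms y_in by (auto simp: u_def intro: V_diff)
  define gap where "gap = rho * norm y - norm (x - y)"
  have gap: "0 < gap" using assms by (simp add: gap_def)
  define g where "g = (\<lambda>z. inner u (z - y) + norm u * norm (z - y) / 8 + 3 * norm u * norm e)"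
  have un: "0 < 1 + norm u" using norm_ge_zero[of u] by linarith
  have "inner v u \<le> g x"
  proof (rule clarke_atD[OF assms(1) u])
    have "isCont (\<lambda>z. inner u (z - y)) x" "isCont (\<lambda>z. norm (z - y)) x"
      unfolding isCont_def by (auto intro!: tendsto_eq_intros)
    then show "isCont g x" unfolding g_def by (intro continuous_intros) auto
    show "0 < gap / (1 + norm u)" using gap un by simp
    show "0 \<le> 5 * (norm u)\<^sup>2" by simp
    fix z t assume z: "z \<in> V 0" "norm (z - x) < gap / (1 + norm u)" "0 < t" "t < gap / (1 + norm u)"
    define w where "w = z + t *\<^sub>R u"
    have w: "w \<in> V 0" using z u by (auto simp: w_def intro: V_add V_scale)
    have tu: "norm (z - x) + t * norm u \<le> gap"
    proof -
      have "t * norm u \<le> gap / (1 + norm u) * norm u" using z by (intro mult_right_mono) auto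
      then have "norm (z - x) + t * norm u \<le> gap / (1 + norm u) * 1 + gap / (1 + norm u) * norm u" using z by simp
      also have "\<dots> = gap / (1 + norm u) * (1 + norm u)" by (simp only: distrib_left)
      also have "\<dots> = gap" using un by simp
      finally show ?thesis .
    qed
    have zyx: "norm (z - y) \<le> norm (z - x) + norm (x - y)"
      using norm_triangle_ineq[of "z - x" "x - y"] by simp
    have zy: "norm (z - y) \<le> rho * norm y"
    proof -
      note zyx
      moreover have "0 \<le> t * norm u" using z by simp
      ultimately show ?thesis using tu by (simp add: gap_def)
    qed
    have wy: "norm (w - y) \<le> rho * norm y"
    proof -
      have wy: "w - y = (z - y) + t *\<^sub>R u" by (simp add: w_def)
      have "norm (w - y) \<le> norm (z - y) + t * norm u"
        unfolding wy using norm_triangle_ineq[of "z - y" "t *\<^sub>R u"] z by simp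
      then show ?thesis using tu zyx by (simp add: gap_def)
    qed
    have yy: "norm (y - y) \<le> rho * norm y" using rho by simp
    have wz: "w - z = t *\<^sub>R u" by (simp add: w_def)
    have nwz: "norm (w - z) = t * norm u" using z by (simp add: wz)
    define Nn where "Nn = t * norm u * norm (z - y)"
    have Nn0: "0 \<le> Nn" using z by (simp add: Nn_def)
    have A: "\<bar>inner (net d w - net d z) (net d z - net d y) - t * inner u (z - y)\<bar> \<le> 1 / 32 * Nn"
      using net_near_isometry[OF y_in y_nz rho(1,3) order_refl w z(1) z(1) y_in wy zy zy yy]
      unfolding nwz by (simp add: wz Nn_def mult.assoc)
    have 1: "inner (net d w - net d z) (net d z - net d y) \<le> t * inner u (z - y) + 1 / 32 * Nn"
      using abs_le_D1[OF A] by linarith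
    have 2: "inner (R w - R z) (R z - R y) \<le> inner (net d w - net d z) (net d z - net d y) + 1 / 100 * (4 * Nn)"
    proof -
      have "\<eta> * norm (net d w - net d z) * norm (net d z - net d y) \<le> (1 / 100) * (2 * norm (w - z)) * (2 * norm (z - y))"
        using eta_le eta_nonneg net_lipschitz[OF z(1) w] net_lipschitz[OF y_in z(1)] by (intro mult_mono) auto
      also have "\<dots> = 1 / 100 * (4 * Nn)" by (simp add: nwz Nn_def)
      finally show ?thesis using rric[OF w z(1) z(1) y_in] by (simp add: abs_le_iff)
    qed
    have 3: "\<bar>inner (R w - R z) e\<bar> \<le> 3 * (t * norm u) * norm e"
      using order_trans[OF Cauchy_Schwarz_ineq2[of "R w - R z" e] mult_right_mono[OF R_lipschitz[OF z(1) w] norm_ge_zero[of e]]]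
      by (simp add: nwz)
    have 4: "(norm (R w - R z))\<^sup>2 / 2 \<le> 5 * (t\<^sup>2 * (norm u)\<^sup>2)"
    proof -
      have "(norm (R w - R z))\<^sup>2 \<le> (3 * (t * norm u))\<^sup>2"
        using R_lipschitz[OF z(1) w] by (intro power_mono) (auto simp: nwz)
      moreover have "0 \<le> t\<^sup>2 * (norm u)\<^sup>2" by simp
      moreover have "(3 * (t * norm u))\<^sup>2 = 9 * (t\<^sup>2 * (norm u)\<^sup>2)" by (simp add: power_mult_distrib)
      ultimately show ?thesis by linarith
    qed
    have "objective w - objective z = (norm (R w - R z))\<^sup>2 / 2 + inner (R w - R z) (R z - R y) - inner (R w - R z) e"
      unfolding objective_def power2_norm_eq_inner
      by (simp add: inner_diff inner_commute algebra_simps add_divide_distrib diff_divide_distrib)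
    also have "\<dots> \<le> 5 * (t\<^sup>2 * (norm u)\<^sup>2) + (t * inner u (z - y) + 1 / 8 * Nn) + 3 * (t * norm u) * norm e"
      using 1 2 3 4 Nn0 by linarith
    also have "\<dots> = t * (g z + 5 * (norm u)\<^sup>2 * t)"
      by (simp add: g_def Nn_def algebra_simps power2_eq_square)
    finally show "objective (z + t *\<^sub>R u) - objective z \<le> t * (g z + 5 * (norm u)\<^sup>2 * t)" by (simp add: w_def)
  qed
  then have "inner (v - (x - y)) u \<le> norm u * norm (x - y) / 8 + 3 * norm u * norm e"
    by (simp add: g_def inner_diff_left inner_diff_right inner_commute)
  then have "inner u u \<le> (norm (x - y) / 8 + 3 * norm e) * norm u"
    unfolding u_def[symmetric] by (simp add: algebra_simps)
  then have "norm u \<le> norm (x - y) / 8 + 3 * norm e" by (rule norm_le_if_inner_le) simp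
  then show ?thesis by (simp add: u_def)
qed

text \<open>
The normalized step size.
\<close>
definition alpha :: real where "alpha = 1 / (4 * (real d)\<^sup>2)"

lemma alpha: "0 < alpha" "alpha \<le> 1 / 4"
proof -
  have "1 \<le> (real d)\<^sup>2" using d_ge by (rule one_le_power)
  then show "alpha \<le> 1 / 4" unfolding alpha_def by (intro frac_le) auto
  show "0 < alpha" using d_pos by (simp add: alpha_def)
qed

lemma model_uminus: "model (- x) - model x = norm x * norm y * (iter_cos d (cosine x y) - iter_cos d (- cosine x y))"
  by (simp add: model_def kern_def cosine_def algebra_simps)

lemma delta_gap: "4 * \<delta> < 1 / (6 * real d ^ 3)"
proof -
  have p: "0 < real d ^ 3" using d_ge by simp
  have "\<delta> * real d ^ 3 \<le> 1 / 10 ^ 6"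
    by (rule delta_bounds)
  then show ?thesis using p by (simp add: field_simps)
qed

lemma objective_flip:
  assumes "x \<in> V 0" "norm x \<le> 2 * norm y"
  shows "\<bar>objective (- x) - objective x - (model (- x) - model x)\<bar> \<le> norm x * norm y * (4 * \<delta>)"
proof -
  have mx: "- x \<in> V 0" using V_scale[OF assms(1), of "-1"] by simp
  have "- x - x = - (2 *\<^sub>R x)" by (simp add: scaleR_2)
  then have "norm (- x - x) = 2 * norm x" by simp
  then show ?thesis using objective_model[OF assms(1) mx, of "2 * norm y"] assms by (simp add: mult_ac)
qed

text \<open>
At an angle of at least 120 degrees the kernel gap in favour of - x is 1/(3 d^3), more than the
error 4 * delta, so that - x would have the smaller loss.
\<close>
lemma sign_select_angle:
  assumes "x \<in> V 0" "x \<noteq> 0" "norm x \<le> 2 * norm y" "objective x \<le> objective (- x)"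
  shows "- (1 / 2) < cosine x y"
proof (rule ccontr)
  assume "\<not> ?thesis"
  then have c: "cosine x y \<le> - (1 / 2)" by simp
  have pos: "0 < norm x * norm y" using assms y_nz by simp
  have "norm x * norm y * (iter_cos d (- cosine x y) - iter_cos d (cosine x y)) \<le> norm x * norm y * (4 * \<delta>)"
    using objective_flip[OF assms(1,3)] assms(4) unfolding model_uminus by (simp add: algebra_simps abs_le_iff)
  then have "iter_cos d (- cosine x y) - iter_cos d (cosine x y) \<le> 4 * \<delta>"
    using pos by (simp only: mult_le_cancel_left_pos)
  moreover have "1 / (3 * real d ^ 3) \<le> iter_cos d (- cosine x y) - iter_cos d (cosine x y)"
    using c d_pos by (intro iter_cos_gap cosine_abs) auto
  moreover have "1 / (6 * real d ^ 3) \<le> 1 / (3 * real d ^ 3)" using d_ge by (simp add: field_simps)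
  ultimately show False using delta_gap by linarith
qed

lemma inner_grad_self:
  assumes "x \<noteq> 0" shows "inner (x - kern_grad d y x) x = norm x * (norm x - norm y * iter_cos d (cosine x y))"
  using kern_grad_euler[OF assms, of d y] by (simp add: inner_diff_left kern_def dot_square_norm power2_eq_square algebra_simps)

text \<open>
A step does not leave the open half space of x: the model gradient pulls towards x only by
|x| - |y| c_d. For |x| < |y| the error of the subgradient is compensated by c_d, which is at least 1/40 because the angle
is not too obtuse.
\<close>
lemma step_nonzero:
  assumes "x \<in> V 0" "x \<noteq> 0" "objective x \<le> objective (- x)" "clarke_at objective x v" "v \<in> V 0"
  shows "x - alpha *\<^sub>R v \<noteq> 0"
proof
  assume "x - alpha *\<^sub>R v = 0"
  then have xv: "x = alpha *\<^sub>R v" by simp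
  define M where "M = max (norm x) (norm y)"
  define k where "k = iter_cos d (cosine x y)"
  have nx: "0 < norm x" using assms by simp
  have dv: "norm (v - (x - kern_grad d y x)) \<le> \<delta> * M"
    unfolding M_def by (rule clarke_near_model_grad) (use assms in auto)
  have "inner v x \<le> norm x * (norm x - norm y * k) + \<delta> * M * norm x"
  proof -
    have "inner (v - (x - kern_grad d y x)) x \<le> \<delta> * M * norm x"
      using order_trans[OF norm_cauchy_schwarz mult_right_mono[OF dv norm_ge_zero[of x]]] .
    then show ?thesis using inner_grad_self[OF assms(2)] by (simp add: inner_diff_left k_def)
  qed
  then have "norm x * norm x \<le> norm x * (alpha * (norm x - norm y * k + \<delta> * M))"
  proof -
    assume "inner v x \<le> norm x * (norm x - norm y * k) + \<delta> * M * norm x"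
    then have "alpha * inner v x \<le> alpha * (norm x * (norm x - norm y * k) + \<delta> * M * norm x)"
      using alpha by (intro mult_left_mono) auto
    moreover have "inner x x = alpha * inner v x" by (subst (1) xv) simp
    ultimately show ?thesis by (simp add: dot_square_norm power2_eq_square algebra_simps)
  qed
  then have key: "norm x \<le> alpha * (norm x - norm y * k + \<delta> * M)" using nx by simp
  have k0: "0 \<le> k"
  proof -
    obtain j where "d = Suc j" using d_pos gr0_implies_Suc by blast
    then show ?thesis using Phi_bounds[OF iter_cos_abs[OF cosine_abs], of j x y] by (simp add: k_def)
  qed
  have "norm x - norm y * k + \<delta> * M \<le> 2 * norm x"
  proof (cases "norm y \<le> norm x")
    case True
    have MM: "M = norm x" using True by (simp add: M_def)
    have "0 \<le> norm y * k" using k0 by simp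
    moreover have "\<delta> * M \<le> 1 * norm x" unfolding MM using delta_bounds(1) by (intro mult_right_mono) auto
    ultimately show ?thesis by linarith
  next
    case False
    have "norm x \<le> 2 * norm y" using False norm_ge_zero[of y] by linarith
    then have "- (1 / 2) < cosine x y" using assms by (intro sign_select_angle) auto
    then have "1 / 40 \<le> k" unfolding k_def by (intro iter_cos_pos cosine_abs d_pos) auto
    then have "\<delta> \<le> k" using delta_bounds by simp
    then have "\<delta> * norm y \<le> k * norm y" by (intro mult_right_mono) auto
    moreover have "M = norm y" "k * norm y = norm y * k" using False by (simp_all add: M_def)
    ultimately show ?thesis using nx by (simp only:)
  qed
  then have "alpha * (norm x - norm y * k + \<delta> * M) \<le> alpha * (2 * norm x)" using alpha by (intro mult_left_mono) auto
  also have "\<dots> \<le> (1/4) * (2 * norm x)" using alpha by (intro mult_right_mono) auto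
  finally show False using key nx by simp
qed

text \<open>
The displacement is - alpha * v. In units of alpha * |v|^2, the linear term of the model contributes -1,
the errors of the subgradient and of the model 4/12, and the quadratic term at most 1/8.
\<close>
lemma step_descent:
  assumes "x \<in> V 0" "x \<noteq> 0" "clarke_at objective x v" "v \<in> V 0"
    and big: "12 * \<delta> * max (norm x) (norm y) \<le> norm v"
  shows "objective (x - alpha *\<^sub>R v) \<le> objective x - 72 * alpha * \<delta>\<^sup>2 * (norm y)\<^sup>2"
proof -
  define M where "M = max (norm x) (norm y)"
  define n where "n = norm v"
  have M: "norm x \<le> M" "norm y \<le> M" "0 < M" using assms by (auto simp: M_def less_max_iff_disj)
  have n0: "0 \<le> n" by (simp add: n_def)
  have nb: "12 * (\<delta> * M) \<le> n" using big by (simp add: M_def n_def)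
  have dv: "norm (v - (x - kern_grad d y x)) \<le> \<delta> * M"
    unfolding M_def by (rule clarke_near_model_grad) (use assms in auto)
  have "n \<le> 5 * M"
  proof -
    have "n \<le> norm (x - kern_grad d y x) + norm (v - (x - kern_grad d y x))"
      unfolding n_def by (rule norm_triangle_sub)
    also have "norm (x - kern_grad d y x) \<le> norm x + norm (kern_grad d y x)" by (rule norm_triangle_ineq4)
    finally have "n \<le> norm x + 3 * norm y + \<delta> * M" using dv kern_grad_norm[of d y x] by linarith
    moreover have "\<delta> * M \<le> 1 * M" using M delta_bounds by (intro mult_right_mono) auto
    ultimately show ?thesis using M by linarith
  qed
  then have an: "alpha * n \<le> 1 / 4 * (5 * M)" using alpha n0 by (intro mult_mono) auto
  define w where "w = x - alpha *\<^sub>R v"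
  have w: "w \<in> V 0" "norm w \<le> 3 * M"
  proof -
    show "w \<in> V 0" using assms by (auto simp: w_def intro: V_diff V_scale)
    have "norm w \<le> norm x + alpha * n" unfolding w_def n_def using norm_triangle_ineq4[of x "alpha *\<^sub>R v"] alpha by simp
    then show "norm w \<le> 3 * M" using an M by linarith
  qed
  have wx: "w - x = - (alpha *\<^sub>R v)" by (simp add: w_def)
  have nwx: "norm (w - x) = alpha * n" using alpha by (simp add: wx n_def)
  have lm: "objective w - objective x - (model w - model x) \<le> \<delta> * (3 * M) * (alpha * n)"
    using objective_model[OF assms(1) w(1), of "3 * M"] M w(2) by (simp add: nwx abs_le_iff)
  have mm: "model w - model x \<le> - alpha * inner (x - kern_grad d y x) v + (alpha * n)\<^sup>2 / 2"
    using model_convex_upper[OF assms(2), of w] by (simp add: nwx) (simp add: wx)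
  have iv: "n\<^sup>2 - \<delta> * M * n \<le> inner (x - kern_grad d y x) v"
  proof -
    have "inner (v - (x - kern_grad d y x)) v \<le> \<delta> * M * n"
      unfolding n_def by (rule order_trans[OF norm_cauchy_schwarz mult_right_mono[OF dv norm_ge_zero]])
    then show ?thesis by (simp add: inner_diff_left n_def power2_norm_eq_inner)
  qed
  have "alpha * (n\<^sup>2 - \<delta> * M * n) \<le> alpha * inner (x - kern_grad d y x) v"
    using iv alpha by (intro mult_left_mono) auto
  then have "objective w - objective x \<le> - (alpha * (n\<^sup>2 - \<delta> * M * n)) + (alpha * n)\<^sup>2 / 2 + \<delta> * (3 * M) * (alpha * n)"
    using lm mm by linarith
  also have "\<dots> = alpha * (- n\<^sup>2 + 4 * ((\<delta> * M) * n) + alpha * n\<^sup>2 / 2)"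
    by (simp add: algebra_simps power2_eq_square)
  also have "\<dots> \<le> alpha * (- (n\<^sup>2 / 2))"
  proof (intro mult_left_mono)
    have "12 * (\<delta> * M) * n \<le> n * n" using nb n0 by (rule mult_right_mono)
    moreover have "alpha * n\<^sup>2 \<le> 1 / 4 * n\<^sup>2" using alpha by (intro mult_right_mono) auto
    ultimately show "- n\<^sup>2 + 4 * ((\<delta> * M) * n) + alpha * n\<^sup>2 / 2 \<le> - (n\<^sup>2 / 2)"
      using zero_le_square[of n] unfolding power2_eq_square by linarith
  qed (use alpha in auto)
  also have "\<dots> \<le> alpha * (- (72 * (\<delta>\<^sup>2 * (norm y)\<^sup>2)))"
  proof (intro mult_left_mono)
    have "(12 * (\<delta> * norm y))\<^sup>2 \<le> n\<^sup>2"
    proof (rule power_mono)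
      have "\<delta> * norm y \<le> \<delta> * M" using M delta_pos by (intro mult_left_mono) auto
      then show "12 * (\<delta> * norm y) \<le> n" using nb by linarith
    qed (use delta_pos in auto)
    then show "- (n\<^sup>2 / 2) \<le> - (72 * (\<delta>\<^sup>2 * (norm y)\<^sup>2))" by (simp add: power_mult_distrib)
  qed (use alpha in auto)
  finally show ?thesis by (simp add: w_def mult.assoc)
qed

text \<open>
The model gradient h is split into its components along x and orthogonal to x. The first one is
|x| - |y| c_d; the second one has length |y| times the sine s of the angle times the
slope P.
\<close>
lemma step_near:
  assumes "x \<in> V 0" "x \<noteq> 0" "objective x \<le> objective (- x)" "clarke_at objective x v" "v \<in> V 0"
    and small: "norm v < 12 * \<delta> * max (norm x) (norm y)"
  shows "norm (x - y) \<le> 260 * real d ^ 3 * \<delta> * norm y" and "1 / 2 < cosine x y" and "norm x \<le> 2 * norm y"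
proof -
  define M where "M = max (norm x) (norm y)"
  define h where "h = x - kern_grad d y x"
  define c where "c = cosine x y"
  define Y where "Y = norm y" define N where "N = norm x"
  have N0: "0 < N" and Y0: "0 < Y" using assms y_nz by (auto simp: N_def Y_def)
  have h13: "norm h \<le> 13 * (\<delta> * M)"
  proof -
    have "norm (v - h) \<le> \<delta> * M"
      unfolding M_def h_def by (rule clarke_near_model_grad) (use assms in auto)
    moreover have "norm h \<le> norm v + norm (v - h)" using norm_triangle_sub[of h v] by (simp add: norm_minus_commute)
    ultimately show ?thesis using small by (simp add: M_def)
  qed
  define k where "k = iter_cos d c"
  have k1: "\<bar>k\<bar> \<le> 1" unfolding k_def c_def by (intro iter_cos_abs cosine_abs)
  have rad: "\<bar>N - Y * k\<bar> \<le> 13 * (\<delta> * M)"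
  proof -
    have "\<bar>inner h x\<bar> \<le> 13 * (\<delta> * M) * N"
      using order_trans[OF Cauchy_Schwarz_ineq2 mult_right_mono[OF h13 norm_ge_zero]] by (simp add: N_def)
    then have "\<bar>N * (N - Y * k)\<bar> \<le> 13 * (\<delta> * M) * N"
      using inner_grad_self[OF assms(2)] by (simp add: h_def N_def Y_def k_def c_def)
    then have "N * \<bar>N - Y * k\<bar> \<le> N * (13 * (\<delta> * M))" using N0 by (simp add: abs_mult mult.commute)
    then show ?thesis using N0 by (simp only: mult_le_cancel_left_pos)
  qed
  have Yk: "Y * k \<le> Y * 1" using k1 Y0 by (intro mult_left_mono) auto
  have N2: "N \<le> 2 * Y"
  proof (cases "N \<le> Y")
    case False
    then have MN: "M = N" by (simp add: M_def N_def Y_def)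
    have "\<delta> * N \<le> 1 / 26 * N" using delta_bounds N0 by (intro mult_right_mono) auto
    then show ?thesis using rad Yk unfolding MN by linarith
  qed (use Y0 in auto)
  then show "norm x \<le> 2 * norm y" by (simp add: N_def Y_def)
  have M2: "M \<le> 2 * Y" using N2 Y0 by (auto simp: M_def N_def Y_def)
  have dM: "\<delta> * M \<le> 2 * (\<delta> * Y)" using mult_left_mono[OF M2, of \<delta>] delta_pos by simp
  have ch: "- (1 / 2) < c" unfolding c_def using assms N2 by (intro sign_select_angle) (auto simp: N_def Y_def)
  have cb: "\<bar>c\<bar> \<le> 1" unfolding c_def by (rule cosine_abs)
  define P where "P = iter_slope d c"
  have P: "1 / (3 * real d ^ 3) \<le> P" unfolding P_def using cb ch d_pos by (intro iter_slope_lower_half) auto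
  have d3: "0 < real d ^ 3" using d_ge by simp
  \<comment> \<open>q is the component of y orthogonal to x, and Y * s is its length.\<close>
  define q where "q = y - (Y * c / N) *\<^sub>R x"
  define s where "s = sqrt (1 - c\<^sup>2)"
  have c2: "c\<^sup>2 \<le> 1" using cb by (simp add: abs_square_le_1)
  have s0: "0 \<le> s" and s2: "s\<^sup>2 = 1 - c\<^sup>2" using c2 by (auto simp: s_def)
  have xy: "inner x y = N * Y * c" unfolding N_def Y_def c_def by (rule inner_eq_cosine)
  have xx: "inner x x = N * N" "inner y y = Y * Y" by (simp_all add: N_def Y_def dot_square_norm power2_eq_square)
  have xq: "inner x q = 0" using N0 by (simp add: q_def inner_diff_right xy xx)
  have yq: "inner y q = (Y * s)\<^sup>2"
  proof -
    have "inner y q = Y * Y - Y * c * (Y * c)"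
      using N0 by (simp add: q_def inner_diff_right inner_commute[of y x] xy xx)
    also have "\<dots> = Y * Y * (1 - c\<^sup>2)" by (simp add: algebra_simps power2_eq_square)
    also have "\<dots> = (Y * s)\<^sup>2" unfolding s2[symmetric] by (simp add: power2_eq_square)
    finally show ?thesis .
  qed
  have qq: "(norm q)\<^sup>2 = (Y * s)\<^sup>2"
  proof -
    have "(norm q)\<^sup>2 = inner y q - (Y * c / N) * inner x q"
      unfolding power2_norm_eq_inner by (subst (1) q_def) (simp add: inner_diff_left)
    then show ?thesis by (simp add: xq yq)
  qed
  have nq: "norm q = Y * s" using qq Y0 s0 by (simp add: power2_eq_iff_nonneg)
  have "inner h q = - P * (Y * s)\<^sup>2"
    unfolding h_def inner_diff_left inner_kern_grad xq yq by (simp add: P_def c_def)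
  then have "P * (Y * s)\<^sup>2 \<le> norm h * (Y * s)"
    using Cauchy_Schwarz_ineq2[of h q] iter_slope_bounds[OF cb, of d] by (simp add: nq abs_mult P_def)
  moreover have "norm h * (Y * s) \<le> 26 * (\<delta> * Y) * (Y * s)"
    using h13 dM Y0 s0 by (intro mult_right_mono) auto
  ultimately have "P * (Y * s)\<^sup>2 \<le> 26 * (\<delta> * Y) * (Y * s)" by linarith
  then have F: "(Y * s) * (P * (Y * s)) \<le> (Y * s) * (26 * (\<delta> * Y))"
    by (simp add: power2_eq_square mult_ac)
  have Ps: "P * s \<le> 26 * \<delta>"
  proof (cases "s = 0")
    case False
    then have "0 < Y * s" using Y0 s0 by simp
    then have "P * (Y * s) \<le> 26 * (\<delta> * Y)" using F by (simp only: mult_le_cancel_left_pos)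
    then have "Y * (P * s) \<le> Y * (26 * \<delta>)" by (simp only: mult_ac)
    then show ?thesis using Y0 by (simp only: mult_le_cancel_left_pos)
  qed (use delta_pos in auto)
  have "1 / (3 * real d ^ 3) * s \<le> P * s" using P s0 by (intro mult_right_mono)
  then have "s / (3 * real d ^ 3) \<le> 26 * \<delta>" using Ps by simp
  then have s78: "s \<le> 78 * (\<delta> * real d ^ 3)" using d3 by (simp add: divide_le_eq mult_ac)
  have dd: "\<delta> * real d ^ 3 \<le> 1 / 10 ^ 6"
    by (rule delta_bounds)
  have ss: "s \<le> 1 / 4" using s78 dd by simp
  have "s * s \<le> 1 / 4 * (1 / 4)" using ss s0 by (intro mult_mono) auto
  then have c34: "3 / 4 < c\<^sup>2" using s2 by (simp add: power2_eq_square)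
  have chalf: "1 / 2 < c"
  proof (rule ccontr)
    assume "\<not> 1 / 2 < c"
    then have "\<bar>c\<bar> \<le> 1 / 2" using ch by simp
    then have "\<bar>c\<bar>\<^sup>2 \<le> (1 / 2)\<^sup>2" by (intro power_mono) auto
    then show False using c34 by (simp add: power2_eq_square)
  qed
  then show "1 / 2 < cosine x y" by (simp add: c_def)
  have "c * c \<le> 1 * c" using chalf cb by (intro mult_right_mono) auto
  then have c1: "1 - c \<le> s\<^sup>2" using s2 by (simp add: power2_eq_square)
  have ssq: "s\<^sup>2 \<le> s" unfolding power2_eq_square using ss s0 mult_left_le[of s s] by simp
  have ck: "c \<le> k" unfolding k_def by (rule iter_cos_ge[OF cb])
  have rad2: "\<bar>N - Y\<bar> \<le> Y * (s + 26 * \<delta>)"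
  proof -
    have "Y * (1 - k) \<le> Y * s" using c1 ck ssq Y0 by (intro mult_left_mono) auto
    then have "Y - Y * k \<le> Y * s" by (simp add: right_diff_distrib)
    moreover have "\<bar>N - Y * k\<bar> \<le> 26 * (\<delta> * Y)" using rad dM by linarith
    ultimately have "\<bar>N - Y\<bar> \<le> Y * s + 26 * (\<delta> * Y)" using Yk by linarith
    then show ?thesis by (simp add: algebra_simps)
  qed
  have "(norm (x - y))\<^sup>2 = (N - Y)\<^sup>2 + 2 * (N * Y) * (1 - c)"
    unfolding power2_norm_eq_inner by (simp add: inner_diff inner_commute[of y x] xy xx power2_eq_square algebra_simps)
  also have "\<dots> \<le> (Y * (s + 26 * \<delta>))\<^sup>2 + (2 * Y * s)\<^sup>2"
  proof (intro add_mono)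
    show "(N - Y)\<^sup>2 \<le> (Y * (s + 26 * \<delta>))\<^sup>2" using rad2 power_mono[OF rad2, of 2] by simp
    have "2 * (N * Y) * (1 - c) \<le> 2 * (2 * Y * Y) * s\<^sup>2"
      using c1 N2 Y0 N0 cb by (intro mult_mono mult_left_mono) (auto intro: mult_right_mono)
    then show "2 * (N * Y) * (1 - c) \<le> (2 * Y * s)\<^sup>2" by (simp add: power2_eq_square mult_ac)
  qed
  also have "\<dots> \<le> (Y * (s + 26 * \<delta>) + 2 * Y * s)\<^sup>2"
  proof -
    have "0 \<le> (Y * (s + 26 * \<delta>)) * (2 * Y * s)" using Y0 s0 delta_pos by simp
    then show ?thesis unfolding power2_sum by simp
  qed
  finally have "norm (x - y) \<le> Y * (s + 26 * \<delta>) + 2 * Y * s"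
    by (rule power2_le_imp_le) (use Y0 s0 delta_pos in auto)
  also have "\<dots> = Y * (3 * s + 26 * \<delta>)" by (simp add: algebra_simps)
  also have "\<dots> \<le> Y * (260 * (\<delta> * real d ^ 3))"
    using s78 delta_bounds(3) Y0 by (intro mult_left_mono) auto
  finally show "norm (x - y) \<le> 260 * real d ^ 3 * \<delta> * norm y" by (simp add: Y_def mult_ac)
qed

end


section \<open>Convergence of the normalized method\<close>

context sensing
begin

definition flip :: "'a \<Rightarrow> 'a" where
  "flip x = (if objective (- x) < objective x then - x else x)"

definition contraction :: real where "contraction = 1 - 7 / 8 * alpha"

definition decrement :: real where "decrement = 72 * alpha * \<delta>\<^sup>2 * (norm y)\<^sup>2"

lemma flip_in: "x \<in> V 0 \<Longrightarrow> flip x \<in> V 0"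
  using V_scale[of x 0 "-1"] by (simp add: flip_def)

lemma flip_nonzero: "x \<noteq> 0 \<Longrightarrow> flip x \<noteq> 0"
  by (simp add: flip_def)

lemma flip_le: "objective (flip x) \<le> objective x" "objective (flip x) \<le> objective (- flip x)"
  by (auto simp: flip_def)

text \<open>
A flip at x would make - x the better one of the two, but its angle with y exceeds 120 degrees, which
sign_select_angle excludes.
\<close>
lemma no_flip_near:
  assumes "x \<in> V 0" "norm (x - y) \<le> rho * norm y"
  shows "flip x = x"
proof (rule ccontr)
  assume "flip x \<noteq> x"
  then have l: "objective (- x) < objective x" by (auto simp: flip_def split: if_splits)
  have Y: "0 < norm y" using y_nz by simp
  have xy: "norm (x - y) \<le> 1 / 2500 * norm y"
    using assms(2) rho(2) mult_right_mono[OF rho(2) norm_ge_zero[of y]] by linarith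
  have nx: "norm x \<le> 2501 / 2500 * norm y" using norm_triangle_sub[of x y] xy by linarith
  have nx2: "norm x \<le> 2 * norm y" using nx Y by linarith
  have "norm y \<le> norm x + norm (x - y)" using norm_triangle_sub[of y x] by (simp add: norm_minus_commute)
  then have x0: "x \<noteq> 0" using xy Y by auto
  have mx: "- x \<in> V 0" using V_scale[OF assms(1), of "-1"] by simp
  have "- (1 / 2) < cosine (- x) y"
    using mx x0 nx2 l by (intro sign_select_angle) auto
  then have c: "cosine x y < 1 / 2" by (simp add: cosine_def)
  have "inner x y = norm y * norm y + inner (x - y) y" by (simp add: inner_diff_left dot_square_norm power2_eq_square)
  moreover have "\<bar>inner (x - y) y\<bar> \<le> 1 / 2500 * norm y * norm y"
    by (rule order_trans[OF Cauchy_Schwarz_ineq2 mult_right_mono[OF xy norm_ge_zero]])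
  ultimately have "2499 / 2500 * (norm y * norm y) \<le> norm x * norm y * cosine x y"
    using inner_eq_cosine[of x y] by (simp add: abs_le_iff)
  also have "\<dots> \<le> norm x * norm y * (1 / 2)" using c by (intro mult_left_mono) auto
  also have "\<dots> \<le> (2501 / 2500 * norm y) * norm y * (1 / 2)"
    using nx by (intro mult_right_mono) auto
  finally have "norm y * norm y \<le> 0" by simp
  then show False using Y by (simp add: mult_le_0_iff)
qed

text \<open>
If the flip is used in the step in which the subgradient gets tiny, then one further step is needed. The loss
before the flip is large enough to pay for it.
\<close>
lemma flipped_objective_large:
  assumes "x \<in> V 0" "1 / 2 < cosine x y" "norm x \<le> 2 * norm y" "norm y \<le> 2 * norm x"
  shows "decrement \<le> objective (- x)"
proof -
  have Y: "0 < norm y" using y_nz by simp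
  have d3: "1 \<le> real d ^ 3" using d_ge by (rule one_le_power)
  define P where "P = norm x * norm y"
  have P0: "0 \<le> P" by (simp add: P_def)
  have YP: "norm y * norm y \<le> 2 * P" using mult_right_mono[OF assms(4) norm_ge_zero[of y]] by (simp add: P_def)
  note objective_flip[OF assms(1,3)]
  moreover have "0 \<le> objective x" by (simp add: objective_def)
  ultimately have "P * (iter_cos d (cosine x y) - iter_cos d (- cosine x y)) - 4 * \<delta> * P \<le> objective (- x)"
    unfolding model_uminus P_def by (simp add: abs_le_iff mult_ac)
  moreover have "P * (1 / (3 * real d ^ 3)) \<le> P * (iter_cos d (cosine x y) - iter_cos d (- cosine x y))"
    using iter_cos_gap[of "- cosine x y" d] cosine_abs[of x y] assms(2) d_pos P0
    by (intro mult_left_mono) auto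
  moreover have "4 * \<delta> * P \<le> 1 / (6 * real d ^ 3) * P"
    using delta_gap P0 by (intro mult_right_mono) auto
  moreover have "P * (1 / (3 * real d ^ 3)) = 2 * (1 / (6 * real d ^ 3) * P)" by simp
  ultimately have 1: "1 / (6 * real d ^ 3) * P \<le> objective (- x)" by linarith
  have "decrement \<le> 18 * \<delta>\<^sup>2 * (norm y)\<^sup>2"
    unfolding decrement_def using alpha by (intro mult_right_mono) auto
  also have "\<dots> = (18 * \<delta>) * \<delta> * (norm y * norm y)" by (simp add: power2_eq_square)
  also have "\<dots> \<le> 1 * \<delta> * (2 * P)"
  proof (rule mult_mono)
    show "18 * \<delta> * \<delta> \<le> 1 * \<delta>" using delta_bounds(1) delta_pos by (intro mult_right_mono) auto
  qed (use YP delta_pos in auto)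
  also have "\<dots> \<le> (4 * \<delta>) * P" using delta_pos P0 by simp
  also have "\<dots> \<le> 1 / (6 * real d ^ 3) * P"
    using delta_gap P0 by (intro mult_right_mono) auto
  finally show ?thesis using 1 by linarith
qed

lemma contraction: "0 < contraction" "contraction < 1"
  using alpha by (auto simp: contraction_def)

lemma contraction_step:
  assumes "x \<in> V 0" "norm (x - y) < rho * norm y" "clarke_at objective x v" "v \<in> V 0"
  shows "norm (x - alpha *\<^sub>R v - y) \<le> contraction * norm (x - y) + 3 * alpha * norm e"
proof -
  have "x - alpha *\<^sub>R v - y = (1 - alpha) *\<^sub>R (x - y) - alpha *\<^sub>R (v - (x - y))"
    by (simp add: algebra_simps)
  also have "norm \<dots> \<le> norm ((1 - alpha) *\<^sub>R (x - y)) + norm (alpha *\<^sub>R (v - (x - y)))"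
    by (rule norm_triangle_ineq4)
  also have "\<dots> = (1 - alpha) * norm (x - y) + alpha * norm (v - (x - y))" using alpha by simp
  also have "alpha * norm (v - (x - y)) \<le> alpha * (norm (x - y) / 8 + 3 * norm e)"
    using alpha clarke_near_target[OF assms(3,1,4,2)] by (intro mult_left_mono) auto
  finally show ?thesis by (simp add: contraction_def algebra_simps)
qed

lemma delta_e: "norm e \<le> \<delta> * norm y / 3"
proof -
  have "0 \<le> 24 * real d * tau * norm y" using tau by simp
  then show ?thesis using delta_ge by linarith
qed

lemma radius_small:
  assumes "n \<le> 260 * real d ^ 3 * \<delta> * norm y + norm e"
  shows "n + 24 / 7 * norm e < rho * norm y"
proof -
  have Y: "0 < norm y" using y_nz by simp
  have "n + 24 / 7 * norm e \<le> 260 * (\<delta> * real d ^ 3 * norm y) + 2 * (\<delta> * norm y)"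
  proof -
    have "260 * real d ^ 3 * \<delta> * norm y = 260 * (\<delta> * real d ^ 3 * norm y)" by (simp only: mult_ac)
    moreover have "0 \<le> \<delta> * norm y" using delta_pos by simp
    ultimately show ?thesis using assms delta_e by linarith
  qed
  also have "\<delta> * norm y \<le> \<delta> * real d ^ 3 * norm y" using delta_bounds(3) by (intro mult_right_mono) auto
  finally have "n + 24 / 7 * norm e \<le> 262 * (\<delta> * real d ^ 3 * norm y)" by (simp add: mult_ac)
  also have "\<dots> \<le> 262 * (1 / 10 ^ 6 / real d * norm y)"
    using delta_bounds(2) by (intro mult_left_mono mult_right_mono) auto
  also have "\<dots> < rho * norm y" using Y d_pos by (simp add: rho_def field_simps)
  finally show ?thesis .
qed

text \<open>
N is the first index with a tiny subgradient if the iterate is not flipped there, and the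
next index otherwise. The constant 24/7 is the sum of the noise terms 3 * alpha * |e| of all steps, a
geometric series with ratio 1 - 7/8 alpha.
\<close>
theorem subgradient_method_converges:
  fixes X :: "nat \<Rightarrow> 'a"
  assumes X0: "X 0 \<in> V 0" "X 0 \<noteq> 0"
    and step: "\<And>i. \<exists>v\<in>V 0. clarke_at objective (flip (X i)) v \<and> X (Suc i) = flip (X i) - alpha *\<^sub>R v"
  shows "\<exists>N. real N * decrement \<le> objective (X 0)
    \<and> norm (X N - y) \<le> 260 * real d ^ 3 * \<delta> * norm y + norm e
    \<and> (\<forall>j. norm (X (N + j) - y) \<le> contraction ^ j * norm (X N - y) + 24 / 7 * norm e
         \<and> norm (net d (X (N + j)) - net d y) \<le> 6 / 5 * norm (X (N + j) - y))"
proof -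
  obtain v where v: "\<And>i. v i \<in> V 0" "\<And>i. clarke_at objective (flip (X i)) (v i)"
    "\<And>i. X (Suc i) = flip (X i) - alpha *\<^sub>R v i"
    using step by metis
  have mem: "X i \<in> V 0 \<and> X i \<noteq> 0" for i
  proof (induction i)
    case (Suc i)
    have "flip (X i) - alpha *\<^sub>R v i \<noteq> 0"
      using Suc flip_in flip_nonzero flip_le v by (intro step_nonzero) auto
    then show ?case unfolding v(3) using Suc v(1) by (auto intro: V_diff V_scale flip_in)
  qed (use X0 in auto)
  have fm: "flip (X i) \<in> V 0" "flip (X i) \<noteq> 0" for i using mem flip_in flip_nonzero by auto
  have dpos: "0 < decrement" using alpha delta_pos y_nz by (simp add: decrement_def)
  define stop where "stop i \<longleftrightarrow> norm (v i) < 12 * \<delta> * max (norm (flip (X i))) (norm y)" for i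
  have descend: "objective (X (Suc i)) \<le> objective (X i) - decrement" if "\<not> stop i" for i
  proof -
    have "objective (X (Suc i)) \<le> objective (flip (X i)) - decrement"
      unfolding v(3) decrement_def using fm[of i] v that by (intro step_descent) (auto simp: stop_def)
    then show ?thesis using flip_le(1)[of "X i"] by linarith
  qed
  have descend_n: "objective (X n) \<le> objective (X 0) - real n * decrement" if "\<forall>i<n. \<not> stop i" for n
    using that
  proof (induction n)
    case (Suc n)
    then show ?case using descend[of n] by (auto simp: algebra_simps)
  qed auto
  have loss0: "0 \<le> objective x" for x by (simp add: objective_def)
  have "\<exists>i. stop i"
  proof (rule ccontr)
    assume none: "\<not> ?thesis"
    obtain n :: nat where "objective (X 0) < real n * decrement" using ex_less_of_nat_mult[OF dpos] by blast
    then show False using descend_n[of n] loss0[of "X n"] none by auto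
  qed
  define K where "K = (LEAST i. stop i)"
  have K: "stop K" "\<forall>i<K. \<not> stop i"
    using LeastI_ex[OF \<open>\<exists>i. stop i\<close>] not_less_Least by (auto simp: K_def)
  define x where "x = flip (X K)"
  have xm: "x \<in> V 0" "x \<noteq> 0" "objective x \<le> objective (- x)" using fm flip_le by (auto simp: x_def)
  have near: "norm (x - y) \<le> 260 * real d ^ 3 * \<delta> * norm y" "1 / 2 < cosine x y" "norm x \<le> 2 * norm y"
    using step_near[OF xm, of "v K"] v K(1) by (auto simp: x_def stop_def)
  have e0: "0 \<le> norm e" by simp
  have xball: "norm (x - y) < rho * norm y"
    using radius_small[of "norm (x - y)"] near(1) e0 by linarith
  obtain N where N: "real N * decrement \<le> objective (X 0)" "norm (X N - y) \<le> 260 * real d ^ 3 * \<delta> * norm y + norm e"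
  proof (cases "x = X K")
    case True
    have "norm (X K - y) \<le> 260 * real d ^ 3 * \<delta> * norm y + norm e" using near(1) e0 unfolding True by linarith
    moreover have "real K * decrement \<le> objective (X 0)" using descend_n[OF K(2)] loss0[of "X K"] by linarith
    ultimately show ?thesis using that by blast
  next
    case False
    then have flipped: "X K = - x" by (auto simp: x_def flip_def split: if_splits)
    have "norm y \<le> 2 * norm x"
    proof -
      have "rho * norm y \<le> 1 / 2500 * norm y" using rho(2) by (intro mult_right_mono) auto
      moreover have "norm y \<le> norm x + norm (x - y)"
        using norm_triangle_sub[of y x] by (simp add: norm_minus_commute)
      ultimately show ?thesis using xball norm_ge_zero[of y] by linarith
    qed
    then have "decrement \<le> objective (X K)" unfolding flipped using near xm by (intro flipped_objective_large) auto
    then have "real (Suc K) * decrement \<le> objective (X 0)" using descend_n[OF K(2)] by (simp add: algebra_simps)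
    moreover have "norm (X (Suc K) - y) \<le> 260 * real d ^ 3 * \<delta> * norm y + norm e"
    proof -
      have "norm (X (Suc K) - y) \<le> contraction * norm (x - y) + 3 * alpha * norm e"
        unfolding v(3) x_def[symmetric]
        using xm xball v by (intro contraction_step) (auto simp: x_def)
      moreover have "contraction * norm (x - y) \<le> 1 * norm (x - y)" using contraction by (intro mult_right_mono) auto
      moreover have "3 * alpha * norm e \<le> 1 * norm e" using alpha by (intro mult_right_mono) auto
      ultimately show ?thesis using near(1) by linarith
    qed
    ultimately show ?thesis by (rule that)
  qed
  have ball: "norm (X (N + j) - y) < rho * norm y"
    if "norm (X (N + j) - y) \<le> contraction ^ j * norm (X N - y) + 24 / 7 * norm e" for j
  proof -
    have "contraction ^ j * norm (X N - y) \<le> 1 * norm (X N - y)"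
      using contraction by (intro mult_right_mono power_le_one) auto
    then show ?thesis using that radius_small[OF N(2)] by linarith
  qed
  have conv: "norm (X (N + j) - y) \<le> contraction ^ j * norm (X N - y) + 24 / 7 * norm e" for j
  proof (induction j)
    case (Suc j)
    have b: "norm (X (N + j) - y) < rho * norm y" by (rule ball[OF Suc])
    have f: "flip (X (N + j)) = X (N + j)" using mem b by (intro no_flip_near) auto
    have "norm (X (Suc (N + j)) - y) \<le> contraction * norm (X (N + j) - y) + 3 * alpha * norm e"
      unfolding v(3) using mem[of "N + j"] b v(1,2)[of "N + j"] f by (intro contraction_step[of "flip (X (N + j))", unfolded f] | simp add: f)+
    also have "\<dots> \<le> contraction * (contraction ^ j * norm (X N - y) + 24 / 7 * norm e) + 3 * alpha * norm e"
      using Suc contraction by (intro add_right_mono mult_left_mono) auto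
    also have "\<dots> = contraction ^ Suc j * norm (X N - y) + 24 / 7 * norm e"
      by (simp add: contraction_def algebra_simps)
    finally show ?case by simp
  qed simp
  have G: "norm (net d (X (N + j)) - net d y) \<le> 6 / 5 * norm (X (N + j) - y)" for j
  proof (rule power2_le_imp_le)
    have b: "norm (X (N + j) - y) \<le> rho * norm y" using ball[OF conv, of j] by simp
    have yy: "norm (y - y) \<le> rho * norm y" using rho by simp
    have xin: "X (N + j) \<in> V 0" using mem by blast
    have "(norm (net d (X (N + j)) - net d y))\<^sup>2 \<le> 33 / 32 * (norm (X (N + j) - y))\<^sup>2"
      using abs_le_D1[OF net_near_isometry[OF y_in y_nz rho(1,3) order_refl xin y_in xin y_in b yy b yy]]
      by (simp add: power2_norm_eq_inner[symmetric] power2_eq_square)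
    also have "\<dots> \<le> (6 / 5 * norm (X (N + j) - y))\<^sup>2" by (simp add: power_mult_distrib power_divide)
    finally show "(norm (net d (X (N + j)) - net d y))\<^sup>2 \<le> (6 / 5 * norm (X (N + j) - y))\<^sup>2" .
  qed simp
  show ?thesis using N conv G by blast
qed

end


section \<open>Finitely supported sequences\<close>

text \<open>
The widths of the layers vary, and the induction over the layers needs all of them in one type. So the
vectors of all dimensions are embedded in the inner product space of finitely supported sequences.
\<close>
typedef finseq = "{f :: nat \<Rightarrow> real. finite {i. f i \<noteq> 0}}"
  morphisms coord Abs_finseq
  by (intro exI[of _ "\<lambda>_. 0"]) simp

lemma finite_coord: "finite {i. coord x i \<noteq> 0}"
  using coord[of x] by simp

lemma finseq_eqI: "(\<And>i. coord x i = coord y i) \<Longrightarrow> x = y"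
  by (subst coord_inject[symmetric]) auto

lemma coord_Abs: "finite {i. f i \<noteq> 0} \<Longrightarrow> coord (Abs_finseq f) = f"
  by (simp add: Abs_finseq_inverse)

instantiation finseq :: real_inner
begin

definition zero_finseq :: finseq where "0 = Abs_finseq (\<lambda>_. 0)"
definition plus_finseq :: "finseq \<Rightarrow> finseq \<Rightarrow> finseq" where
  "x + y = Abs_finseq (\<lambda>i. coord x i + coord y i)"
definition uminus_finseq :: "finseq \<Rightarrow> finseq" where
  "- x = Abs_finseq (\<lambda>i. - coord x i)"
definition minus_finseq :: "finseq \<Rightarrow> finseq \<Rightarrow> finseq" where
  "x - y = Abs_finseq (\<lambda>i. coord x i - coord y i)"
definition scaleR_finseq :: "real \<Rightarrow> finseq \<Rightarrow> finseq" where
  "r *\<^sub>R x = Abs_finseq (\<lambda>i. r * coord x i)"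
definition inner_finseq :: "finseq \<Rightarrow> finseq \<Rightarrow> real" where
  "inner x y = (\<Sum>i\<in>{i. coord x i \<noteq> 0}. coord x i * coord y i)"
definition norm_finseq :: "finseq \<Rightarrow> real" where "norm x = sqrt (inner x x)" for x :: finseq
definition dist_finseq :: "finseq \<Rightarrow> finseq \<Rightarrow> real" where "dist x y = norm (x - y)" for x :: finseq
definition sgn_finseq :: "finseq \<Rightarrow> finseq" where "sgn x = inverse (norm x) *\<^sub>R x" for x :: finseq
definition uniformity_finseq :: "(finseq \<times> finseq) filter" where
  "uniformity_finseq = (INF e\<in>{0<..}. principal {(x, y). dist x y < e})"
definition open_finseq :: "finseq set \<Rightarrow> bool" where
  "open_finseq U \<longleftrightarrow> (\<forall>x\<in>U. \<forall>\<^sub>F (x', y) in uniformity. x' = x \<longrightarrow> y \<in> U)"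

lemma coord_0: "coord 0 i = 0"
  by (simp add: zero_finseq_def coord_Abs)

lemma coord_add: "coord (x + y) i = coord x i + coord y i"
proof -
  have "finite {i. coord x i + coord y i \<noteq> 0}"
    by (rule finite_subset[OF _ finite_UnI[OF finite_coord[of x] finite_coord[of y]]]) auto
  then show ?thesis by (simp add: plus_finseq_def coord_Abs)
qed

lemma coord_diff: "coord (x - y) i = coord x i - coord y i"
proof -
  have "finite {i. coord x i - coord y i \<noteq> 0}"
    by (rule finite_subset[OF _ finite_UnI[OF finite_coord[of x] finite_coord[of y]]]) auto
  then show ?thesis by (simp add: minus_finseq_def coord_Abs)
qed

lemma coord_uminus: "coord (- x) i = - coord x i"
  by (simp add: uminus_finseq_def coord_Abs finite_coord)

lemma coord_scaleR: "coord (r *\<^sub>R x) i = r * coord x i"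
proof -
  have "finite {i. r * coord x i \<noteq> 0}"
    by (rule finite_subset[OF _ finite_coord[of x]]) auto
  then show ?thesis by (simp add: scaleR_finseq_def coord_Abs)
qed

lemmas coord_simps = coord_0 coord_add coord_diff coord_uminus coord_scaleR

lemma inner_finseq_superset:
  assumes "finite S" "{i. coord x i \<noteq> 0} \<subseteq> S"
  shows "inner x y = (\<Sum>i\<in>S. coord x i * coord y i)"
  unfolding inner_finseq_def using assms by (intro sum.mono_neutral_left) auto

instance
proof
  fix x y z :: finseq and r s :: real
  have S: "finite ({i. coord x i \<noteq> 0} \<union> {i. coord y i \<noteq> 0})" (is "finite ?S")
    using finite_coord by simp
  show "x + y + z = x + (y + z)" by (rule finseq_eqI) (simp add: coord_simps)
  show "x + y = y + x" by (rule finseq_eqI) (simp add: coord_simps)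
  show "0 + x = x" by (rule finseq_eqI) (simp add: coord_simps)
  show "- x + x = 0" by (rule finseq_eqI) (simp add: coord_simps)
  show "x - y = x + - y" by (rule finseq_eqI) (simp add: coord_simps)
  show "r *\<^sub>R (x + y) = r *\<^sub>R x + r *\<^sub>R y" by (rule finseq_eqI) (simp add: coord_simps distrib_left)
  show "(r + s) *\<^sub>R x = r *\<^sub>R x + s *\<^sub>R x" by (rule finseq_eqI) (simp add: coord_simps distrib_right)
  show "r *\<^sub>R s *\<^sub>R x = (r * s) *\<^sub>R x" by (rule finseq_eqI) (simp add: coord_simps mult.assoc)
  show "1 *\<^sub>R x = x" by (rule finseq_eqI) (simp add: coord_simps)
  show "dist x y = norm (x - y)" by (rule dist_finseq_def)
  show "sgn x = inverse (norm x) *\<^sub>R x" by (rule sgn_finseq_def)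
  show "uniformity = (INF e\<in>{0<..}. principal {(x :: finseq, y). dist x y < e})"
    by (rule uniformity_finseq_def)
  show "open U \<longleftrightarrow> (\<forall>x\<in>U. \<forall>\<^sub>F (x', y) in uniformity. x' = x \<longrightarrow> y \<in> U)" for U :: "finseq set"
    by (rule open_finseq_def)
  show "inner x y = inner y x"
    using inner_finseq_superset[OF S, of x y] inner_finseq_superset[OF S, of y x] by (simp add: mult.commute)
  have S3: "finite ({i. coord x i \<noteq> 0} \<union> {i. coord y i \<noteq> 0})" using finite_coord by simp
  have "inner (x + y) z = (\<Sum>i\<in>?S. coord (x + y) i * coord z i)"
    by (rule inner_finseq_superset[OF S3]) (auto simp: coord_add)
  then show "inner (x + y) z = inner x z + inner y z"
    using inner_finseq_superset[OF S3, of x z] inner_finseq_superset[OF S3, of y z]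
    by (simp add: coord_add algebra_simps sum.distrib)
  have "inner (r *\<^sub>R x) y = (\<Sum>i\<in>?S. coord (r *\<^sub>R x) i * coord y i)"
    by (rule inner_finseq_superset[OF S]) (auto simp: coord_scaleR)
  then show "inner (r *\<^sub>R x) y = r * inner x y"
    using inner_finseq_superset[OF S, of x y] by (simp add: coord_scaleR sum_distrib_left mult.assoc)
  show "0 \<le> inner x x" unfolding inner_finseq_def by (intro sum_nonneg) simp
  show "inner x x = 0 \<longleftrightarrow> x = 0"
  proof
    assume "inner x x = 0"
    then have "\<forall>i\<in>{i. coord x i \<noteq> 0}. coord x i * coord x i = 0"
      unfolding inner_finseq_def by (subst (asm) sum_nonneg_eq_0_iff) (auto simp: finite_coord)
    then have "coord x i = 0" for i by auto
    then show "x = 0" by (intro finseq_eqI) (simp add: coord_0)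
  qed (simp add: inner_finseq_def coord_0)
  show "norm x = sqrt (inner x x)" by (rule norm_finseq_def)
qed

end

definition emb :: "real vec \<Rightarrow> finseq" where
  "emb v = Abs_finseq (\<lambda>i. if i < dim_vec v then v $ i else 0)"

definition proj :: "nat \<Rightarrow> finseq \<Rightarrow> real vec" where
  "proj n x = vec n (coord x)"

definition coord_space :: "nat \<Rightarrow> finseq set" where
  "coord_space n = {x. \<forall>i\<ge>n. coord x i = 0}"

lemma coord_emb: "coord (emb v) i = (if i < dim_vec v then v $ i else 0)"
proof -
  have "finite {i. (if i < dim_vec v then v $ i else 0) \<noteq> 0}"
    by (rule finite_subset[of _ "{..<dim_vec v}"]) (auto split: if_splits)
  then show ?thesis by (simp add: emb_def coord_Abs)
qed

lemma proj_carrier[simp]: "proj n x \<in> carrier_vec n" "dim_vec (proj n x) = n"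
  by (auto simp: proj_def)

lemma emb_in: "v \<in> carrier_vec n \<Longrightarrow> emb v \<in> coord_space n"
  by (auto simp: coord_space_def coord_emb)

lemma proj_emb: "v \<in> carrier_vec n \<Longrightarrow> proj n (emb v) = v"
  by (intro eq_vecI) (auto simp: proj_def coord_emb)

lemma emb_proj: "x \<in> coord_space n \<Longrightarrow> emb (proj n x) = x"
  by (rule finseq_eqI) (auto simp: coord_emb proj_def coord_space_def)

lemma coord_space_subspace: "subspace (coord_space n)"
  by (auto simp: subspace_def coord_space_def coord_simps)

lemma proj_add: "proj n (x + y) = proj n x + proj n y"
  by (intro eq_vecI) (auto simp: proj_def coord_simps)

lemma proj_scale: "proj n (r *\<^sub>R x) = r \<cdot>\<^sub>v proj n x"
  by (intro eq_vecI) (auto simp: proj_def coord_simps)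

lemma emb_add: "u \<in> carrier_vec n \<Longrightarrow> v \<in> carrier_vec n \<Longrightarrow> emb (u + v) = emb u + emb v"
  by (rule finseq_eqI) (auto simp: coord_emb coord_simps)

lemma emb_diff: "u \<in> carrier_vec n \<Longrightarrow> v \<in> carrier_vec n \<Longrightarrow> emb (u - v) = emb u - emb v"
  by (rule finseq_eqI) (auto simp: coord_emb coord_simps)

lemma emb_uminus: "emb (- u) = - emb u"
  by (rule finseq_eqI) (auto simp: coord_emb coord_simps)

lemma emb_scale: "emb (r \<cdot>\<^sub>v u) = r *\<^sub>R emb u"
  by (rule finseq_eqI) (auto simp: coord_emb coord_simps)

lemma emb_zero: "emb (0\<^sub>v n) = 0"
  by (rule finseq_eqI) (auto simp: coord_emb coord_simps)

lemma emb_inject: "u \<in> carrier_vec n \<Longrightarrow> v \<in> carrier_vec n \<Longrightarrow> emb u = emb v \<longleftrightarrow> u = v"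
  using proj_emb by metis

lemma emb_eq_0: "u \<in> carrier_vec n \<Longrightarrow> emb u = 0 \<longleftrightarrow> u = 0\<^sub>v n"
  using emb_inject[of u n "0\<^sub>v n"] by (simp add: emb_zero)

lemma inner_emb: "u \<in> carrier_vec n \<Longrightarrow> v \<in> carrier_vec n \<Longrightarrow> inner (emb u) (emb v) = u \<bullet> v"
proof -
  assume uv: "u \<in> carrier_vec n" "v \<in> carrier_vec n"
  then have d: "dim_vec u = n" "dim_vec v = n" by auto
  have "{i. coord (emb u) i \<noteq> 0} \<subseteq> {0..<n}" by (auto simp: coord_emb d)
  then have "inner (emb u) (emb v) = (\<Sum>i\<in>{0..<n}. coord (emb u) i * coord (emb v) i)"
    by (intro inner_finseq_superset) simp
  also have "\<dots> = u \<bullet> v" unfolding scalar_prod_def d by (intro sum.cong) (simp_all add: coord_emb d)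
  finally show ?thesis .
qed

lemma norm_emb: "norm (emb u) = vnorm u"
  unfolding norm_finseq_def vnorm_def by (subst inner_emb[of u "dim_vec u"]) auto

lemma vec_Cauchy_Schwarz:
  "u \<in> carrier_vec n \<Longrightarrow> v \<in> carrier_vec n \<Longrightarrow> \<bar>u \<bullet> v\<bar> \<le> vnorm u * vnorm v"
  using Cauchy_Schwarz_ineq2[of "emb u" "emb v"] by (simp add: inner_emb norm_emb)

lemma vnorm_nonneg: "0 \<le> vnorm u"
  using norm_ge_zero[of "emb u"] by (simp add: norm_emb)

lemma vnorm_scale: "vnorm (r \<cdot>\<^sub>v u) = \<bar>r\<bar> * vnorm u"
  using norm_scaleR[of r "emb u"] by (simp add: emb_scale[symmetric] norm_emb)

lemma vnorm_pos: "u \<in> carrier_vec n \<Longrightarrow> u \<noteq> 0\<^sub>v n \<Longrightarrow> 0 < vnorm u"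
  using emb_eq_0[of u n] norm_emb[of u] by (metis zero_less_norm_iff)

lemma cosine_emb: "u \<in> carrier_vec n \<Longrightarrow> v \<in> carrier_vec n \<Longrightarrow>
    cosine (emb u) (emb v) = (u \<bullet> v) / (vnorm u * vnorm v)"
  by (simp add: cosine_def inner_emb norm_emb)

section \<open>The spectral norm as a bound for bilinear forms\<close>

text \<open>
The supremum in the spectral norm is over a bounded set: each entry of M v is bounded by the norm of
a row.
\<close>
lemma spectral_norm_bilinear:
  assumes M: "M \<in> carrier_mat p q" and u: "u \<in> carrier_vec p" and v: "v \<in> carrier_vec q"
  shows "\<bar>u \<bullet> (M *\<^sub>v v)\<bar> \<le> spectral_norm M * vnorm u * vnorm v"
proof -
  define S where "S = {vnorm (M *\<^sub>v v) | v. v \<in> carrier_vec (dim_col M) \<and> vnorm v \<le> 1}"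
  have bdd: "bdd_above S"
  proof (rule bdd_aboveI)
    fix r assume "r \<in> S"
    then obtain w where w: "w \<in> carrier_vec q" "vnorm w \<le> 1" "r = vnorm (M *\<^sub>v w)" using M by (auto simp: S_def)
    have row: "\<bar>row M i \<bullet> w\<bar> \<le> vnorm (row M i)" if "i < p" for i
    proof -
      have "\<bar>row M i \<bullet> w\<bar> \<le> vnorm (row M i) * vnorm w" using M w that by (intro vec_Cauchy_Schwarz[of _ q]) auto
      also have "\<dots> \<le> vnorm (row M i) * 1" using w by (intro mult_left_mono vnorm_nonneg) auto
      finally show ?thesis by simp
    qed
    have "(M *\<^sub>v w) \<bullet> (M *\<^sub>v w) = (\<Sum>i\<in>{0..<p}. (row M i \<bullet> w)\<^sup>2)"
      using M by (simp add: scalar_prod_def[of "M *\<^sub>v w"] power2_eq_square)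
    also have "\<dots> \<le> (\<Sum>i\<in>{0..<p}. (vnorm (row M i))\<^sup>2)"
      using row by (intro sum_mono) (auto simp: abs_le_square_iff[symmetric] vnorm_nonneg)
    finally show "r \<le> sqrt (\<Sum>i\<in>{0..<p}. (vnorm (row M i))\<^sup>2)"
      unfolding w(3) vnorm_def[of "M *\<^sub>v w"] by (rule real_sqrt_le_mono)
  qed
  have Mv: "vnorm (M *\<^sub>v v) \<le> spectral_norm M * vnorm v"
  proof (cases "v = 0\<^sub>v q")
    case True
    then have "M *\<^sub>v v = 0\<^sub>v p" using M by (auto intro!: eq_vecI)
    then show ?thesis using True by (simp add: vnorm_def)
  next
    case False
    then have pos: "0 < vnorm v" using vnorm_pos v by blast
    define w where "w = (1 / vnorm v) \<cdot>\<^sub>v v"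
    have w: "w \<in> carrier_vec q" "vnorm w = 1" using v pos by (auto simp: w_def vnorm_scale)
    have "vnorm (M *\<^sub>v w) \<le> Sup S" using M w by (intro cSup_upper bdd) (auto simp: S_def)
    moreover have "M *\<^sub>v w = (1 / vnorm v) \<cdot>\<^sub>v (M *\<^sub>v v)" unfolding w_def using M v by (simp add: mult_mat_vec)
    ultimately have "vnorm (M *\<^sub>v v) / vnorm v \<le> spectral_norm M"
      using pos by (simp add: vnorm_scale spectral_norm_def S_def)
    then show ?thesis using pos by (simp add: divide_le_eq)
  qed
  have "\<bar>u \<bullet> (M *\<^sub>v v)\<bar> \<le> vnorm u * vnorm (M *\<^sub>v v)" using M u v by (intro vec_Cauchy_Schwarz[of _ p]) auto
  also have "\<dots> \<le> vnorm u * (spectral_norm M * vnorm v)" using Mv by (intro mult_left_mono vnorm_nonneg)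
  finally show ?thesis by (simp add: mult_ac)
qed

section \<open>The swap matrix\<close>

text \<open>
The swap of unit vectors a and b in a coordinate free form: it has the eigenvalue 1 at a + b, the eigenvalue - 1 at a - b, and
vanishes on the orthogonal complement. For parallel a and b one of these two vectors is 0, and division by
0 makes its term vanish, as it should.
\<close>
definition swap_op :: "'a::real_inner \<Rightarrow> 'a \<Rightarrow> 'a \<Rightarrow> 'a" where
  "swap_op a b v = (inner (a + b) v / inner (a + b) (a + b)) *\<^sub>R (a + b)
     - (inner (a - b) v / inner (a - b) (a - b)) *\<^sub>R (a - b)"

lemma swap_op_swaps:
  assumes "norm a = 1" "norm b = 1" shows "swap_op a b a = b" "swap_op a b b = a"
proof -
  have ab: "inner a a = 1" "inner b b = 1" using assms by (auto simp: dot_square_norm)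
  have ratio: "(t / inner p p) *\<^sub>R p = r *\<^sub>R p" if "t = r * inner p p" for p :: 'a and t r
    using that by (cases "p = 0") simp_all
  have p: "(inner (a + b) a / inner (a + b) (a + b)) *\<^sub>R (a + b) = (1 / 2) *\<^sub>R (a + b)"
    "(inner (a + b) b / inner (a + b) (a + b)) *\<^sub>R (a + b) = (1 / 2) *\<^sub>R (a + b)"
    by (rule ratio; simp add: inner_add_left inner_add_right ab inner_commute[of b a])+
  have m: "(inner (a - b) a / inner (a - b) (a - b)) *\<^sub>R (a - b) = (1 / 2) *\<^sub>R (a - b)"
    "(inner (a - b) b / inner (a - b) (a - b)) *\<^sub>R (a - b) = - (1 / 2) *\<^sub>R (a - b)"
    by (rule ratio; simp add: inner_diff_left inner_diff_right ab inner_commute[of b a] field_simps)+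
  have half: "(1 / 2) *\<^sub>R x + (1 / 2) *\<^sub>R x = x" for x :: 'a
    by (simp add: scaleR_add_left[symmetric])
  have "swap_op a b a = (1 / 2) *\<^sub>R (a + b) - (1 / 2) *\<^sub>R (a - b)" unfolding swap_op_def p m ..
  also have "\<dots> = (1 / 2) *\<^sub>R b + (1 / 2) *\<^sub>R b" by (simp add: algebra_simps)
  finally show "swap_op a b a = b" unfolding half .
  have "swap_op a b b = (1 / 2) *\<^sub>R (a + b) - - (1 / 2) *\<^sub>R (a - b)" unfolding swap_op_def p m ..
  also have "\<dots> = (1 / 2) *\<^sub>R a + (1 / 2) *\<^sub>R a" by (simp add: algebra_simps)
  finally show "swap_op a b b = a" unfolding half .
qed

lemma swap_op_orthogonal:
  assumes "inner z a = 0" "inner z b = 0" shows "swap_op a b z = 0"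
proof -
  have "inner (a + b) z = 0" "inner (a - b) z = 0"
    using assms by (simp_all add: inner_commute[of _ z] inner_add_right inner_diff_right)
  then show ?thesis by (simp add: swap_op_def)
qed

lemma swap_op_bound: "\<bar>inner u (swap_op a b v)\<bar> \<le> 2 * norm u * norm v"
proof -
  have one: "\<bar>inner u ((inner p v / inner p p) *\<^sub>R p)\<bar> \<le> norm u * norm v" for p :: 'a
  proof (cases "p = 0")
    case False
    have "\<bar>inner p v\<bar> * \<bar>inner u p\<bar> \<le> (norm p * norm v) * (norm u * norm p)"
      by (intro mult_mono Cauchy_Schwarz_ineq2) auto
    then have "\<bar>inner p v * inner u p\<bar> \<le> norm u * norm v * inner p p"
      by (simp add: abs_mult dot_square_norm power2_eq_square mult_ac)
    then have "\<bar>inner p v * inner u p\<bar> / inner p p \<le> norm u * norm v" using False by (simp add: divide_le_eq)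
    then show ?thesis using False by (simp add: abs_mult)
  qed simp
  show ?thesis using one[of "a + b"] one[of "a - b"] unfolding swap_op_def inner_diff_right by linarith
qed

text \<open>
Removing from v its components along the orthogonal vectors a + b and a - b leaves a vector on which T vanishes.
\<close>
lemma swap_op_unique:
  fixes T :: "'a::real_inner \<Rightarrow> 'a"
  assumes lin: "linear T" and ab: "norm a = 1" "norm b = 1" "T a = b" "T b = a"
    and S: "subspace S" "a \<in> S" "b \<in> S" and orth: "\<And>z. z \<in> S \<Longrightarrow> inner z a = 0 \<Longrightarrow> inner z b = 0 \<Longrightarrow> T z = 0"
    and v: "v \<in> S"
  shows "T v = swap_op a b v"
proof -
  define p where "p = a + b" define m where "m = a - b"
  define \<alpha> where "\<alpha> = inner p v / inner p p" define \<beta> where "\<beta> = inner m v / inner m m"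
  define z where "z = v - \<alpha> *\<^sub>R p - \<beta> *\<^sub>R m"
  have "inner p m = inner a a - inner b b"
    by (simp add: p_def m_def inner_add_left inner_diff_right inner_commute[of b a])
  then have pm: "inner p m = 0" using ab by (simp add: dot_square_norm)
  have mp: "inner m p = 0" using pm by (simp add: inner_commute)
  have "\<alpha> * inner p p = inner v p" by (cases "p = 0") (simp_all add: \<alpha>_def inner_commute)
  then have "inner z p = 0" using mp by (simp add: z_def inner_diff_left)
  moreover have "\<beta> * inner m m = inner v m" by (cases "m = 0") (simp_all add: \<beta>_def inner_commute)
  then have "inner z m = 0" using pm by (simp add: z_def inner_diff_left)
  ultimately have zz: "inner z a = 0" "inner z b = 0"
    by (auto simp: p_def m_def inner_add_right inner_diff_right)
  have "z \<in> S" unfolding z_def p_def m_def using S v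
    by (intro subspace_diff subspace_scale subspace_add) auto
  then have Tz: "T z = 0" using orth zz by blast
  have T: "T p = p" "T m = - m" using ab by (auto simp: p_def m_def linear_add[OF lin] linear_diff[OF lin])
  have "T (z + \<alpha> *\<^sub>R p + \<beta> *\<^sub>R m) = \<alpha> *\<^sub>R p - \<beta> *\<^sub>R m"
    by (simp add: linear_add[OF lin] linear_cmul[OF lin] T Tz)
  moreover have "z + \<alpha> *\<^sub>R p + \<beta> *\<^sub>R m = v" by (simp add: z_def)
  ultimately have "T v = \<alpha> *\<^sub>R p - \<beta> *\<^sub>R m" by simp
  then show ?thesis by (simp add: swap_op_def \<alpha>_def \<beta>_def p_def m_def)
qed

lemma vunit_facts:
  assumes "x \<in> carrier_vec q" "x \<noteq> 0\<^sub>v q"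
  shows "vunit x \<in> carrier_vec q" "norm (emb (vunit x)) = 1" "x = vnorm x \<cdot>\<^sub>v vunit x"
  using assms vnorm_pos[OF assms] by (auto simp: vunit_def norm_emb vnorm_scale smult_smult_assoc)

lemma linear_emb_mat:
  "linear (\<lambda>z. emb (M *\<^sub>v proj q z))" if "M \<in> carrier_mat p q"
proof (rule linearI)
  fix a b :: finseq and r :: real
  show "emb (M *\<^sub>v proj q (a + b)) = emb (M *\<^sub>v proj q a) + emb (M *\<^sub>v proj q b)"
    using that by (simp add: proj_add mult_add_distrib_mat_vec[of _ p q] emb_add[of _ p])
  show "emb (M *\<^sub>v proj q (r *\<^sub>R a)) = r *\<^sub>R emb (M *\<^sub>v proj q a)"
    using that by (simp add: proj_scale mult_mat_vec[of _ p q] emb_scale)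
qed

text \<open>
The definite description in swap_mat is met by the matrix of swap_op, and by swap_op_unique by no other matrix.
\<close>
lemma swap_mat_op:
  assumes x: "x \<in> carrier_vec q" "x \<noteq> 0\<^sub>v q" and y: "y \<in> carrier_vec q" "y \<noteq> 0\<^sub>v q"
  shows "swap_mat x y \<in> carrier_mat q q"
    and "v \<in> carrier_vec q \<Longrightarrow> emb (swap_mat x y *\<^sub>v v) = swap_op (emb (vunit x)) (emb (vunit y)) (emb v)"
proof -
  define a where "a = emb (vunit x)" define b where "b = emb (vunit y)"
  note vx = vunit_facts[OF x] and vy = vunit_facts[OF y]
  define P where "P M \<longleftrightarrow> M \<in> carrier_mat (dim_vec x) (dim_vec x) \<and>
     M *\<^sub>v vunit x = vunit y \<and> M *\<^sub>v vunit y = vunit x \<and>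
     (\<forall>z \<in> carrier_vec (dim_vec x). z \<bullet> x = 0 \<and> z \<bullet> y = 0 \<longrightarrow> M *\<^sub>v z = 0\<^sub>v (dim_vec x))" for M
  have dx: "dim_vec x = q" using x by simp
  have ex: "emb x = vnorm x *\<^sub>R a" "emb y = vnorm y *\<^sub>R b"
    using arg_cong[OF vx(3), of emb] arg_cong[OF vy(3), of emb] by (simp_all add: emb_scale a_def b_def)
  have orth: "z \<bullet> x = vnorm x * inner (emb z) a" "z \<bullet> y = vnorm y * inner (emb z) b" if "z \<in> carrier_vec q" for z
    using inner_emb[OF that x(1)] inner_emb[OF that y(1)] by (simp_all add: ex)
  have uniq: "emb (M *\<^sub>v v) = swap_op a b (emb v)" if M: "P M" and v: "v \<in> carrier_vec q" for M v
  proof -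
    have Mc: "M \<in> carrier_mat q q" using M dx by (simp add: P_def)
    have "(\<lambda>z. emb (M *\<^sub>v proj q z)) (emb v) = swap_op a b (emb v)"
    proof (rule swap_op_unique[OF linear_emb_mat[OF Mc]])
      show "norm a = 1" "norm b = 1" using vx vy by (auto simp: a_def b_def)
      show "emb (M *\<^sub>v proj q a) = b" "emb (M *\<^sub>v proj q b) = a"
        using M vx vy by (auto simp: a_def b_def proj_emb P_def)
      show "subspace (coord_space q)" by (rule coord_space_subspace)
      show "a \<in> coord_space q" "b \<in> coord_space q" "emb v \<in> coord_space q"
        using vx vy v by (auto simp: a_def b_def emb_in)
      fix z assume z: "z \<in> coord_space q" "inner z a = 0" "inner z b = 0"
      have "proj q z \<bullet> x = 0" "proj q z \<bullet> y = 0" using z orth[of "proj q z"] by (simp_all add: emb_proj)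
      then have "M *\<^sub>v proj q z = 0\<^sub>v q" using M dx by (auto simp: P_def)
      then show "emb (M *\<^sub>v proj q z) = 0" by (simp add: emb_zero)
    qed
    then show ?thesis using v by (simp add: proj_emb)
  qed
  define S0 where "S0 = mat q q (\<lambda>(i, j).
      coord (a + b) i * coord (a + b) j / inner (a + b) (a + b) - coord (a - b) i * coord (a - b) j / inner (a - b) (a - b))"
  have in_sp: "a + b \<in> coord_space q" "a - b \<in> coord_space q"
    using vx vy coord_space_subspace by (auto simp: a_def b_def intro!: subspace_add subspace_diff emb_in)
  have inn: "inner w (emb v) = (\<Sum>j\<in>{0..<q}. coord w j * v $ j)" if "w \<in> coord_space q" "v \<in> carrier_vec q" for w v
    using that by (subst inner_finseq_superset[of "{0..<q}"]) (auto simp: coord_space_def coord_emb not_less[symmetric])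
  have S0v: "emb (S0 *\<^sub>v v) = swap_op a b (emb v)" if v: "v \<in> carrier_vec q" for v
  proof (rule finseq_eqI)
    fix i
    show "coord (emb (S0 *\<^sub>v v)) i = coord (swap_op a b (emb v)) i"
    proof (cases "i < q")
      case True
      have "coord (emb (S0 *\<^sub>v v)) i = (\<Sum>j\<in>{0..<q}. (coord (a + b) i * coord (a + b) j / inner (a + b) (a + b)
          - coord (a - b) i * coord (a - b) j / inner (a - b) (a - b)) * v $ j)"
        using True v by (simp add: coord_emb S0_def scalar_prod_def)
      also have "\<dots> = coord (a + b) i / inner (a + b) (a + b) * inner (a + b) (emb v)
         - coord (a - b) i / inner (a - b) (a - b) * inner (a - b) (emb v)"
        unfolding inn[OF in_sp(1) v] inn[OF in_sp(2) v] sum_distrib_left sum_subtractf[symmetric]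
        by (intro sum.cong refl) (simp add: algebra_simps)
      also have "\<dots> = coord (swap_op a b (emb v)) i"
        by (simp add: swap_op_def coord_diff[of "_ *\<^sub>R _" "_ *\<^sub>R _"] coord_scaleR mult.commute)
      finally show ?thesis .
    next
      case False
      then have "coord (a + b) i = 0" "coord (a - b) i = 0" using in_sp by (auto simp: coord_space_def)
      then have "coord (swap_op a b (emb v)) i = 0"
        by (simp add: swap_op_def coord_diff[of "_ *\<^sub>R _" "_ *\<^sub>R _"] coord_scaleR)
      then show ?thesis using False by (simp add: coord_emb S0_def)
    qed
  qed
  have S0c: "S0 \<in> carrier_mat q q" by (simp add: S0_def)
  have inj: "u = v" if "emb u = emb v" "u \<in> carrier_vec q" "v \<in> carrier_vec q" for u v
    using that emb_inject by blast
  have PS0: "P S0"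
    unfolding P_def dx
  proof (intro conjI ballI impI)
    show "S0 \<in> carrier_mat q q" by (rule S0c)
    have ab1: "norm a = 1" "norm b = 1" using vx vy by (auto simp: a_def b_def)
    show "S0 *\<^sub>v vunit x = vunit y"
      using S0v[OF vx(1)] swap_op_swaps(1)[OF ab1] S0c vx vy by (intro inj) (auto simp: a_def b_def)
    show "S0 *\<^sub>v vunit y = vunit x"
      using S0v[OF vy(1)] swap_op_swaps(2)[OF ab1] S0c vx vy by (intro inj) (auto simp: a_def b_def)
    fix z assume z: "z \<in> carrier_vec q" "z \<bullet> x = 0 \<and> z \<bullet> y = 0"
    have "inner (emb z) a = 0" "inner (emb z) b = 0"
      using orth[OF z(1)] z(2) vnorm_pos[OF x] vnorm_pos[OF y] by auto
    then have "emb (S0 *\<^sub>v z) = emb (0\<^sub>v q)" using S0v[OF z(1)] by (simp add: swap_op_orthogonal emb_zero)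
    then show "S0 *\<^sub>v z = 0\<^sub>v q" using S0c z by (intro inj) auto
  qed
  have "swap_mat x y = S0"
    unfolding swap_mat_def
  proof (rule the_equality)
    show "S0 \<in> carrier_mat (dim_vec x) (dim_vec x) \<and> S0 *\<^sub>v vunit x = vunit y \<and> S0 *\<^sub>v vunit y = vunit x \<and>
      (\<forall>z\<in>carrier_vec (dim_vec x). z \<bullet> x = 0 \<and> z \<bullet> y = 0 \<longrightarrow> S0 *\<^sub>v z = 0\<^sub>v (dim_vec x))"
      using PS0 by (simp add: P_def)
    fix M assume "M \<in> carrier_mat (dim_vec x) (dim_vec x) \<and> M *\<^sub>v vunit x = vunit y \<and> M *\<^sub>v vunit y = vunit x \<and>
      (\<forall>z\<in>carrier_vec (dim_vec x). z \<bullet> x = 0 \<and> z \<bullet> y = 0 \<longrightarrow> M *\<^sub>v z = 0\<^sub>v (dim_vec x))"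
    then have PM: "P M" by (simp add: P_def)
    then have Mc: "M \<in> carrier_mat q q" using dx by (simp add: P_def)
    have eq: "M *\<^sub>v v = S0 *\<^sub>v v" if "v \<in> carrier_vec q" for v
      using uniq[OF PM that] S0v[OF that] Mc S0c that by (intro inj) auto
    show "M = S0"
    proof (rule eq_matI)
      fix i j assume ij: "i < dim_row S0" "j < dim_col S0"
      then have "(M *\<^sub>v unit_vec q j) $ i = (S0 *\<^sub>v unit_vec q j) $ i" using eq[of "unit_vec q j"] by simp
      then show "M $$ (i, j) = S0 $$ (i, j)" using Mc S0c ij by (simp add: scalar_prod_right_unit)
    qed (use Mc S0c in auto)
  qed
  then show "swap_mat x y \<in> carrier_mat q q" "v \<in> carrier_vec q \<Longrightarrow> emb (swap_mat x y *\<^sub>v v) = swap_op (emb (vunit x)) (emb (vunit y)) (emb v)"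
    using S0c S0v by (auto simp: a_def b_def)
qed


section \<open>ReLU layers as masked linear maps\<close>

text \<open>
The linear piece of a ReLU layer with weights M that is active at x.
\<close>
definition masked :: "real mat \<Rightarrow> real vec \<Rightarrow> real vec \<Rightarrow> real vec" where
  "masked M x u = vec (dim_row M) (\<lambda>j. if 0 < row M j \<bullet> x then row M j \<bullet> u else 0)"

lemma masked_carrier: "M \<in> carrier_mat p q \<Longrightarrow> masked M x u \<in> carrier_vec p"
  by (simp add: masked_def)

lemma relu_eq_masked: "relu_vec (M *\<^sub>v x) = masked M x x"
  by (intro eq_vecI) (auto simp: relu_vec_def masked_def max_def)

lemma masked_add:
  assumes "M \<in> carrier_mat p q" "u \<in> carrier_vec q" "v \<in> carrier_vec q"
  shows "masked M x (u + v) = masked M x u + masked M x v"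
  by (intro eq_vecI) (use assms in \<open>auto simp: masked_def scalar_prod_add_distrib[of _ q]\<close>)

lemma masked_scale:
  assumes "M \<in> carrier_mat p q" "u \<in> carrier_vec q"
  shows "masked M x (r \<cdot>\<^sub>v u) = r \<cdot>\<^sub>v masked M x u"
  by (intro eq_vecI) (use assms in \<open>auto simp: masked_def scalar_prod_smult_distrib[of _ q]\<close>)

lemma masked_pos_scale:
  assumes "M \<in> carrier_mat p q" "x \<in> carrier_vec q" "0 < r"
  shows "masked M (r \<cdot>\<^sub>v x) u = masked M x u"
  by (intro eq_vecI) (use assms in \<open>auto simp: masked_def scalar_prod_smult_distrib[of _ q] zero_less_mult_iff\<close>)

text \<open>
For a = 0 the sign is that of b, otherwise that of a.
\<close>
lemma sign_germ:
  fixes a b :: real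
  shows "\<exists>\<delta>>0. \<exists>s. (\<forall>p. 0 < p \<and> p < \<delta> \<longrightarrow> (0 < a + p * b) = s) \<and> (0 < a \<longrightarrow> s) \<and> (a < 0 \<longrightarrow> \<not> s)"
proof -
  consider "a = 0" | "a \<noteq> 0" by blast
  then show ?thesis
  proof cases
    case 1
    then show ?thesis by (intro exI[of _ 1] conjI exI[of _ "0 < b"]) (auto simp: zero_less_mult_iff)
  next
    case 2
    define \<delta> where "\<delta> = \<bar>a\<bar> / (\<bar>b\<bar> + 1)"
    have "\<bar>p * b\<bar> < \<bar>a\<bar>" if "0 < p" "p < \<delta>" for p
    proof -
      have "\<bar>p * b\<bar> \<le> p * (\<bar>b\<bar> + 1)" using that by (simp add: abs_mult)
      also have "\<dots> < \<bar>a\<bar>" using that by (simp add: \<delta>_def less_divide_eq)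
      finally show ?thesis .
    qed
    then have "(0 < a + p * b) = (0 < a)" if "0 < p" "p < \<delta>" for p
      using that 2 by (smt (verit))
    moreover have "0 < \<delta>" using 2 by (simp add: \<delta>_def add_nonneg_pos)
    ultimately show ?thesis by (intro exI[of _ \<delta>] conjI exI[of _ "0 < a"]) auto
  qed
qed

lemma common_germ:
  assumes "\<And>j. j < (N::nat) \<Longrightarrow> \<exists>\<delta>>0::real. \<forall>p. 0 < p \<and> p < \<delta> \<longrightarrow> P j p"
  shows "\<exists>\<delta>>0. \<forall>p. 0 < p \<and> p < \<delta> \<longrightarrow> (\<forall>j<N. P j p)"
  using assms
proof (induction N)
  case (Suc N)
  obtain \<delta> where d: "\<delta> > 0" "\<And>p. 0 < p \<and> p < \<delta> \<Longrightarrow> \<forall>j<N. P j p" using Suc by fastforce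
  obtain \<delta>' where d': "\<delta>' > 0" "\<And>p. 0 < p \<and> p < \<delta>' \<Longrightarrow> P N p" using Suc.prems[of N] by auto
  show ?case using d d' by (intro exI[of _ "min \<delta> \<delta>'"]) (auto simp: less_Suc_eq)
qed (auto intro: exI[of _ 1])

text \<open>
A row orthogonal to z contributes 0 to the layer at z with either choice of the pattern.
\<close>
lemma masked_germ:
  assumes M: "M \<in> carrier_mat p q" and z: "z \<in> carrier_vec q" and u: "u \<in> carrier_vec q"
  shows "\<exists>\<delta>>0. \<exists>L. (\<forall>t. 0 < t \<and> t < \<delta> \<longrightarrow> masked M (z + t \<cdot>\<^sub>v u) = L) \<and> masked M z z = L z"
proof -
  define a where "a j = row M j \<bullet> z" for j
  define b where "b j = row M j \<bullet> u" for j
  have "\<forall>j. \<exists>s. \<exists>\<delta>>0. (\<forall>t. 0 < t \<and> t < \<delta> \<longrightarrow> (0 < a j + t * b j) = s) \<and> (0 < a j \<longrightarrow> s) \<and> (a j < 0 \<longrightarrow> \<not> s)"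
    using sign_germ by blast
  then obtain s where s: "\<And>j. \<exists>\<delta>>0. (\<forall>t. 0 < t \<and> t < \<delta> \<longrightarrow> (0 < a j + t * b j) = s j)"
    "\<And>j. 0 < a j \<Longrightarrow> s j" "\<And>j. a j < 0 \<Longrightarrow> \<not> s j" by metis
  obtain \<delta> where \<delta>: "\<delta> > 0" "\<And>t j. 0 < t \<and> t < \<delta> \<Longrightarrow> j < p \<Longrightarrow> (0 < a j + t * b j) = s j"
    using common_germ[of p "\<lambda>j t. (0 < a j + t * b j) = s j"] s(1) by blast
  define L where "L v = vec (dim_row M) (\<lambda>j. if s j then row M j \<bullet> v else 0)" for v
  show ?thesis
  proof (intro exI[of _ \<delta>] conjI exI[of _ L] allI impI \<delta>(1))
    fix t assume t: "0 < t \<and> t < \<delta>"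
    have act: "row M j \<bullet> (z + t \<cdot>\<^sub>v u) = a j + t * b j" if "j < p" for j
      using M z u that by (simp add: a_def b_def scalar_prod_add_distrib[of _ q] scalar_prod_smult_distrib[of _ q])
    show "masked M (z + t \<cdot>\<^sub>v u) = L"
    proof
      fix v
      show "masked M (z + t \<cdot>\<^sub>v u) v = L v"
        using M act \<delta>(2)[OF t] by (intro eq_vecI) (auto simp: masked_def L_def)
    qed
  next
    have "(if 0 < a j then a j else 0) = (if s j then a j else 0)" for j
      using s(2)[of j] s(3)[of j] by (cases "a j = 0") (auto simp: not_less le_less)
    moreover have "masked M z z = vec (dim_row M) (\<lambda>j. if 0 < a j then a j else 0)"
      "L z = vec (dim_row M) (\<lambda>j. if s j then a j else 0)" unfolding masked_def L_def a_def by (rule refl)+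
    ultimately show "masked M z z = L z" by simp
  qed
qed

lemma smult_mat_mult_vec:
  fixes M :: "real mat"
  assumes "M \<in> carrier_mat p q" "u \<in> carrier_vec q"
  shows "(r \<cdot>\<^sub>m M) *\<^sub>v u = r \<cdot>\<^sub>v (M *\<^sub>v u)"
  using assms by (intro eq_vecI) (auto simp: scalar_prod_def sum_distrib_left mult.assoc)

lemma active_gram_bilinear:
  assumes M: "M \<in> carrier_mat p q" and v: "v \<in> carrier_vec q" and u: "u \<in> carrier_vec q"
  shows "inner (emb (masked M x v)) (emb (masked M w u)) = v \<bullet> (active_gram M x w *\<^sub>v u)"
proof -
  define c where "c j = (of_bool (row M j \<bullet> x > 0) * of_bool (row M j \<bullet> w > 0) :: real)" for j
  have "inner (emb (masked M x v)) (emb (masked M w u)) = masked M x v \<bullet> masked M w u"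
    using M by (intro inner_emb[of _ p] masked_carrier)
  also have "\<dots> = (\<Sum>j\<in>{0..<p}. c j * ((row M j \<bullet> v) * (row M j \<bullet> u)))"
    unfolding scalar_prod_def[of "masked M x v"] using M by (intro sum.cong) (auto simp: masked_def c_def)
  also have "\<dots> = (\<Sum>j\<in>{0..<p}. \<Sum>a\<in>{0..<q}. \<Sum>b\<in>{0..<q}. v $ a * (c j * (row M j $ a * row M j $ b)) * u $ b)"
  proof (intro sum.cong refl)
    fix j assume "j \<in> {0..<p}"
    have "(row M j \<bullet> v) * (row M j \<bullet> u) = (\<Sum>a\<in>{0..<q}. \<Sum>b\<in>{0..<q}. (row M j $ a * v $ a) * (row M j $ b * u $ b))"
      unfolding scalar_prod_def carrier_vecD[OF v] carrier_vecD[OF u] by (rule sum_product)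
    then show "c j * ((row M j \<bullet> v) * (row M j \<bullet> u)) =
        (\<Sum>a\<in>{0..<q}. \<Sum>b\<in>{0..<q}. v $ a * (c j * (row M j $ a * row M j $ b)) * u $ b)"
      by (simp only: sum_distrib_left mult_ac)
  qed
  also have "\<dots> = (\<Sum>a\<in>{0..<q}. \<Sum>j\<in>{0..<p}. \<Sum>b\<in>{0..<q}. v $ a * (c j * (row M j $ a * row M j $ b)) * u $ b)"
    by (rule sum.swap)
  also have "\<dots> = (\<Sum>a\<in>{0..<q}. \<Sum>b\<in>{0..<q}. \<Sum>j\<in>{0..<p}. v $ a * (c j * (row M j $ a * row M j $ b)) * u $ b)"
    by (intro sum.cong refl sum.swap)
  also have "\<dots> = (\<Sum>a\<in>{0..<q}. v $ a * (\<Sum>b\<in>{0..<q}. (\<Sum>j\<in>{0..<p}. c j * (row M j $ a * row M j $ b)) * u $ b))"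
    by (simp only: sum_distrib_left sum_distrib_right mult.assoc)
  also have "\<dots> = v \<bullet> (active_gram M x w *\<^sub>v u)"
    unfolding scalar_prod_def[of v] using M u
    by (intro sum.cong) (auto simp: active_gram_def scalar_prod_def c_def lessThan_atLeast0)
  finally show ?thesis .
qed

lemma swap_op_scale: "swap_op a b (r *\<^sub>R v) = r *\<^sub>R swap_op a b v"
  by (simp add: swap_op_def scaleR_diff_right)

lemma emb_vunit: "emb (vunit x) = sgn (emb x)"
  by (simp add: vunit_def emb_scale norm_emb sgn_div_norm divide_inverse)

text \<open>
The WDC tested with two vectors. The factor 2 is the square of the normalization sqrt 2.
\<close>
lemma WDC_bilinear:
  assumes M: "M \<in> carrier_mat p q" and wdc: "WDC \<epsilon> M"
    and x: "x \<in> carrier_vec q" "x \<noteq> 0\<^sub>v q" and w: "w \<in> carrier_vec q" "w \<noteq> 0\<^sub>v q"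
    and v: "v \<in> carrier_vec q" and u: "u \<in> carrier_vec q"
  shows "\<bar>2 * inner (emb (masked M x v)) (emb (masked M w u))
     - (slope (cosine (emb x) (emb w)) * inner (emb v) (emb u)
        + sin (arccos (cosine (emb x) (emb w))) / pi * inner (emb v) (swap_op (sgn (emb x)) (sgn (emb w)) (emb u)))\<bar>
     \<le> 2 * \<epsilon> * norm (emb v) * norm (emb u)"
proof -
  define \<theta> where "\<theta> = arccos (cosine (emb x) (emb w))"
  have ang: "vangle x w = \<theta>" unfolding vangle_def \<theta>_def cosine_emb[OF x(1) w(1)] ..
  let ?G = "active_gram M x w" and ?S = "swap_mat x w"
  have S: "?S \<in> carrier_mat q q" by (rule swap_mat_op(1)[OF x w])
  have G: "?G \<in> carrier_mat q q" using M by (simp add: active_gram_def)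
  have I: "(1\<^sub>m (dim_vec x) :: real mat) \<in> carrier_mat q q" using x by simp
  have Q: "Q_mat x w \<in> carrier_mat q q" unfolding Q_mat_def using S I by auto
  have Su: "?S *\<^sub>v u \<in> carrier_vec q" using S u by simp
  have Qu: "Q_mat x w *\<^sub>v u = ((pi - \<theta>) / (2 * pi)) \<cdot>\<^sub>v u + (sin \<theta> / (2 * pi)) \<cdot>\<^sub>v (?S *\<^sub>v u)"
  proof -
    have "Q_mat x w *\<^sub>v u = (((pi - \<theta>) / (2 * pi)) \<cdot>\<^sub>m 1\<^sub>m q) *\<^sub>v u + ((sin \<theta> / (2 * pi)) \<cdot>\<^sub>m ?S) *\<^sub>v u"
      unfolding Q_mat_def ang using S u x by (subst add_mult_distrib_mat_vec[of _ q q]) auto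
    then show ?thesis using S u by (simp add: smult_mat_mult_vec[of _ q q])
  qed
  have vQu: "2 * (v \<bullet> (Q_mat x w *\<^sub>v u)) = slope (cosine (emb x) (emb w)) * inner (emb v) (emb u)
        + sin \<theta> / pi * inner (emb v) (swap_op (sgn (emb x)) (sgn (emb w)) (emb u))"
  proof -
    have "v \<bullet> (?S *\<^sub>v u) = inner (emb v) (swap_op (sgn (emb x)) (sgn (emb w)) (emb u))"
      using inner_emb[OF v Su] swap_mat_op(2)[OF x w u] by (simp add: emb_vunit)
    moreover have "v \<bullet> (Q_mat x w *\<^sub>v u) = (pi - \<theta>) / (2 * pi) * (v \<bullet> u) + sin \<theta> / (2 * pi) * (v \<bullet> (?S *\<^sub>v u))"
      unfolding Qu using v u Su by (simp add: scalar_prod_add_distrib[of _ q])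
    ultimately show ?thesis using inner_emb[OF v u]
      by (simp add: slope_def \<theta>_def[symmetric] field_simps)
  qed
  have spec: "spectral_norm (?G - Q_mat x w) \<le> \<epsilon>" using wdc x w M by (auto simp: WDC_def)
  have "\<bar>v \<bullet> ((?G - Q_mat x w) *\<^sub>v u)\<bar> \<le> spectral_norm (?G - Q_mat x w) * vnorm v * vnorm u"
    using Q v u by (intro spectral_norm_bilinear[of _ q q]) auto
  also have "\<dots> \<le> \<epsilon> * vnorm v * vnorm u" using spec by (intro mult_right_mono vnorm_nonneg)
  finally have b: "\<bar>v \<bullet> ((?G - Q_mat x w) *\<^sub>v u)\<bar> \<le> \<epsilon> * vnorm v * vnorm u" .
  have "v \<bullet> ((?G - Q_mat x w) *\<^sub>v u) = v \<bullet> (?G *\<^sub>v u) - v \<bullet> (Q_mat x w *\<^sub>v u)"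
    using G Q v u by (simp add: minus_mult_distrib_mat_vec[of _ q q] scalar_prod_minus_distrib[of _ q])
  then have "\<bar>2 * (v \<bullet> (?G *\<^sub>v u)) - 2 * (v \<bullet> (Q_mat x w *\<^sub>v u))\<bar> \<le> 2 * (\<epsilon> * vnorm v * vnorm u)"
    using b by simp
  then show ?thesis
    unfolding vQu active_gram_bilinear[OF M v u] \<theta>_def norm_emb by (simp add: mult.assoc)
qed

section \<open>Transfer to matrices and vectors\<close>

text \<open>
The setting of the theorem with 1/10^16 and 1/10^7 as the constants in the bounds for the WDC constant and the noise.
\<close>
locale recovery =
  fixes d k m :: nat and n :: "nat \<Rightarrow> nat" and W :: "nat \<Rightarrow> real mat" and A :: "real mat"
    and xstar e :: "real vec" and \<epsilon> :: real
  assumes d: "0 < d" and n0: "n 0 = k"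
    and W: "\<And>i. i \<in> {1..d} \<Longrightarrow> W i \<in> carrier_mat (n i) (n (i - 1))"
    and A: "A \<in> carrier_mat m (n d)"
    and xstar: "xstar \<in> carrier_vec k" "xstar \<noteq> 0\<^sub>v k" and e: "e \<in> carrier_vec m"
    and eps: "0 < \<epsilon>" "\<epsilon> \<le> 1 / 10 ^ 16 / real d ^ 90"
    and wdc: "\<And>i. i \<in> {1..d} \<Longrightarrow> WDC \<epsilon> (W i)"
    and rric: "RRIC \<epsilon> k (gen_net W d) A"
    and noise: "vnorm e \<le> 1 / 10 ^ 7 * vnorm xstar / (real d ^ 42 * 2 powr (real d / 2))"
begin

definition G :: "real vec \<Rightarrow> real vec" where "G = gen_net W d"

definition f :: "real vec \<Rightarrow> real" where "f = loss A G (A *\<^sub>v G xstar + e)"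

text \<open>
The value 0 behind the last layer makes the map linear for every index.
\<close>
definition layer :: "nat \<Rightarrow> finseq \<Rightarrow> finseq \<Rightarrow> finseq" where
  "layer i w u = (if i < d then sqrt 2 *\<^sub>R emb (masked (W (Suc i)) (proj (n i) w) (proj (n i) u)) else 0)"

definition scale :: real where "scale = sqrt 2 ^ d"

lemma W_Suc: "i < d \<Longrightarrow> W (Suc i) \<in> carrier_mat (n (Suc i)) (n i)"
  using W[of "Suc i"] by simp

lemma d1: "1 \<le> real d" using d by simp

lemma eps_small: "\<epsilon> \<le> 1 / 10 ^ 16" "\<epsilon> * real d ^ 90 \<le> 1 / 10 ^ 16" "real d * (2 * \<epsilon>) \<le> 1 / 100"
proof -
  have p: "1 \<le> real d ^ i" for i using d1 by (rule one_le_power)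
  show a: "\<epsilon> * real d ^ 90 \<le> 1 / 10 ^ 16" using eps d1 by (simp add: le_divide_eq)
  have "\<epsilon> * 1 \<le> \<epsilon> * real d ^ 90" using p eps by (intro mult_left_mono) auto
  then show "\<epsilon> \<le> 1 / 10 ^ 16" using a by simp
  have "real d ^ 1 \<le> real d ^ 90" using d1 by (intro power_increasing) auto
  then have "\<epsilon> * real d ^ 1 \<le> \<epsilon> * real d ^ 90" using eps by (intro mult_left_mono) auto
  then show "real d * (2 * \<epsilon>) \<le> 1 / 100" using a by (simp add: mult.commute)
qed

lemma layer_inner: "i < d \<Longrightarrow> inner (layer i x v) (layer i w u) =
    2 * inner (emb (masked (W (Suc i)) (proj (n i) x) (proj (n i) v))) (emb (masked (W (Suc i)) (proj (n i) w) (proj (n i) u)))"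
  by (simp add: layer_def)

lemma layer_WDC:
  assumes i: "i < d" and mem: "x \<in> coord_space (n i)" "w \<in> coord_space (n i)" "v \<in> coord_space (n i)" "u \<in> coord_space (n i)"
    and nz: "x \<noteq> 0" "w \<noteq> 0"
  shows "\<bar>inner (layer i x v) (layer i w u) - (slope (cosine x w) * inner v u
        + sin (arccos (cosine x w)) / pi * inner v (swap_op (sgn x) (sgn w) u))\<bar> \<le> 2 * \<epsilon> * norm v * norm u"
proof -
  have "proj (n i) x \<noteq> 0\<^sub>v (n i)" "proj (n i) w \<noteq> 0\<^sub>v (n i)"
    using nz emb_proj[OF mem(1)] emb_proj[OF mem(2)] by (auto simp: emb_zero)
  then show ?thesis
    using WDC_bilinear[OF W_Suc[OF i] wdc[of "Suc i"], of "proj (n i) x" "proj (n i) w" "proj (n i) v" "proj (n i) u"] i mem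
    by (simp add: layer_inner emb_proj)
qed

interpretation N: network "\<lambda>i. coord_space (n i)" layer d "2 * \<epsilon>"
proof (rule network.intro)
  fix i :: nat and x w u v z :: finseq
  show "subspace (coord_space (n i))" by (rule coord_space_subspace)
  show "linear (layer i w)"
  proof (cases "i < d")
    case True
    show ?thesis
      using W_Suc[OF True] True
      by (intro linearI) (auto simp: layer_def proj_add proj_scale masked_add[of _ "n (Suc i)" "n i"] masked_scale[of _ "n (Suc i)" "n i"]
        emb_add[of _ "n (Suc i)"] masked_carrier emb_scale scaleR_add_right)
  next
    case False
    then have "layer i w = (\<lambda>_. 0)" by (auto simp: layer_def)
    then show ?thesis by (auto intro: linearI)
  qed
  show "0 \<le> 2 * \<epsilon>" using eps by simp
  show "real d * (2 * \<epsilon>) \<le> 1 / 100" by (rule eps_small)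
  assume i: "i < d"
  show "layer i w u \<in> coord_space (n (Suc i))"
    using W_Suc[OF i] i by (auto simp: layer_def intro!: subspace_scale[OF coord_space_subspace] emb_in masked_carrier)
  show "\<exists>\<delta>>0. \<exists>L. (\<forall>p. 0 < p \<and> p < \<delta> \<longrightarrow> layer i (z + p *\<^sub>R u) = L) \<and> layer i z z = L z"
  proof -
    obtain \<delta> L where \<delta>: "\<delta> > 0"
      and L: "\<And>t. 0 < t \<and> t < \<delta> \<Longrightarrow> masked (W (Suc i)) (proj (n i) z + t \<cdot>\<^sub>v proj (n i) u) = L"
        "masked (W (Suc i)) (proj (n i) z) (proj (n i) z) = L (proj (n i) z)"
      using masked_germ[OF W_Suc[OF i] proj_carrier(1) proj_carrier(1), of z u] by blast
    show ?thesis
      using i \<delta> L by (intro exI[of _ \<delta>] conjI exI[of _ "\<lambda>v. sqrt 2 *\<^sub>R emb (L (proj (n i) v))"])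
        (auto simp: layer_def proj_add proj_scale fun_eq_iff)
  qed
  assume mem: "x \<in> coord_space (n i)" "w \<in> coord_space (n i)" "u \<in> coord_space (n i)" and nz: "x \<noteq> 0" "w \<noteq> 0"
  have sg: "norm (sgn w) = 1" "norm (sgn x) = 1" using nz by (auto simp: norm_sgn)
  have "swap_op (sgn w) (sgn x) x = norm x *\<^sub>R sgn w"
  proof -
    have "swap_op (sgn w) (sgn x) (norm x *\<^sub>R sgn x) = norm x *\<^sub>R sgn w"
      unfolding swap_op_scale swap_op_swaps(2)[OF sg] ..
    then show ?thesis using nz by (simp add: sgn_div_norm)
  qed
  then have "inner u (swap_op (sgn w) (sgn x) x) = norm x / norm w * inner w u"
    by (simp add: sgn_div_norm inner_commute divide_inverse)
  then show "\<bar>inner (layer i x x) (layer i w u) - (slope (cosine x w) * inner x u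
           + sin (arccos (cosine x w)) / pi * (norm x / norm w * inner w u))\<bar> \<le> 2 * \<epsilon> * norm x * norm u"
    using layer_WDC[OF i mem(2,1,3,1) nz(2,1)]
    by (simp add: cosine_commute[of w x] inner_commute[of u x] inner_commute[of "layer i w u"] mult.commute mult.left_commute)
  assume vm: "v \<in> coord_space (n i)"
  define \<theta> where "\<theta> = arccos (cosine x w)"
  have th: "0 \<le> \<theta>" "\<theta> \<le> pi"
    using cosine_abs[of x w] unfolding \<theta>_def by (auto intro: arccos_lbound arccos_ubound simp: abs_le_iff)
  define B where "B = inner v (swap_op (sgn x) (sgn w) u)"
  define P where "P = norm v * norm u"
  have P0: "0 \<le> P" by (simp add: P_def)
  have "\<bar>inner (layer i x v) (layer i w u) - (slope (cosine x w) * inner v u + sin \<theta> / pi * B)\<bar> \<le> 2 * \<epsilon> * P"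
    using layer_WDC[OF i mem(1,2) vm mem(3) nz] by (simp add: \<theta>_def B_def P_def mult.assoc)
  moreover have "slope (cosine x w) * inner v u = inner v u - \<theta> / pi * inner v u"
    by (simp add: slope_def \<theta>_def algebra_simps)
  moreover have "\<bar>\<theta> / pi * inner v u\<bar> \<le> \<theta> / pi * P"
    unfolding abs_mult P_def using th Cauchy_Schwarz_ineq2[of v u] by (intro mult_mono) auto
  moreover have "\<bar>sin \<theta> / pi * B\<bar> \<le> \<theta> / pi * (2 * P)"
    unfolding abs_mult
  proof (intro mult_mono)
    show "\<bar>sin \<theta> / pi\<bar> \<le> \<theta> / pi" using sin_lipschitz[of \<theta> 0] th by (simp add: divide_right_mono)
    show "\<bar>B\<bar> \<le> 2 * P" unfolding B_def P_def using swap_op_bound[of v "sgn x" "sgn w" u] by simp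
  qed (use th in auto)
  moreover have "\<theta> / pi * P + \<theta> / pi * (2 * P) \<le> 2 * \<theta> * P"
  proof -
    have "3 * \<theta> \<le> 2 * \<theta> * pi" using th pi_ge_two mult_left_mono[of 2 pi \<theta>] by simp
    then have "3 * (\<theta> / pi) \<le> 2 * \<theta>" by (simp add: divide_le_eq)
    then have "3 * (\<theta> / pi) * P \<le> 2 * \<theta> * P" using P0 by (rule mult_right_mono)
    then show ?thesis by (simp add: algebra_simps)
  qed
  moreover have "\<bar>X - Z\<bar> \<le> e1 + e4"
    if "\<bar>X - (s + b)\<bar> \<le> e1" "s = Z - a" "\<bar>a\<bar> \<le> e2" "\<bar>b\<bar> \<le> e3" "e2 + e3 \<le> e4"
    for X Z s a b e1 e2 e3 e4 :: real
    using that by linarith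
  ultimately have "\<bar>inner (layer i x v) (layer i w u) - inner v u\<bar> \<le> 2 * \<epsilon> * P + 2 * \<theta> * P"
    by blast
  then show "\<bar>inner (layer i x v) (layer i w u) - inner v u\<bar> \<le> (2 * \<epsilon> + 2 * arccos (cosine x w)) * norm v * norm u"
    by (simp add: P_def \<theta>_def algebra_simps)
qed

lemma gen_net_carrier: "i \<le> d \<Longrightarrow> x \<in> carrier_vec k \<Longrightarrow> gen_net W i x \<in> carrier_vec (n i)"
proof (induction i)
  case (Suc i)
  then show ?case using W_Suc[of i] by (simp add: relu_vec_def)
qed (simp add: n0)

lemma net_emb: "i \<le> d \<Longrightarrow> x \<in> carrier_vec k \<Longrightarrow> N.net i (emb x) = sqrt 2 ^ i *\<^sub>R emb (gen_net W i x)"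
proof (induction i)
  case (Suc i)
  have i: "i < d" using Suc by simp
  define g where "g = gen_net W i x"
  have g: "g \<in> carrier_vec (n i)" unfolding g_def using Suc by (intro gen_net_carrier) auto
  have r: "0 < sqrt 2 ^ i" by simp
  have pr: "proj (n i) (sqrt 2 ^ i *\<^sub>R emb g) = sqrt 2 ^ i \<cdot>\<^sub>v g"
    using g by (simp add: proj_scale proj_emb)
  have "masked (W (Suc i)) (sqrt 2 ^ i \<cdot>\<^sub>v g) (sqrt 2 ^ i \<cdot>\<^sub>v g) = sqrt 2 ^ i \<cdot>\<^sub>v masked (W (Suc i)) g g"
    using masked_pos_scale[OF W_Suc[OF i] g r] masked_scale[OF W_Suc[OF i] g] by simp
  then have "layer i (sqrt 2 ^ i *\<^sub>R emb g) (sqrt 2 ^ i *\<^sub>R emb g) = sqrt 2 ^ Suc i *\<^sub>R emb (masked (W (Suc i)) g g)"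
    using i by (simp add: layer_def pr emb_scale)
  then show ?case using Suc i by (simp add: g_def[symmetric] relu_eq_masked)
qed simp

definition R :: "finseq \<Rightarrow> finseq" where "R x = scale *\<^sub>R emb (A *\<^sub>v G (proj k x))"

text \<open>
The exponent 3 of d is larger than the error of the layers requires. It makes alpha * delta^2 at
least of order d^4 * epsilon, which is the decrease per step that the bound on the number of steps needs.
\<close>
definition \<delta> :: real where "\<delta> = 48 * real d ^ 3 * sqrt \<epsilon> + 3 * (scale * vnorm e / vnorm xstar)"

lemma scale: "0 < scale" "scale * scale = 2 ^ d" "scale = 2 powr (real d / 2)"
proof -
  show "0 < scale" by (simp add: scale_def)
  have "scale * scale = (sqrt 2 * sqrt 2) ^ d" unfolding scale_def by (rule power_mult_distrib[symmetric])
  then show "scale * scale = 2 ^ d" by simp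
  have "scale = (2 powr (1/2)) powr real d" by (simp add: scale_def powr_half_sqrt powr_realpow)
  then show "scale = 2 powr (real d / 2)" by (simp add: powr_powr)
qed

lemma xstar_pos: "0 < vnorm xstar" using vnorm_pos xstar by blast

lemma noise_scaled: "scale * vnorm e / vnorm xstar \<le> 1 / 10 ^ 7 / real d ^ 42"
  using noise xstar_pos d1 scale(1) unfolding scale(3)[symmetric] by (simp add: field_simps)

lemma delta_small: "\<delta> * real d ^ 4 \<le> 1 / 10 ^ 6"
proof -
  have dd: "0 < real d" using d by simp
  have s: "sqrt \<epsilon> * real d ^ 45 \<le> 1 / 10 ^ 8"
  proof (rule power2_le_imp_le)
    have "(sqrt \<epsilon> * real d ^ 45)\<^sup>2 = \<epsilon> * real d ^ 90"
      using eps by (simp add: power_mult_distrib power_mult[symmetric])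
    then show "(sqrt \<epsilon> * real d ^ 45)\<^sup>2 \<le> (1 / 10 ^ 8)\<^sup>2" using eps_small(2) by (simp add: power2_eq_square)
  qed simp
  have "sqrt \<epsilon> * real d ^ 7 \<le> sqrt \<epsilon> * real d ^ 45"
    using d1 eps by (intro mult_left_mono power_increasing) auto
  then have 1: "sqrt \<epsilon> * real d ^ 7 \<le> 1 / 10 ^ 8" using s by linarith
  have "1 / 10 ^ 7 / real d ^ 42 * real d ^ 4 \<le> 1 / 10 ^ 7"
  proof -
    have "real d ^ 4 \<le> real d ^ 42" using d1 by (intro power_increasing) auto
    then show ?thesis using dd by (simp add: divide_le_eq)
  qed
  moreover have "scale * vnorm e / vnorm xstar * real d ^ 4 \<le> 1 / 10 ^ 7 / real d ^ 42 * real d ^ 4"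
    using noise_scaled by (intro mult_right_mono) auto
  ultimately have 2: "scale * vnorm e / vnorm xstar * real d ^ 4 \<le> 1 / 10 ^ 7" by linarith
  have p7: "real d ^ 7 = real d ^ 3 * real d ^ 4" by (simp add: power_add[symmetric])
  have "\<delta> * real d ^ 4 = 48 * (sqrt \<epsilon> * real d ^ 7) + 3 * (scale * vnorm e / vnorm xstar * real d ^ 4)"
    unfolding \<delta>_def p7 by (simp add: algebra_simps)
  then show ?thesis using 1 2 by simp
qed

interpretation S: sensing "\<lambda>i. coord_space (n i)" layer d "2 * \<epsilon>" R "emb xstar" "scale *\<^sub>R emb e" \<delta>
proof
  fix x1 x2 x3 x4 assume mem: "x1 \<in> coord_space (n 0)" "x2 \<in> coord_space (n 0)" "x3 \<in> coord_space (n 0)" "x4 \<in> coord_space (n 0)"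
  define g where "g x = G (proj k x)" for x
  have gc: "g x \<in> carrier_vec (n d)" for x unfolding g_def G_def by (intro gen_net_carrier) auto
  have net: "N.net d x = scale *\<^sub>R emb (g x)" if "x \<in> coord_space (n 0)" for x
    using net_emb[of d "proj k x"] that n0 by (simp add: emb_proj g_def G_def scale_def)
  have nd: "N.net d x - N.net d x' = scale *\<^sub>R emb (g x - g x')" if "x \<in> coord_space (n 0)" "x' \<in> coord_space (n 0)" for x x'
    using net that emb_diff[OF gc gc] by (simp add: scaleR_diff_right)
  have rd: "R x - R x' = scale *\<^sub>R emb (A *\<^sub>v (g x - g x'))" for x x'
    using A gc[of x] gc[of x'] emb_diff[of "A *\<^sub>v g x" m "A *\<^sub>v g x'"]
    by (simp add: R_def g_def[symmetric] scaleR_diff_right mult_minus_distrib_mat_vec[of _ m "n d"])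
  have gd: "g x - g x' \<in> carrier_vec (n d)" for x x' using gc by simp
  define p where "p = g x1 - g x2" define q where "q = g x3 - g x4"
  have pq: "p \<in> carrier_vec (n d)" "q \<in> carrier_vec (n d)" using gd by (auto simp: p_def q_def)
  have "\<bar>(A *\<^sub>v p) \<bullet> (A *\<^sub>v q) - p \<bullet> q\<bar> \<le> \<epsilon> * vnorm p * vnorm q"
    using rric unfolding RRIC_def p_def q_def g_def G_def by simp
  also have "\<dots> \<le> 2 * \<epsilon> * vnorm p * vnorm q" using eps by (intro mult_right_mono vnorm_nonneg) auto
  finally have b: "\<bar>inner (emb (A *\<^sub>v p)) (emb (A *\<^sub>v q)) - inner (emb p) (emb q)\<bar> \<le> 2 * \<epsilon> * vnorm p * vnorm q"
    using A pq by (simp add: inner_emb[of _ m] inner_emb[of _ "n d"])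
  have "scale * scale * \<bar>inner (emb (A *\<^sub>v p)) (emb (A *\<^sub>v q)) - inner (emb p) (emb q)\<bar> \<le> scale * scale * (2 * \<epsilon> * vnorm p * vnorm q)"
    using b scale by (intro mult_left_mono) auto
  then have "\<bar>scale * scale * (inner (emb (A *\<^sub>v p)) (emb (A *\<^sub>v q)) - inner (emb p) (emb q))\<bar> \<le> scale * scale * (2 * \<epsilon> * vnorm p * vnorm q)"
    using scale by (simp add: abs_mult)
  then show "\<bar>inner (R x1 - R x2) (R x3 - R x4) - inner (N.net d x1 - N.net d x2) (N.net d x3 - N.net d x4)\<bar>
        \<le> 2 * \<epsilon> * norm (N.net d x1 - N.net d x2) * norm (N.net d x3 - N.net d x4)"
    unfolding nd[OF mem(1,2)] nd[OF mem(3,4)] rd p_def[symmetric] q_def[symmetric]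
    using scale(1) by (simp add: norm_emb right_diff_distrib mult_ac)
next
  have "N.net d (emb (0\<^sub>v k)) = 0" by (simp add: emb_zero N.net_zero)
  then have "sqrt 2 ^ d *\<^sub>R emb (gen_net W d (0\<^sub>v k)) = 0" using net_emb[of d "0\<^sub>v k"] by simp
  then have "emb (gen_net W d (0\<^sub>v k)) = 0" by simp
  then have "G (0\<^sub>v k) = 0\<^sub>v (n d)" using emb_eq_0[OF gen_net_carrier[of d "0\<^sub>v k"]] by (simp add: G_def)
  moreover have "proj k 0 = 0\<^sub>v k" using proj_emb[of "0\<^sub>v k" k] by (simp add: emb_zero)
  moreover have "A *\<^sub>v 0\<^sub>v (n d) = 0\<^sub>v m" using A by (auto intro!: eq_vecI)
  ultimately show "R 0 = 0" by (simp add: R_def emb_zero)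
next
  show "emb xstar \<in> coord_space (n 0)" using xstar n0 by (simp add: emb_in)
  show "emb xstar \<noteq> 0" using xstar emb_eq_0 by blast
  show "0 < d" by (rule d)
  have c: "0 \<le> scale * vnorm e / vnorm xstar" using scale xstar_pos vnorm_nonneg[of e] by simp
  show "0 < \<delta>" unfolding \<delta>_def using c eps d by (intro add_pos_nonneg) auto
  show "\<delta> * real d ^ 4 \<le> 1 / 10 ^ 6" by (rule delta_small)
  have "N.tau \<le> 2 * real d * sqrt \<epsilon>"
    unfolding N.tau_def
  proof (rule real_le_lsqrt)
    have "real d * 1 \<le> real d * real d" using d1 by (intro mult_left_mono) auto
    then have "real d * (2 * \<epsilon>) \<le> 4 * (real d * real d) * \<epsilon>" using eps mult_right_mono[of "real d" "real d * real d" "2 * \<epsilon>"] by simp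
    also have "\<dots> = (2 * real d * sqrt \<epsilon>)\<^sup>2" using eps by (simp add: power_mult_distrib power2_eq_square)
    finally show "real d * (2 * \<epsilon>) \<le> (2 * real d * sqrt \<epsilon>)\<^sup>2" .
  qed (use eps in auto)
  then have "24 * real d * N.tau \<le> 24 * real d * (2 * real d * sqrt \<epsilon>)" by (intro mult_left_mono) auto
  also have "\<dots> = 48 * real d ^ 2 * sqrt \<epsilon>" by (simp add: power2_eq_square)
  also have "\<dots> \<le> 48 * real d ^ 3 * sqrt \<epsilon>"
    using d1 eps by (intro mult_right_mono mult_left_mono power_increasing) auto
  finally have "24 * real d * N.tau * vnorm xstar \<le> 48 * real d ^ 3 * sqrt \<epsilon> * vnorm xstar"
    by (rule mult_right_mono) (rule vnorm_nonneg)
  moreover have "\<delta> * vnorm xstar = 48 * real d ^ 3 * sqrt \<epsilon> * vnorm xstar + 3 * (scale * vnorm e)"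
    using xstar_pos by (simp add: \<delta>_def distrib_right)
  ultimately show "24 * real d * N.tau * norm (emb xstar) + 3 * norm (scale *\<^sub>R emb e) \<le> \<delta> * norm (emb xstar)"
    using scale(1) by (simp add: norm_emb)
qed

lemma objective_emb: "x \<in> carrier_vec k \<Longrightarrow> S.objective (emb x) = 2 ^ d * f x"
proof -
  assume x: "x \<in> carrier_vec k"
  have c: "A *\<^sub>v G x \<in> carrier_vec m" "A *\<^sub>v G xstar \<in> carrier_vec m"
    using A x xstar by (auto simp: G_def intro!: mult_mat_vec_carrier gen_net_carrier)
  have "R (emb x) - R (emb xstar) - scale *\<^sub>R emb e = scale *\<^sub>R emb (A *\<^sub>v G x - (A *\<^sub>v G xstar + e))"
    using x xstar c e by (simp add: R_def proj_emb emb_diff[of _ m] emb_add[of _ m] algebra_simps)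
  then have "S.objective (emb x) = (scale * vnorm (A *\<^sub>v G x - (A *\<^sub>v G xstar + e)))\<^sup>2 / 2"
    using scale(1) by (simp add: S.objective_def norm_emb)
  then show ?thesis by (simp add: f_def loss_def power_mult_distrib power2_eq_square[of scale] scale(2))
qed

text \<open>
A bound for the difference quotients near x bounds their upper limit, hence the Clarke directional derivative.
\<close>
lemma clarke_emb:
  assumes x: "x \<in> carrier_vec k" and v: "v \<in> clarke_subdiff f x"
  shows "N.clarke_at S.objective (emb x) (2 ^ d *\<^sub>R emb v)"
  unfolding N.clarke_at_def
proof (intro ballI allI impI)
  fix U L assume U: "U \<in> coord_space (n 0)"
    and H: "\<forall>\<gamma>>0. \<exists>r>0. \<forall>z\<in>coord_space (n 0). \<forall>t. norm (z - emb x) < r \<and> 0 < t \<and> t < r \<longrightarrow>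
      (S.objective (z + t *\<^sub>R U) - S.objective z) / t \<le> L + \<gamma>"
  define u where "u = proj k U"
  have u: "u \<in> carrier_vec k" "emb u = U" using U n0 by (auto simp: u_def emb_proj)
  have dx: "dim_vec x = k" using x by simp
  have vc: "v \<in> carrier_vec k" and vu: "ereal (v \<bullet> u) \<le> clarke_dir_deriv f x u"
    using v u dx by (auto simp: clarke_subdiff_def)
  have D: "(0::real) < 2 ^ d" by simp
  show "inner (2 ^ d *\<^sub>R emb v) U \<le> L"
  proof (rule field_le_epsilon)
    fix \<gamma> :: real assume "0 < \<gamma>"
    then obtain r where r: "r > 0" and Hr: "\<And>z t. z \<in> coord_space (n 0) \<Longrightarrow> norm (z - emb x) < r \<Longrightarrow> 0 < t \<Longrightarrow> t < r \<Longrightarrow>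
      (S.objective (z + t *\<^sub>R U) - S.objective z) / t \<le> L + \<gamma>" using H by blast
    have q: "(f (y + t \<cdot>\<^sub>v u) - f y) / t \<le> (L + \<gamma>) / 2 ^ d"
      if y: "y \<in> carrier_vec k" "vnorm (y - x) < r" and t: "0 < t" "t < r" for y t
    proof -
      have "norm (emb y - emb x) < r" using y x by (simp add: emb_diff[symmetric] norm_emb)
      then have "(S.objective (emb y + t *\<^sub>R U) - S.objective (emb y)) / t \<le> L + \<gamma>"
        using y t n0 by (intro Hr) (auto simp: emb_in)
      moreover have "emb y + t *\<^sub>R U = emb (y + t \<cdot>\<^sub>v u)" using y u by (simp add: emb_add[of _ k] emb_scale)
      ultimately have "2 ^ d * ((f (y + t \<cdot>\<^sub>v u) - f y) / t) \<le> L + \<gamma>"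
        using y u by (simp add: objective_emb right_diff_distrib)
      then show ?thesis using D by (simp add: le_divide_eq mult.commute)
    qed
    have "eventually (\<lambda>y. y \<in> carrier_vec k \<and> vnorm (y - x) < r) (vec_nhds x)"
      unfolding vec_nhds_def dx eventually_inf_principal eventually_filtercomap
    proof (intro exI[of _ "\<lambda>s. s < r"] conjI allI impI)
      show "\<forall>\<^sub>F s in nhds 0. s < r" using r by (intro eventually_nhds_in_open[of "{..<r}", simplified]) auto
    qed auto
    moreover have "eventually (\<lambda>t. 0 < t \<and> t < r) (at_right (0::real))"
      using r by (auto simp: eventually_at_right_field)
    ultimately have "eventually (\<lambda>p. (fst p \<in> carrier_vec k \<and> vnorm (fst p - x) < r) \<and> (0 < snd p \<and> snd p < r))
       (vec_nhds x \<times>\<^sub>F at_right (0::real))" by (rule eventually_prodI)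
    then have "eventually (\<lambda>p. (case p of (y, t) \<Rightarrow> ereal ((f (y + t \<cdot>\<^sub>v u) - f y) / t)) \<le> ereal ((L + \<gamma>) / 2 ^ d))
       (vec_nhds x \<times>\<^sub>F at_right (0::real))"
      by (rule eventually_mono) (auto intro!: q)
    then have "clarke_dir_deriv f x u \<le> ereal ((L + \<gamma>) / 2 ^ d)"
      unfolding clarke_dir_deriv_def by (rule Limsup_bounded)
    then have "ereal (v \<bullet> u) \<le> ereal ((L + \<gamma>) / 2 ^ d)" using vu by (rule order_trans[rotated])
    then have "2 ^ d * (v \<bullet> u) \<le> L + \<gamma>" using D by (simp add: le_divide_eq mult.commute)
    then show "inner (2 ^ d *\<^sub>R emb v) U \<le> L + \<gamma>" using inner_emb[OF vc u(1)] u(2) by simp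
  qed
qed

lemma flip_emb: "x \<in> carrier_vec k \<Longrightarrow> S.flip (emb x) = emb (sign_select f x)"
  using objective_emb[of x] objective_emb[of "- x"] by (simp add: S.flip_def sign_select_def emb_uminus)

lemma sign_select_carrier: "x \<in> carrier_vec k \<Longrightarrow> sign_select f x \<in> carrier_vec k"
  by (simp add: sign_select_def)

text \<open>
The normalized result in the original scale. The decrease per step is at least 41472 d^4 epsilon |xstar|^2, and
the radius is 260 d^3 delta |xstar| plus the noise, where delta is inserted.
\<close>
theorem run_converges:
  assumes \<nu>: "\<nu> = 1 / 4 * 2 ^ d / (real d)\<^sup>2" and C: "C = 1 - \<nu> / 2 ^ d * (7 / 8)"
    and run: "subgradient_run k f \<nu> X"
  shows "0 < C \<and> C < 1 \<and>
      (\<exists>N::nat.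
        real N \<le> f (X 0) * 2 ^ d / (real d ^ 4 * \<epsilon> * (vnorm xstar)\<^sup>2) \<and>
        vnorm (X N - xstar)
          \<le> 12480 * real d ^ 9 * vnorm xstar * sqrt \<epsilon> + 781 * real d ^ 6 * 2 powr (real d / 2) * vnorm e \<and>
        (\<forall>i\<ge>N.
          vnorm (X (i + 1) - xstar)
            \<le> C ^ (i + 1 - N) * vnorm (X N - xstar) + 24 / 7 * 2 powr (real d / 2) * vnorm e \<and>
          vnorm (G (X (i + 1)) - G xstar)
            \<le> 1.2 / 2 powr (real d / 2) * C ^ (i + 1 - N) * vnorm (X N - xstar)
              + 1.2 * (24 / 7) * vnorm e))"
proof -
  have nu: "\<nu> = S.alpha * 2 ^ d" by (simp add: \<nu> S.alpha_def)
  have CC: "C = S.contraction" by (simp add: C nu S.contraction_def)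
  have Xc: "X i \<in> carrier_vec k" for i
  proof (induction i)
    case (Suc i)
    obtain v where v: "v \<in> clarke_subdiff f (sign_select f (X i))" "X (Suc i) = sign_select f (X i) - \<nu> \<cdot>\<^sub>v v"
      using run by (auto simp: subgradient_run_def)
    have "v \<in> carrier_vec k" using v(1) sign_select_carrier[OF Suc] by (auto simp: clarke_subdiff_def)
    then show ?case unfolding v(2) using sign_select_carrier[OF Suc] by simp
  qed (use run in \<open>simp add: subgradient_run_def\<close>)
  have "\<exists>N. real N * S.decrement \<le> S.objective (emb (X 0))
    \<and> norm (emb (X N) - emb xstar) \<le> 260 * real d ^ 3 * \<delta> * norm (emb xstar) + norm (scale *\<^sub>R emb e)
    \<and> (\<forall>j. norm (emb (X (N + j)) - emb xstar) \<le> S.contraction ^ j * norm (emb (X N) - emb xstar) + 24 / 7 * norm (scale *\<^sub>R emb e)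
         \<and> norm (N.net d (emb (X (N + j))) - N.net d (emb xstar)) \<le> 6 / 5 * norm (emb (X (N + j)) - emb xstar))"
  proof (rule S.subgradient_method_converges)
    show "emb (X 0) \<in> coord_space (n 0)" using Xc n0 by (simp add: emb_in)
    show "emb (X 0) \<noteq> 0" using run emb_eq_0[OF Xc, of 0] by (simp add: subgradient_run_def)
    fix i
    obtain v where v: "v \<in> clarke_subdiff f (sign_select f (X i))" "X (Suc i) = sign_select f (X i) - \<nu> \<cdot>\<^sub>v v"
      using run by (auto simp: subgradient_run_def)
    have sel: "sign_select f (X i) \<in> carrier_vec k" by (rule sign_select_carrier[OF Xc])
    have vc: "v \<in> carrier_vec k" using v(1) sel by (auto simp: clarke_subdiff_def)
    show "\<exists>v\<in>coord_space (n 0). N.clarke_at S.objective (S.flip (emb (X i))) v \<and>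
        emb (X (Suc i)) = S.flip (emb (X i)) - S.alpha *\<^sub>R v"
    proof (intro bexI[of _ "2 ^ d *\<^sub>R emb v"] conjI)
      show "N.clarke_at S.objective (S.flip (emb (X i))) (2 ^ d *\<^sub>R emb v)"
        unfolding flip_emb[OF Xc] by (rule clarke_emb[OF sel v(1)])
      show "emb (X (Suc i)) = S.flip (emb (X i)) - S.alpha *\<^sub>R 2 ^ d *\<^sub>R emb v"
        unfolding flip_emb[OF Xc] v(2) using sel vc by (simp add: emb_diff[of _ k] emb_scale nu)
      show "2 ^ d *\<^sub>R emb v \<in> coord_space (n 0)"
        using vc n0 by (intro subspace_scale[OF coord_space_subspace]) (simp add: emb_in)
    qed
  qed
  then obtain N where N: "real N * S.decrement \<le> S.objective (emb (X 0))"
    "norm (emb (X N) - emb xstar) \<le> 260 * real d ^ 3 * \<delta> * norm (emb xstar) + norm (scale *\<^sub>R emb e)"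
    "\<And>j. norm (emb (X (N + j)) - emb xstar) \<le> S.contraction ^ j * norm (emb (X N) - emb xstar) + 24 / 7 * norm (scale *\<^sub>R emb e)"
    "\<And>j. norm (N.net d (emb (X (N + j))) - N.net d (emb xstar)) \<le> 6 / 5 * norm (emb (X (N + j)) - emb xstar)"
    by blast
  have dist: "norm (emb (X i) - emb xstar) = vnorm (X i - xstar)" for i
    using Xc xstar by (simp add: emb_diff[of _ k, symmetric] norm_emb)
  have ne: "norm (scale *\<^sub>R emb e) = scale * vnorm e" using scale(1) by (simp add: norm_emb)
  have netd: "norm (N.net d (emb (X i)) - N.net d (emb xstar)) = scale * vnorm (G (X i) - G xstar)" for i
  proof -
    have "N.net d (emb (X i)) - N.net d (emb xstar) = scale *\<^sub>R emb (G (X i) - G xstar)"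
      using net_emb[OF order_refl Xc] net_emb[OF order_refl xstar(1)] emb_diff[of "G (X i)" "n d" "G xstar"]
        gen_net_carrier[OF order_refl Xc] gen_net_carrier[OF order_refl xstar(1)]
      by (simp add: scale_def G_def scaleR_diff_right)
    then show ?thesis using scale(1) by (simp add: norm_emb)
  qed
  define Y where "Y = vnorm xstar"
  have Y: "0 < Y" using xstar_pos by (simp add: Y_def)
  have dpow: "real d ^ i \<le> real d ^ j" if "i \<le> j" for i j using d1 that by (intro power_increasing) auto
  have iterations: "real N \<le> f (X 0) * 2 ^ d / (real d ^ 4 * \<epsilon> * Y\<^sup>2)"
  proof -
    have "real d ^ 4 * \<epsilon> * Y\<^sup>2 \<le> S.decrement"
    proof -
      have "48 * real d ^ 3 * sqrt \<epsilon> \<le> \<delta>"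
        using scale(1) xstar_pos vnorm_nonneg[of e] by (simp add: \<delta>_def)
      then have "(48 * real d ^ 3 * sqrt \<epsilon>)\<^sup>2 \<le> \<delta>\<^sup>2" using eps by (intro power_mono) auto
      then have "72 * S.alpha * (48 * real d ^ 3 * sqrt \<epsilon>)\<^sup>2 * Y\<^sup>2 \<le> S.decrement"
        unfolding S.decrement_def norm_emb Y_def using S.alpha by (intro mult_right_mono mult_left_mono) auto
      moreover have "72 * S.alpha * (48 * real d ^ 3 * sqrt \<epsilon>)\<^sup>2 * Y\<^sup>2 = 41472 * (real d ^ 4 * \<epsilon> * Y\<^sup>2)"
        using d eps by (simp add: S.alpha_def power_mult_distrib field_simps eval_nat_numeral)
      moreover have "0 \<le> real d ^ 4 * \<epsilon> * Y\<^sup>2" using eps by simp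
      ultimately show ?thesis by linarith
    qed
    then have "real N * (real d ^ 4 * \<epsilon> * Y\<^sup>2) \<le> real N * S.decrement" by (intro mult_left_mono) auto
    then have "real N * (real d ^ 4 * \<epsilon> * Y\<^sup>2) \<le> f (X 0) * 2 ^ d"
      using N(1) objective_emb[OF Xc, of 0] by (simp add: mult.commute)
    moreover have "0 < real d ^ 4 * \<epsilon> * Y\<^sup>2" using d eps Y by simp
    ultimately show ?thesis by (simp add: le_divide_eq)
  qed
  have radius: "vnorm (X N - xstar) \<le> 12480 * real d ^ 9 * Y * sqrt \<epsilon> + 781 * real d ^ 6 * scale * vnorm e"
  proof -
    have "260 * real d ^ 3 * \<delta> * Y = 12480 * real d ^ 6 * (Y * sqrt \<epsilon>) + 780 * real d ^ 3 * (scale * vnorm e)"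
      using Y by (simp add: \<delta>_def Y_def distrib_left distrib_right power_add[symmetric])
    also have "\<dots> \<le> 12480 * real d ^ 9 * (Y * sqrt \<epsilon>) + 780 * real d ^ 6 * (scale * vnorm e)"
      using dpow[of 6 9] dpow[of 3 6] Y eps scale(1) vnorm_nonneg[of e] by (intro add_mono mult_right_mono) auto
    finally have "260 * real d ^ 3 * \<delta> * Y \<le> 12480 * real d ^ 9 * (Y * sqrt \<epsilon>) + 780 * real d ^ 6 * (scale * vnorm e)" .
    moreover have "1 * (scale * vnorm e) \<le> real d ^ 6 * (scale * vnorm e)"
      using d1 scale(1) vnorm_nonneg[of e] by (intro mult_right_mono one_le_power) auto
    moreover have "781 * real d ^ 6 * scale * vnorm e = 780 * real d ^ 6 * (scale * vnorm e) + real d ^ 6 * (scale * vnorm e)" by simp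
    moreover have "12480 * real d ^ 9 * Y * sqrt \<epsilon> = 12480 * real d ^ 9 * (Y * sqrt \<epsilon>)" by simp
    ultimately show ?thesis using N(2) unfolding dist ne norm_emb Y_def[symmetric] by linarith
  qed
  have linear_rate: "vnorm (X (i + 1) - xstar) \<le> C ^ (i + 1 - N) * vnorm (X N - xstar) + 24 / 7 * scale * vnorm e \<and>
      vnorm (G (X (i + 1)) - G xstar) \<le> 1.2 / scale * C ^ (i + 1 - N) * vnorm (X N - xstar) + 1.2 * (24 / 7) * vnorm e"
    if i: "N \<le> i" for i
  proof
    have Nj: "N + (i + 1 - N) = i + 1" using i by simp
    show 1: "vnorm (X (i + 1) - xstar) \<le> C ^ (i + 1 - N) * vnorm (X N - xstar) + 24 / 7 * scale * vnorm e"
      using N(3)[of "i + 1 - N"] unfolding Nj dist ne CC by simp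
    have "scale * vnorm (G (X (i + 1)) - G xstar) \<le> 6 / 5 * vnorm (X (i + 1) - xstar)"
      using N(4)[of "i + 1 - N"] unfolding Nj dist netd by simp
    also have "\<dots> \<le> 6 / 5 * (C ^ (i + 1 - N) * vnorm (X N - xstar) + 24 / 7 * scale * vnorm e)"
      using 1 by (rule mult_left_mono) simp
    also have "\<dots> = scale * (1.2 / scale * C ^ (i + 1 - N) * vnorm (X N - xstar) + 1.2 * (24 / 7) * vnorm e)"
      using scale(1) by (simp add: field_simps)
    finally show "vnorm (G (X (i + 1)) - G xstar) \<le> 1.2 / scale * C ^ (i + 1 - N) * vnorm (X N - xstar) + 1.2 * (24 / 7) * vnorm e"
      using scale(1) by (simp only: mult_le_cancel_left_pos)
  qed
  show ?thesis
    unfolding scale(3)[symmetric] Y_def[symmetric]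
    using S.contraction iterations radius linear_rate CC by (intro conjI exI[of _ N]) auto
qed

end

theorem theorem3p1:
  shows "\<exists>K1 K2 K3 K4 K5 K6 K7 :: real.
    K1 > 0 \<and> K2 > 0 \<and> K3 > 0 \<and> K4 > 0 \<and> K5 > 0 \<and> K6 > 0 \<and> K7 > 0 \<and>
    (\<forall>(d::nat) (k::nat) (m::nat) (n :: nat \<Rightarrow> nat) (W :: nat \<Rightarrow> real mat) (A :: real mat)
       (xstar :: real vec) (e :: real vec) (\<epsilon>::real) (X :: nat \<Rightarrow> real vec)
       (G :: real vec \<Rightarrow> real vec) (f :: real vec \<Rightarrow> real) (\<nu>::real) (C::real).
      d > 0 \<and> k > 0 \<and> m > 0 \<and> n 0 = k \<and> (\<forall>i\<in>{1..d}. n i > 0) \<and>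
      (\<forall>i\<in>{1..d}. W i \<in> carrier_mat (n i) (n (i - 1))) \<and>
      A \<in> carrier_mat m (n d) \<and>
      xstar \<in> carrier_vec k \<and> xstar \<noteq> 0\<^sub>v k \<and>
      e \<in> carrier_vec m \<and>
      G = gen_net W d \<and>
      f = loss A G (A *\<^sub>v G xstar + e) \<and>
      0 < \<epsilon> \<and> \<epsilon> \<le> K1 / real d ^ 90 \<and>
      (\<forall>i\<in>{1..d}. WDC \<epsilon> (W i)) \<and>
      RRIC \<epsilon> k G A \<and>
      vnorm e \<le> K2 * vnorm xstar / (real d ^ 42 * 2 powr (real d / 2)) \<and>
      \<nu> = K3 * 2 ^ d / (real d)\<^sup>2 \<and>
      C = 1 - \<nu> / 2 ^ d * (7 / 8) \<and>
      subgradient_run k f \<nu> X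
      \<longrightarrow>
      0 < C \<and> C < 1 \<and>
      (\<exists>N::nat.
        real N \<le> K4 * f (X 0) * 2 ^ d / (real d ^ 4 * \<epsilon> * (vnorm xstar)\<^sup>2) \<and>
        vnorm (X N - xstar)
          \<le> K5 * real d ^ 9 * vnorm xstar * sqrt \<epsilon> + K6 * real d ^ 6 * 2 powr (real d / 2) * vnorm e \<and>
        (\<forall>i\<ge>N.
          vnorm (X (i + 1) - xstar)
            \<le> C ^ (i + 1 - N) * vnorm (X N - xstar) + K7 * 2 powr (real d / 2) * vnorm e \<and>
          vnorm (G (X (i + 1)) - G xstar)
            \<le> 1.2 / 2 powr (real d / 2) * C ^ (i + 1 - N) * vnorm (X N - xstar)
              + 1.2 * K7 * vnorm e)))"
proof (rule exI[of _ "1 / 10 ^ 16"], rule exI[of _ "1 / 10 ^ 7"], rule exI[of _ "1 / 4"], rule exI[of _ "1"],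
    rule exI[of _ "12480"], rule exI[of _ "781"], rule exI[of _ "24 / 7"], (rule conjI, simp)+, (rule allI)+,
    rule impI, goal_cases)
  case (1 d k m n W A xstar e \<epsilon> X G f \<nu> C)
  then interpret rc: recovery d k m n W A xstar e \<epsilon> by unfold_locales auto
  have eqs: "G = rc.G" "f = rc.f" using 1 by (simp_all add: rc.G_def rc.f_def)
  have "\<nu> = 1 / 4 * 2 ^ d / (real d)\<^sup>2" "C = 1 - \<nu> / 2 ^ d * (7 / 8)" "subgradient_run k rc.f \<nu> X"
    using 1 unfolding eqs[symmetric] by blast+
  from rc.run_converges[OF this] show ?case by (simp only: eqs mult_1_left)
qed


end
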